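(* The Moyal coproduct $\Delta_{\mathrm h}:(\mathrm{Sym}\,L)[\mathrm h]\to(\mathrm{Sym}\,L)[\mathrm h]\otimes_{\mathbf k[\mathrm h]}(\mathrm{Sym}\,L)[\mathrm h]$ is coassociative: $(1\otimes\Delta_{\mathrm h})\Delta_{\mathrm h}(P)=(\Delta_{\mathrm h}\otimes1)\Delta_{\mathrm h}(P)$ for all $P$.
   Context: Let $\mathbf k$ be a field of characteristic $0$ and $Q$ a quiver with vertex set $I$. The double $\overline Q$ has edges $e,e^*$ for $e\in Q$, with $e^*$ the reverse of $e$, $(e^* )^*=e$; $*$ is edge reversal. $L$ is the $\mathbf k$-space with basis the cyclic paths (necklaces) in $\overline Q$ up to rotation, including the trivial path at each vertex. $\mathrm{Sym}\,L$ (product $\&$, over $\mathbf k$) has basis the collections $P=P_1\&\cdots\&P_k\&v_1\&\cdots\&v_q$ with $P_i=a_{i1}\cdots a_{il_i}$ necklaces of positive length and $v_s\in I$. The set of abstract edges of $P$ is $X=\{(i,j):1\le i\le k,1\le j\le l_i\}$, $\mathrm{pr}_X(i,j)=a_{ij}$, $(i,j)+1=(i,j+1)$ with $j$ modulo $l_i$. **Coproduct.** For a collection $P$, $$\Delta_{\mathrm h}(P)=\sum_{(J,\phi)}\frac{\mathrm h^{\#J/2}}{2^{\#J/2}}P_{J,\phi},$$ over all $J\subset X$ with involution $\phi:J\to J$ satisfying $\mathrm{pr}_X\circ\phi=*\circ\mathrm{pr}_X$; extend $\mathbf k[\mathrm h]$-linearly. To define $P_{J,\phi}$, let $f:X\to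 X$, $f(x)=x+1$ for $x\notin J$, $f(x)=\phi(x)+1$ for $x\in J$. Let $R_1\&\cdots\&R_m$ be the collection with one member for each orbit of $f$ (the necklace of the edges of the orbit not in $J$ read in order, or, if the orbit lies in $J$, the trivial path at the start vertex of any of its edges), together with the original trivial paths $v_1,\dots,v_q$. Let $g:X\to\{1,\dots,m\}$ send $x$ to the index of the member given by the $f$-orbit of $x$. Then $$P_{J,\phi}=\sum_{\mathbf c\in\{1,2\}^m}s(\mathbf c,J,\phi)\,R_1^{c_1}\&\cdots\&R_m^{c_m},$$ where $R^{1}=R\otimes1$, $R^{2}=1\otimes R$, and $(A\otimes B)\&(A'\otimes B')=(A\&A')\otimes(B\&B')$. Writing $J=\{x_1,\phi(x_1),\dots,x_N,\phi(x_N)\}$ with $\mathrm{pr}_X(x_i)\in Q$, $s(\mathbf c,J,\phi)=s_1\cdots s_N$ with $s_i=1$ if $c_{g(x_i)}<c_{g(x_i+1)}$, $s_i=0$ if equal, and $s_i=-1$ if $c_{g(x_i)}>c_{g(x_i+1)}$. *)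

theory Defs
  imports
    "HOL-Library.Poly_Mapping"
    "HOL-Library.Product_Plus"
    "HOL-Library.Multiset"
    "HOL-Library.FuncSet"
    "HOL-Computational_Algebra.Polynomial"
    "HOL-Combinatorics.Orbits"
    "Graph_Theory.Arc_Walk"
begin

section \<open>Free modules and tensor products\<close>

text \<open>
  A free \<open>R\<close>-module with basis \<open>B\<close> is represented by the finitely supported functions with
  support in \<open>B\<close>; the tensor product over \<open>R\<close> of the free modules on \<open>A\<close> and \<open>B\<close> is the free
  module on \<open>A \<times> B\<close>.
\<close>

definition free_module :: "'a set \<Rightarrow> ('a \<Rightarrow>\<^sub>0 'r::comm_ring_1) set" where
  "free_module B = {F. Poly_Mapping.keys F \<subseteq> B}"

definition linear_extension ::
    "('a \<Rightarrow> ('b \<Rightarrow>\<^sub>0 'r)) \<Rightarrow> ('a \<Rightarrow>\<^sub>0 'r) \<Rightarrow> ('b \<Rightarrow>\<^sub>0 'r::comm_ring_1)" where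
  "linear_extension g F =
     (\<Sum>a\<in>Poly_Mapping.keys F. Poly_Mapping.map ((*) (Poly_Mapping.lookup F a)) (g a))"

definition tensor ::
    "('a \<Rightarrow>\<^sub>0 'r) \<Rightarrow> ('b \<Rightarrow>\<^sub>0 'r) \<Rightarrow> ('a \<times> 'b \<Rightarrow>\<^sub>0 'r::comm_ring_1)" where
  "tensor F G =
     (\<Sum>a\<in>Poly_Mapping.keys F. \<Sum>b\<in>Poly_Mapping.keys G.
        Poly_Mapping.single (a, b) (Poly_Mapping.lookup F a * Poly_Mapping.lookup G b))"

definition tensor_map ::
    "(('a \<Rightarrow>\<^sub>0 'r) \<Rightarrow> ('c \<Rightarrow>\<^sub>0 'r)) \<Rightarrow> (('b \<Rightarrow>\<^sub>0 'r) \<Rightarrow> ('d \<Rightarrow>\<^sub>0 'r)) \<Rightarrow>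
     ('a \<times> 'b \<Rightarrow>\<^sub>0 'r) \<Rightarrow> ('c \<times> 'd \<Rightarrow>\<^sub>0 'r::comm_ring_1)" where
  "tensor_map S T =
     linear_extension
       (\<lambda>(a, b). tensor (S (Poly_Mapping.single a 1)) (T (Poly_Mapping.single b 1)))"

definition tensor_assoc ::
    "(('a \<times> 'b) \<times> 'c \<Rightarrow>\<^sub>0 'r) \<Rightarrow> ('a \<times> 'b \<times> 'c \<Rightarrow>\<^sub>0 'r::comm_ring_1)" where
  "tensor_assoc = linear_extension (\<lambda>((a, b), c). Poly_Mapping.single (a, b, c) 1)"


section \<open>Necklaces in the double quiver\<close>

text \<open>
  A quiver is a \<^const>\<open>wf_digraph\<close>: loops, parallel edges and infinitely many vertices or edges
  are allowed. In the double, \<^term>\<open>Inl e\<close> is the edge \<open>e\<close> and \<^term>\<open>Inr e\<close> is \<open>e\<^sup>*\<close>.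
\<close>

definition double_quiver :: "('v, 'e) pre_digraph \<Rightarrow> ('v, 'e + 'e) pre_digraph" where
  "double_quiver Q =
     \<lparr>verts = verts Q, arcs = arcs Q <+> arcs Q,
      tail = case_sum (tail Q) (head Q), head = case_sum (head Q) (tail Q)\<rparr>"

definition edge_reversal :: "'e + 'e \<Rightarrow> 'e + 'e" where
  "edge_reversal = case_sum Inr Inl"

definition rotation_equiv :: "'a list \<Rightarrow> 'a list \<Rightarrow> bool" where
  "rotation_equiv xs ys \<longleftrightarrow> (\<exists>n. ys = rotate n xs)"

lemma equivp_rotation_equiv: "equivp (rotation_equiv :: 'a list \<Rightarrow> 'a list \<Rightarrow> bool)"
proof (rule equivpI)
  show "reflp rotation_equiv"
    by (rule reflpI) (auto simp: rotation_equiv_def intro: exI[of _ 0])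
  show "symp (rotation_equiv :: 'a list \<Rightarrow> 'a list \<Rightarrow> bool)"
  proof (rule sympI)
    fix xs ys :: "'a list"
    assume "rotation_equiv xs ys"
    then obtain n where n: "ys = rotate n xs"
      by (auto simp: rotation_equiv_def)
    have "xs = rotate (length xs - n mod length xs) ys"
    proof (cases "xs = []")
      case False
      then have "n mod length xs < length xs"
        by simp
      then have "rotate (length xs - n mod length xs) (rotate (n mod length xs) xs) = xs"
        by (simp add: rotate_rotate)
      then show ?thesis
        unfolding n by (metis rotate_conv_mod)
    qed (simp add: n)
    then show "rotation_equiv ys xs"
      unfolding rotation_equiv_def by blast
  qed
  show "transp rotation_equiv"
    by (rule transpI) (auto simp: rotation_equiv_def rotate_rotate)
qed

quotient_type 'a cyclic_word = "'a list" / rotation_equiv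
  morphisms rep_cyclic_word cyclic_word
  by (rule equivp_rotation_equiv)

datatype ('v, 'e) necklace = Trivial 'v | Cyclic "('e + 'e) cyclic_word"

definition cyclic_path :: "('v, 'e) pre_digraph \<Rightarrow> ('e + 'e) list \<Rightarrow> bool" where
  "cyclic_path Q w \<longleftrightarrow> w \<noteq> [] \<and> (\<exists>u. pre_digraph.awalk (double_quiver Q) u w u)"

definition necklaces :: "('v, 'e) pre_digraph \<Rightarrow> ('v, 'e) necklace set" where
  "necklaces Q = Trivial ` verts Q \<union> {Cyclic (cyclic_word w) | w. cyclic_path Q w}"

text \<open>
  The ring \<open>(Sym L)[h]\<close> is \<^term>\<open>Sym_L Q\<close>, with coefficients in \<open>k[h] = 'k poly\<close>. Its product
  \<open>&\<close> is the multiplication \<open>*\<close> of \<open>\<Rightarrow>\<^sub>0\<close>, which adds exponents, here multisets. Likewise \<open>*\<close> on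
  functions supported on pairs of multisets is the product \<open>&\<close> of \<open>(Sym L)[h] \<otimes> (Sym L)[h]\<close>.
\<close>

type_synonym ('v, 'e) collection = "('v, 'e) necklace multiset"

definition collections :: "('v, 'e) pre_digraph \<Rightarrow> ('v, 'e) collection set" where
  "collections Q = {P. set_mset P \<subseteq> necklaces Q}"

definition Sym_L :: "('v, 'e) pre_digraph \<Rightarrow> (('v, 'e) collection \<Rightarrow>\<^sub>0 'k::field_char_0 poly) set" where
  "Sym_L Q = free_module (collections Q)"

definition Sym_L_tensor_Sym_L ::
    "('v, 'e) pre_digraph \<Rightarrow>
     (('v, 'e) collection \<times> ('v, 'e) collection \<Rightarrow>\<^sub>0 'k::field_char_0 poly) set" where
  "Sym_L_tensor_Sym_L Q = free_module (collections Q \<times> collections Q)"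


section \<open>The Moyal coproduct\<close>

text \<open>
  The collection \<open>P\<^sub>1 & \<dots> & P\<^sub>k & v\<^sub>1 & \<dots> & v\<^sub>q\<close> is presented by the list \<open>ws\<close> of words
  representing \<open>P\<^sub>1, \<dots>, P\<^sub>k\<close> and the list \<open>vs = [v\<^sub>1, \<dots>, v\<^sub>q]\<close>. Indices start at 0.
\<close>

definition presents ::
    "('e + 'e) list list \<Rightarrow> 'v list \<Rightarrow> ('v, 'e) collection \<Rightarrow> bool" where
  "presents ws vs P \<longleftrightarrow>
     [] \<notin> set ws \<and>
     P = mset (map (\<lambda>w. Cyclic (cyclic_word w)) ws) + mset (map Trivial vs)"

definition abstract_edges :: "'a list list \<Rightarrow> (nat \<times> nat) set" where
  "abstract_edges ws = (SIGMA i:{..<length ws}. {..<length (ws ! i)})"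

definition edge_of :: "'a list list \<Rightarrow> nat \<times> nat \<Rightarrow> 'a" where
  "edge_of ws = (\<lambda>(i, j). ws ! i ! j)"

definition next_edge :: "'a list list \<Rightarrow> nat \<times> nat \<Rightarrow> nat \<times> nat" where
  "next_edge ws = (\<lambda>(i, j). (i, Suc j mod length (ws ! i)))"

definition pairings ::
    "('e + 'e) list list \<Rightarrow> ((nat \<times> nat) set \<times> (nat \<times> nat \<Rightarrow> nat \<times> nat)) set" where
  "pairings ws =
     {(J, \<phi>). J \<subseteq> abstract_edges ws \<and> \<phi> \<in> J \<rightarrow>\<^sub>E J \<and>
        (\<forall>x\<in>J. \<phi> (\<phi> x) = x \<and> edge_of ws (\<phi> x) = edge_reversal (edge_of ws x))}"

definition successor ::
    "'a list list \<Rightarrow> (nat \<times> nat) set \<Rightarrow> (nat \<times> nat \<Rightarrow> nat \<times> nat) \<Rightarrow> nat \<times> nat \<Rightarrow> nat \<times> nat" where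
  "successor ws J \<phi> x = (if x \<in> J then next_edge ws (\<phi> x) else next_edge ws x)"

definition orbit_necklace ::
    "('v, 'e) pre_digraph \<Rightarrow> ('e + 'e) list list \<Rightarrow>
     (nat \<times> nat) set \<Rightarrow> (nat \<times> nat \<Rightarrow> nat \<times> nat) \<Rightarrow> nat \<times> nat \<Rightarrow> ('v, 'e) necklace" where
  "orbit_necklace Q ws J \<phi> x =
     (let f = successor ws J \<phi> in
      if orbit f x \<subseteq> J then Trivial (tail (double_quiver Q) (edge_of ws x))
      else Cyclic (cyclic_word (map (edge_of ws)
             (filter (\<lambda>y. y \<notin> J) (map (\<lambda>n. (f ^^ n) x) [0..<card (orbit f x)])))))"

text \<open>
  The members \<open>R\<^sub>1, \<dots>, R\<^sub>m\<close> are indexed by \<^term>\<open>Inl A\<close> for the orbits \<open>A\<close> of \<^const>\<open>successor\<close>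
  and \<^term>\<open>Inr s\<close> for the positions \<open>s\<close> in the list of trivial paths. The base point chosen in
  an orbit affects neither the necklace read off nor the start vertex.
\<close>

type_synonym member_index = "(nat \<times> nat) set + nat"

definition member_indices ::
    "'a list list \<Rightarrow> 'v list \<Rightarrow> (nat \<times> nat) set \<Rightarrow> (nat \<times> nat \<Rightarrow> nat \<times> nat) \<Rightarrow>
     member_index set" where
  "member_indices ws vs J \<phi> =
     (orbit (successor ws J \<phi>) ` abstract_edges ws) <+> {..<length vs}"

definition member ::
    "('v, 'e) pre_digraph \<Rightarrow> ('e + 'e) list list \<Rightarrow> 'v list \<Rightarrow>
     (nat \<times> nat) set \<Rightarrow> (nat \<times> nat \<Rightarrow> nat \<times> nat) \<Rightarrow> member_index \<Rightarrow> ('v, 'e) necklace" where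
  "member Q ws vs J \<phi> r =
     (case r of Inl A \<Rightarrow> orbit_necklace Q ws J \<phi> (SOME x. x \<in> A) | Inr s \<Rightarrow> Trivial (vs ! s))"

definition member_of_edge ::
    "'a list list \<Rightarrow> (nat \<times> nat) set \<Rightarrow> (nat \<times> nat \<Rightarrow> nat \<times> nat) \<Rightarrow> nat \<times> nat \<Rightarrow>
     member_index" where
  "member_of_edge ws J \<phi> x = Inl (orbit (successor ws J \<phi>) x)"

definition pairing_sign ::
    "('e + 'e) list list \<Rightarrow> (nat \<times> nat) set \<Rightarrow> (nat \<times> nat \<Rightarrow> nat \<times> nat) \<Rightarrow>
     (member_index \<Rightarrow> nat) \<Rightarrow> int" where
  "pairing_sign ws J \<phi> c =
     (\<Prod>x\<in>{x \<in> J. isl (edge_of ws x)}.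
        let a = c (member_of_edge ws J \<phi> x); b = c (member_of_edge ws J \<phi> (next_edge ws x))
        in if a < b then 1 else if a = b then 0 else - 1)"

definition coloured ::
    "('v, 'e) necklace \<Rightarrow> nat \<Rightarrow>
     (('v, 'e) collection \<times> ('v, 'e) collection \<Rightarrow>\<^sub>0 'k::field_char_0 poly)" where
  "coloured R i =
     (if i = 1 then tensor (Poly_Mapping.single {#R#} 1) 1
      else tensor 1 (Poly_Mapping.single {#R#} 1))"

definition pairing_term ::
    "('v, 'e) pre_digraph \<Rightarrow> ('e + 'e) list list \<Rightarrow> 'v list \<Rightarrow>
     (nat \<times> nat) set \<Rightarrow> (nat \<times> nat \<Rightarrow> nat \<times> nat) \<Rightarrow>
     (('v, 'e) collection \<times> ('v, 'e) collection \<Rightarrow>\<^sub>0 'k::field_char_0 poly)" where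
  "pairing_term Q ws vs J \<phi> =
     (\<Sum>c\<in>member_indices ws vs J \<phi> \<rightarrow>\<^sub>E {1, 2}.
        of_int (pairing_sign ws J \<phi> c) *
        (\<Prod>r\<in>member_indices ws vs J \<phi>. coloured (member Q ws vs J \<phi> r) (c r)))"

definition moyal_coproduct_presented ::
    "('v, 'e) pre_digraph \<Rightarrow> ('e + 'e) list list \<Rightarrow> 'v list \<Rightarrow>
     (('v, 'e) collection \<times> ('v, 'e) collection \<Rightarrow>\<^sub>0 'k::field_char_0 poly)" where
  "moyal_coproduct_presented Q ws vs =
     (\<Sum>(J, \<phi>)\<in>pairings ws.
        Poly_Mapping.map ((*) (monom (1 / 2 ^ (card J div 2)) (card J div 2)))
          (pairing_term Q ws vs J \<phi>))"

text \<open>The value does not depend on the presentation chosen for a collection in \<^term>\<open>collections Q\<close>.\<close>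

definition moyal_coproduct_collection ::
    "('v, 'e) pre_digraph \<Rightarrow> ('v, 'e) collection \<Rightarrow>
     (('v, 'e) collection \<times> ('v, 'e) collection \<Rightarrow>\<^sub>0 'k::field_char_0 poly)" where
  "moyal_coproduct_collection Q P =
     (let (ws, vs) = (SOME (ws, vs). presents ws vs P) in moyal_coproduct_presented Q ws vs)"

definition moyal_coproduct ::
    "('v, 'e) pre_digraph \<Rightarrow> (('v, 'e) collection \<Rightarrow>\<^sub>0 'k::field_char_0 poly) \<Rightarrow>
     (('v, 'e) collection \<times> ('v, 'e) collection \<Rightarrow>\<^sub>0 'k poly)" where
  "moyal_coproduct Q = linear_extension (moyal_coproduct_collection Q)"

end

(*
  A pairing merges the cyclic words of a collection into the orbits of "next edge after the pairing",
  and its sign compares the colours of the two partners of each pair, so only pairings whose partners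
  have different colours contribute. Iterating the coproduct on either side therefore gives the sum
  over all pairings with a colouring of the orbits by 1 < 2 < 3 for which partners differ in colour:
  the pairs performed first are those meeting colour 1 for 1 (x) Delta, and those meeting colour 3
  for Delta (x) 1.

  To iterate without choosing words for the intermediate collections, edges that have been paired off
  are kept as marked elements of a finite set with a permutation; necklaces skip them, and an orbit
  of marked elements is a trivial path. The coproduct computed in such a marked structure depends
  only on its collection: marked elements can be bypassed one at a time until every marked element is
  a fixed point, and structures of that kind with the same collection are isomorphic.
*)
theory Submission
  imports Defs "HOL-Combinatorics.List_Permutation"
begin

section \<open>Free modules\<close>

text \<open>Contracting a pairing turns the permutation \<open>\<sigma>\<close> into
  \<open>\<sigma> \<circ> \<phi>\<close>, and a second contraction turns it into
  \<open>\<sigma> \<circ> \<phi> \<circ> \<psi>\<close>. Both iterated coproducts thus refer to one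
  permutation \<open>\<sigma> \<circ> \<theta>\<close> of the same set with
  \<open>\<theta> = \<phi> \<circ> \<psi>\<close>, and coassociativity compares two ways of
  factoring \<open>\<theta>\<close>. Each factoring is forced: a pair across the first cut cannot
  wait, because the second step acts inside one factor, and a pair between two colours that the
  first cut leaves together cannot be performed earlier, because its sign would vanish. Signs agree
  because merging two neighbouring colours of 1 < 2 < 3 preserves the order of any two colours that
  it leaves different. The obstacle is that \<open>moyal_coproduct_collection\<close> chooses a
  presentation, so the words chosen for an intermediate collection are unrelated to the words from
  which it was cut. Its value must therefore be shown to depend on the collection alone, even when a
  necklace occurs several times and there is no canonical matching of members.\<close>

abbreviation scale :: "'r \<Rightarrow> ('a \<Rightarrow>\<^sub>0 'r) \<Rightarrow> ('a \<Rightarrow>\<^sub>0 'r::comm_ring_1)" where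
  "scale c \<equiv> Poly_Mapping.map ((*) c)"

lemma lookup_scale [simp]: "Poly_Mapping.lookup (scale c F) k = c * Poly_Mapping.lookup F k"
  by (simp add: Poly_Mapping.map.rep_eq when_def)

lemma scale_single [simp]: "scale c (Poly_Mapping.single k d) = Poly_Mapping.single k (c * d)"
  by (rule poly_mapping_eqI) (simp add: lookup_single when_def)

lemma scale_sum: "scale c (\<Sum>i\<in>I. F i) = (\<Sum>i\<in>I. scale c (F i))"
  by (rule poly_mapping_eqI) (simp add: lookup_sum sum_distrib_left)

text \<open>Any finite set containing the support may serve as index set, so the extensions of
  \<open>F\<close>, \<open>G\<close> and \<open>F + G\<close> can be compared over one common
  sum.\<close>

lemma lookup_linear_extension:
  assumes "finite S" "Poly_Mapping.keys F \<subseteq> S"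
  shows "Poly_Mapping.lookup (linear_extension g F) k =
    (\<Sum>a\<in>S. Poly_Mapping.lookup F a * Poly_Mapping.lookup (g a) k)"
  unfolding linear_extension_def lookup_sum lookup_scale
  by (rule sum.mono_neutral_left) (use assms in \<open>auto simp: in_keys_iff\<close>)

lemma linear_extension_single [simp]:
  "linear_extension g (Poly_Mapping.single a c) = scale c (g a)"
  by (rule poly_mapping_eqI)
    (simp add: lookup_linear_extension[of "{a}"])

lemma linear_extension_zero [simp]: "linear_extension g 0 = 0"
  by (simp add: linear_extension_def)

lemma linear_extension_add:
  "linear_extension g (F + G) = linear_extension g F + linear_extension g G"
proof (rule poly_mapping_eqI)
  fix k
  let ?S = "Poly_Mapping.keys F \<union> Poly_Mapping.keys G"
  have "finite ?S" "Poly_Mapping.keys (F + G) \<subseteq> ?S"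
    using keys_add[of F G] by auto
  then show "Poly_Mapping.lookup (linear_extension g (F + G)) k =
      Poly_Mapping.lookup (linear_extension g F + linear_extension g G) k"
    by (simp add: lookup_linear_extension[of ?S] lookup_add algebra_simps sum.distrib)
qed

lemma linear_extension_sum:
  "linear_extension g (\<Sum>i\<in>I. F i) = (\<Sum>i\<in>I. linear_extension g (F i))"
  by (induction I rule: infinite_finite_induct) (simp_all add: linear_extension_add)

lemma linear_extension_scale:
  "linear_extension g (scale c F) = scale c (linear_extension g F)"
proof (rule poly_mapping_eqI)
  fix k
  have "Poly_Mapping.keys (scale c F) \<subseteq> Poly_Mapping.keys F"
    by (auto simp: in_keys_iff)
  then show "Poly_Mapping.lookup (linear_extension g (scale c F)) k =
      Poly_Mapping.lookup (scale c (linear_extension g F)) k"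
    by (simp add: lookup_linear_extension[of "Poly_Mapping.keys F"] sum_distrib_left mult.assoc)
qed

lemma lookup_tensor [simp]:
  "Poly_Mapping.lookup (tensor F G) (a, b) = Poly_Mapping.lookup F a * Poly_Mapping.lookup G b"
proof -
  have "Poly_Mapping.lookup (tensor F G) (a, b) =
      (\<Sum>a'\<in>Poly_Mapping.keys F. \<Sum>b'\<in>Poly_Mapping.keys G. if b' = b then
        if a' = a then Poly_Mapping.lookup F a' * Poly_Mapping.lookup G b' else 0 else 0)"
    unfolding tensor_def lookup_sum lookup_single by (auto intro!: sum.cong simp: when_def)
  also have "\<dots> = Poly_Mapping.lookup F a * Poly_Mapping.lookup G b"
    by (cases "b \<in> Poly_Mapping.keys G") (auto simp: sum.delta in_keys_iff)
  finally show ?thesis .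
qed

text \<open>The keys \<open>k i\<close> may coincide and their coefficients cancel, so the support
  of the second factor is not known; the identity is checked coefficientwise.\<close>

lemma tensor_single_left:
  "tensor (Poly_Mapping.single a 1) (\<Sum>i\<in>I. Poly_Mapping.single (k i) (c i)) =
    (\<Sum>i\<in>I. Poly_Mapping.single (a, k i) (c i))"
proof (rule poly_mapping_eqI, clarify)
  fix a' b
  show "Poly_Mapping.lookup (tensor (Poly_Mapping.single a 1)
        (\<Sum>i\<in>I. Poly_Mapping.single (k i) (c i))) (a', b) =
      Poly_Mapping.lookup (\<Sum>i\<in>I. Poly_Mapping.single (a, k i) (c i)) (a', b)"
    by (cases "a = a'") (auto simp: lookup_sum lookup_single when_def intro!: sum.cong)
qed

lemma tensor_single_right:
  "tensor (\<Sum>i\<in>I. Poly_Mapping.single (k i) (c i)) (Poly_Mapping.single b 1) =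
    (\<Sum>i\<in>I. Poly_Mapping.single (k i, b) (c i))"
proof (rule poly_mapping_eqI, clarify)
  fix a b'
  show "Poly_Mapping.lookup (tensor (\<Sum>i\<in>I. Poly_Mapping.single (k i) (c i))
        (Poly_Mapping.single b 1)) (a, b') =
      Poly_Mapping.lookup (\<Sum>i\<in>I. Poly_Mapping.single (k i, b) (c i)) (a, b')"
    by (cases "b = b'") (auto simp: lookup_sum lookup_single when_def intro!: sum.cong)
qed

lemma tensor_single_single [simp]:
  "tensor (Poly_Mapping.single a c) (Poly_Mapping.single b d) = Poly_Mapping.single (a, b) (c * d)"
  by (rule poly_mapping_eqI) (auto simp: lookup_single when_def split: if_splits)

section \<open>Necklaces of a permutation with marked elements\<close>

definition cycle_list :: "('x \<Rightarrow> 'x) \<Rightarrow> 'x list \<Rightarrow> bool" where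
  "cycle_list \<sigma> xs \<longleftrightarrow> xs \<noteq> [] \<and> distinct xs \<and> map \<sigma> xs = rotate1 xs"

text \<open>The list of iterates that \<open>orbit_necklace\<close> reads, beginning with the base
  point itself.\<close>

definition traversal :: "('x \<Rightarrow> 'x) \<Rightarrow> 'x \<Rightarrow> 'x list" where
  "traversal \<sigma> x = map (\<lambda>n. (\<sigma> ^^ n) x) [0..<card (orbit \<sigma> x)]"

lemma cycle_list_rotate: "cycle_list \<sigma> xs \<Longrightarrow> cycle_list \<sigma> (rotate n xs)"
  by (simp add: cycle_list_def rotate_map[symmetric] rotate1_rotate_swap)

lemma funpow_cycle_list:
  assumes "cycle_list \<sigma> xs"
  shows "(\<sigma> ^^ n) (hd xs) = xs ! (n mod length xs)"
proof (induction n)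
  case 0
  then show ?case
    using assms by (simp add: cycle_list_def hd_conv_nth)
next
  case (Suc n)
  have len: "n mod length xs < length xs"
    using assms by (simp add: cycle_list_def)
  have "\<sigma> (xs ! (n mod length xs)) = map \<sigma> xs ! (n mod length xs)"
    using len by simp
  also have "\<dots> = xs ! (Suc n mod length xs)"
    using assms len by (simp add: cycle_list_def nth_rotate1 mod_Suc_eq)
  finally show ?case
    using Suc by simp
qed

lemma orbit_hd_cycle_list:
  assumes "cycle_list \<sigma> xs"
  shows "orbit \<sigma> (hd xs) = set xs"
proof -
  have "xs \<noteq> []"
    using assms by (simp add: cycle_list_def)
  then have "orbit \<sigma> (hd xs) = {(\<sigma> ^^ m) (hd xs) | m. m < length xs}"
    by (intro orbit_altdef_bounded) (simp_all add: funpow_cycle_list[OF assms], simp add: hd_conv_nth)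
  also have "\<dots> = set xs"
    by (force simp: funpow_cycle_list[OF assms] in_set_conv_nth)
  finally show ?thesis .
qed

lemma traversal_hd_cycle_list:
  assumes "cycle_list \<sigma> xs"
  shows "traversal \<sigma> (hd xs) = xs"
proof (rule nth_equalityI)
  have card: "card (set xs) = length xs"
    using assms by (simp add: cycle_list_def distinct_card)
  then show "length (traversal \<sigma> (hd xs)) = length xs"
    by (simp add: traversal_def orbit_hd_cycle_list[OF assms])
  fix i
  assume "i < length (traversal \<sigma> (hd xs))"
  with card show "traversal \<sigma> (hd xs) ! i = xs ! i"
    by (simp add: traversal_def orbit_hd_cycle_list[OF assms] funpow_cycle_list[OF assms])
qed

lemma cycle_list_starting_at:
  assumes "cycle_list \<sigma> xs" "x \<in> set xs"
  obtains n where "cycle_list \<sigma> (rotate n xs)" "hd (rotate n xs) = x"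
proof -
  obtain i where "i < length xs" "xs ! i = x"
    using assms(2) by (auto simp: in_set_conv_nth)
  moreover have "xs \<noteq> []"
    using assms(2) by auto
  ultimately have "hd (rotate i xs) = x"
    by (simp add: hd_rotate_conv_nth)
  with cycle_list_rotate[OF assms(1)] that show ?thesis
    by blast
qed

lemma orbit_cycle_list:
  assumes "cycle_list \<sigma> xs" "x \<in> set xs"
  shows "orbit \<sigma> x = set xs"
  using assms by (metis cycle_list_starting_at orbit_hd_cycle_list set_rotate)

text \<open>\<open>orbit\<close> begins at the first image of the base point, so the point itself is
  reached only because the permutation is periodic. Extending \<open>\<sigma>\<close> by the
  identity outside \<open>X\<close> gives a permutation of the whole type and keeps the orbits
  inside \<open>X\<close>.\<close>

lemma self_in_orbit_bij_betw:
  assumes "finite X" "bij_betw \<sigma> X X" "x \<in> X"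
  shows "x \<in> orbit \<sigma> x"
proof -
  let ?p = "\<lambda>y. if y \<in> X then \<sigma> y else y"
  have "bij_betw ?p X X"
    using assms(2) by (simp cong: bij_betw_cong)
  then have "?p permutes X"
    by (auto intro: bij_imp_permutes)
  then have "x \<in> orbit ?p x"
    using assms(1) by (auto intro!: permutation_self_in_orbit simp: permutation_permutes)
  moreover have "orbit ?p x = orbit \<sigma> x"
    using assms(3) bij_betwE[OF assms(2)] by (intro orbit_cong0[of x X]) auto
  ultimately show ?thesis
    by simp
qed

lemma orbit_subset_closed:
  assumes "f ` A \<subseteq> A" "x \<in> A"
  shows "orbit f x \<subseteq> A"
proof
  fix y
  assume "y \<in> orbit f x"
  then show "y \<in> A"
    by induction (use assms in auto)
qed

lemma cycle_list_traversal:
  assumes "finite X" "bij_betw \<sigma> X X" "x \<in> X"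
  shows "cycle_list \<sigma> (traversal \<sigma> x)" "set (traversal \<sigma> x) = orbit \<sigma> x"
    "hd (traversal \<sigma> x) = x"
proof -
  \<comment> \<open>\<open>n\<close> is the period of \<open>x\<close>: the iterates before the
    first return list the orbit without repetition, and the return closes the cycle.\<close>
  define n where "n = funpow_dist1 \<sigma> x x"
  have x: "x \<in> orbit \<sigma> x"
    using assms by (rule self_in_orbit_bij_betw)
  have orb: "orbit \<sigma> x = (\<lambda>m. (\<sigma> ^^ m) x) ` {0..<n}"
    unfolding n_def by (rule orbit_conv_funpow_dist1[OF x])
  have inj: "inj_on (\<lambda>m. (\<sigma> ^^ m) x) {0..<n}"
    unfolding n_def by (rule inj_on_funpow_dist1[OF x])
  have card: "card (orbit \<sigma> x) = n"
    unfolding orb by (simp add: card_image[OF inj])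
  have n: "n > 0" "(\<sigma> ^^ n) x = x"
    unfolding n_def using funpow_dist1_prop[OF x] by simp_all
  have "map \<sigma> (traversal \<sigma> x) = rotate1 (traversal \<sigma> x)"
  proof (rule nth_equalityI)
    fix i
    assume "i < length (map \<sigma> (traversal \<sigma> x))"
    then have "i < n"
      by (simp add: traversal_def card)
    then show "map \<sigma> (traversal \<sigma> x) ! i = rotate1 (traversal \<sigma> x) ! i"
      using n by (cases "Suc i = n") (auto simp: traversal_def card nth_rotate1)
  qed simp
  moreover have "distinct (traversal \<sigma> x)"
    using inj by (simp add: traversal_def card distinct_map)
  ultimately show "cycle_list \<sigma> (traversal \<sigma> x)"
    using n by (simp add: cycle_list_def traversal_def card)
  show "set (traversal \<sigma> x) = orbit \<sigma> x"
    unfolding traversal_def card by (simp add: orb)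
  show "hd (traversal \<sigma> x) = x"
    using n by (simp add: traversal_def card hd_map)
qed

text \<open>This is \<open>orbit_necklace\<close> with the paired edges replaced by an arbitrary set
  of marks. The vertex map is separate from the labels because marked elements that stand for
  trivial paths carry no meaningful label.\<close>

definition necklace_at ::
    "('x \<Rightarrow> 'e + 'e) \<Rightarrow> ('x \<Rightarrow> 'v) \<Rightarrow> ('x \<Rightarrow> 'x) \<Rightarrow> 'x set \<Rightarrow> 'x \<Rightarrow> ('v, 'e) necklace" where
  "necklace_at lab vert \<sigma> M x =
     (if orbit \<sigma> x \<subseteq> M then Trivial (vert x)
      else Cyclic (cyclic_word (map lab (filter (\<lambda>y. y \<notin> M) (traversal \<sigma> x)))))"

lemma cyclic_word_eq_iff: "cyclic_word xs = cyclic_word ys \<longleftrightarrow> (\<exists>n. ys = rotate n xs)"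
  using cyclic_word.abs_eq_iff[of xs ys] by (simp add: rotation_equiv_def)

lemma cyclic_word_append_commute: "cyclic_word (xs @ ys) = cyclic_word (ys @ xs)"
  unfolding cyclic_word_eq_iff by (rule exI[of _ "length xs"]) (simp add: rotate_append)

text \<open>Independence of the base point: on a wholly marked cycle \<open>vert\<close> is
  constant, and otherwise moving the base point rotates the cycle and hence the word that is
  left.\<close>

lemma necklace_at_cycle_list:
  assumes xs: "cycle_list \<sigma> xs" "x \<in> set xs"
    and vert: "\<And>y. y \<in> set xs \<Longrightarrow> y \<in> M \<Longrightarrow> vert (\<sigma> y) = vert y"
  shows "necklace_at lab vert \<sigma> M x =
    (if set xs \<subseteq> M then Trivial (vert (hd xs))
     else Cyclic (cyclic_word (map lab (filter (\<lambda>y. y \<notin> M) xs))))"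
proof -
  obtain n where n: "cycle_list \<sigma> (rotate n xs)" "hd (rotate n xs) = x"
    using cycle_list_starting_at[OF xs] .
  have orb: "orbit \<sigma> x = set xs"
    using xs by (rule orbit_cycle_list)
  show ?thesis
  proof (cases "set xs \<subseteq> M")
    case True
    have "xs \<noteq> []"
      using xs(2) by auto
    have "vert ((\<sigma> ^^ k) (hd xs)) = vert (hd xs)" for k
    proof (induction k)
      case (Suc k)
      have "(\<sigma> ^^ k) (hd xs) \<in> set xs"
        using \<open>xs \<noteq> []\<close> by (simp add: funpow_cycle_list[OF xs(1)])
      with True Suc vert show ?case
        by auto
    qed simp
    moreover obtain k where "k < length xs" "x = xs ! k"
      using xs(2) by (auto simp: in_set_conv_nth)
    ultimately have "vert x = vert (hd xs)"
      by (metis funpow_cycle_list[OF xs(1)] mod_less)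
    with True show ?thesis
      by (simp add: necklace_at_def orb)
  next
    case False
    have "traversal \<sigma> x = rotate n xs"
      using traversal_hd_cycle_list[OF n(1)] n(2) by simp
    \<comment> \<open>Filtering does not preserve the amount of a rotation. A rotation exchanges two
      consecutive blocks, however, and filtering respects the blocks.\<close>
    moreover have "cyclic_word (map lab (filter (\<lambda>y. y \<notin> M) (rotate n xs))) =
        cyclic_word (map lab (filter (\<lambda>y. y \<notin> M) xs))"
      unfolding rotate_drop_take filter_append map_append
      by (subst cyclic_word_append_commute)
        (simp flip: map_append filter_append)
    ultimately show ?thesis
      using False by (simp add: necklace_at_def orb)
  qed
qed

text \<open>Multiplicity is counted by orbits, so equal necklaces on different orbits remain
  separate members. The set \<open>A\<close> will be a union of orbits, such as one colour
  class.\<close>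

definition collection_of ::
    "('x \<Rightarrow> 'e + 'e) \<Rightarrow> ('x \<Rightarrow> 'v) \<Rightarrow> ('x \<Rightarrow> 'x) \<Rightarrow> 'x set \<Rightarrow> 'x set \<Rightarrow> ('v, 'e) collection" where
  "collection_of lab vert \<sigma> M A =
     image_mset (\<lambda>K. necklace_at lab vert \<sigma> M (SOME x. x \<in> K)) (mset_set (orbit \<sigma> ` A))"

text \<open>\<open>p\<close> and \<open>q\<close> cut \<open>A\<close> into the same classes, so
  \<open>p x\<close> determines \<open>q x\<close>, and \<open>k\<close> is the resulting bijection
  of index sets. If there are infinitely many classes, both multisets are empty by the convention
  for \<open>mset_set\<close>.\<close>

lemma image_mset_quotient_cong:
  assumes "\<And>x y. x \<in> A \<Longrightarrow> y \<in> A \<Longrightarrow> p x = p y \<longleftrightarrow> q x = q y"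
    and "\<And>x. x \<in> A \<Longrightarrow> g (p x) = h (q x)"
  shows "image_mset g (mset_set (p ` A)) = image_mset h (mset_set (q ` A))"
proof -
  define k where "k b = q (SOME x. x \<in> A \<and> p x = b)" for b
  have k: "k (p x) = q x" if "x \<in> A" for x
    using someI[of "\<lambda>y. y \<in> A \<and> p y = p x" x] that assms(1) unfolding k_def by auto
  have "inj_on k (p ` A)"
    by (auto simp: inj_on_def k assms(1))
  moreover have "k ` p ` A = q ` A"
    by (auto simp: image_image k)
  ultimately have "mset_set (q ` A) = image_mset k (mset_set (p ` A))"
    by (simp add: image_mset_mset_set)
  then show ?thesis
    by (cases "finite (p ` A)")
      (auto simp: multiset.map_comp k assms(2) intro!: image_mset_cong)
qed

text \<open>A marked element acts as a step of length zero at its vertex, an unmarked one as the arc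
  \<open>lab x\<close> leading to the vertex of its successor. Words read along orbits are then
  closed walks, whatever the labels of marked elements are.\<close>

definition necklace_structure ::
    "('v, 'e) pre_digraph \<Rightarrow> ('x \<Rightarrow> 'e + 'e) \<Rightarrow> ('x \<Rightarrow> 'v) \<Rightarrow> ('x \<Rightarrow> 'x) \<Rightarrow> 'x set \<Rightarrow> 'x set \<Rightarrow>
     bool" where
  "necklace_structure Q lab vert \<sigma> M X \<longleftrightarrow>
     finite X \<and> bij_betw \<sigma> X X \<and> vert ` X \<subseteq> verts Q \<and>
     (\<forall>x\<in>X \<inter> M. vert (\<sigma> x) = vert x) \<and>
     (\<forall>x\<in>X - M. lab x \<in> arcs (double_quiver Q) \<and> tail (double_quiver Q) (lab x) = vert x \<and>
        head (double_quiver Q) (lab x) = vert (\<sigma> x))"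

lemma necklace_at_orbit:
  assumes S: "necklace_structure Q lab vert \<sigma> M X" and "x \<in> X" "y \<in> orbit \<sigma> x"
  shows "necklace_at lab vert \<sigma> M y = necklace_at lab vert \<sigma> M x"
proof -
  have fin: "finite X" "bij_betw \<sigma> X X"
    using S by (auto simp: necklace_structure_def)
  note trav = cycle_list_traversal[OF fin \<open>x \<in> X\<close>]
  have sub: "orbit \<sigma> x \<subseteq> X"
    using fin \<open>x \<in> X\<close> by (intro orbit_subset_closed) (auto simp: bij_betw_def)
  have vert: "vert (\<sigma> z) = vert z" if "z \<in> set (traversal \<sigma> x)" "z \<in> M" for z
    using that S sub trav(2) by (auto simp: necklace_structure_def)
  have x: "x \<in> orbit \<sigma> x"
    using fin \<open>x \<in> X\<close> by (rule self_in_orbit_bij_betw)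
  show ?thesis
    using necklace_at_cycle_list[where lab = lab and vert = vert and M = M, OF trav(1) _ vert] assms(3) x trav(2) by simp
qed

lemma necklace_at_some_orbit:
  assumes "necklace_structure Q lab vert \<sigma> M X" "x \<in> X"
  shows "necklace_at lab vert \<sigma> M (SOME y. y \<in> orbit \<sigma> x) = necklace_at lab vert \<sigma> M x"
  using assms by (rule necklace_at_orbit) (metis orbit.base someI_ex)

text \<open>Orbits may be indexed by any \<open>h\<close> that separates exactly the orbits. This
  covers the orbits of another permutation as well as the member indices of the coproduct.\<close>

lemma collection_of_eq:
  assumes S: "necklace_structure Q lab vert \<sigma> M X"
    and "\<And>x y. x \<in> X \<Longrightarrow> y \<in> X \<Longrightarrow> h x = h y \<longleftrightarrow> orbit \<sigma> x = orbit \<sigma> y"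
    and "\<And>x. x \<in> X \<Longrightarrow> g (h x) = necklace_at lab vert \<sigma> M x"
  shows "collection_of lab vert \<sigma> M X = image_mset g (mset_set (h ` X))"
  unfolding collection_of_def
proof (rule image_mset_quotient_cong)
  fix x
  assume "x \<in> X"
  then show "necklace_at lab vert \<sigma> M (SOME y. y \<in> orbit \<sigma> x) = g (h x)"
    by (simp add: necklace_at_some_orbit[OF S] assms(3))
qed (simp add: assms(2))

lemma orbit_eq:
  assumes "necklace_structure Q lab vert \<sigma> M X" "x \<in> X" "y \<in> orbit \<sigma> x"
  shows "orbit \<sigma> y = orbit \<sigma> x"
proof -
  have fin: "finite X" "bij_betw \<sigma> X X"
    using assms(1) by (auto simp: necklace_structure_def)
  show ?thesis
    using orbit_cycle_list[OF cycle_list_traversal(1)[OF fin assms(2)], of y] assms(3)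
      cycle_list_traversal(2)[OF fin assms(2)] by simp
qed

lemma self_in_orbit:
  assumes "necklace_structure Q lab vert \<sigma> M X" "x \<in> X"
  shows "x \<in> orbit \<sigma> x"
  using assms by (auto simp: necklace_structure_def intro: self_in_orbit_bij_betw)

lemma orbit_subset_structure:
  assumes "necklace_structure Q lab vert \<sigma> M X" "x \<in> X"
  shows "orbit \<sigma> x \<subseteq> X"
  using assms by (intro orbit_subset_closed) (auto simp: necklace_structure_def bij_betw_def)

text \<open>An injective self-map of a finite set is onto, so \<open>\<sigma>\<close> permutes
  \<open>A\<close>; thus \<open>A\<close> is a union of cycles, and so is its complement.\<close>

lemma necklace_structure_closed_subset:
  assumes S: "necklace_structure Q lab vert \<sigma> M X" and A: "A \<subseteq> X" "\<sigma> ` A \<subseteq> A"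
  shows "necklace_structure Q lab vert \<sigma> M A" "necklace_structure Q lab vert \<sigma> M (X - A)"
proof -
  have fin: "finite X" and bij: "bij_betw \<sigma> X X"
    using S by (auto simp: necklace_structure_def)
  have inj: "inj_on \<sigma> A"
    using bij A(1) by (meson bij_betw_def inj_on_subset)
  have bijA: "bij_betw \<sigma> A A"
    using inj A finite_subset[OF A(1) fin] by (simp add: bij_betw_def endo_inj_surj)
  moreover have "bij_betw \<sigma> (X - A) (X - A)"
    using bij bijA A(1)
    by (metis Diff_disjoint Diff_partition Int_commute bij_betw_partition Un_commute)
  ultimately show "necklace_structure Q lab vert \<sigma> M A" "necklace_structure Q lab vert \<sigma> M (X - A)"
    using S A(1) finite_subset[OF A(1) fin] unfolding necklace_structure_def by blast+
qed

text \<open>Invariance under isomorphism. Labels are compared only at unmarked elements, where they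
  are read; vertices are compared everywhere, since a wholly marked orbit is read through
  them.\<close>

lemma necklace_structure_image:
  assumes S: "necklace_structure Q lab vert \<sigma> M X" and inj: "inj_on b X"
    and \<sigma>: "\<And>x. x \<in> X \<Longrightarrow> \<sigma>' (b x) = b (\<sigma> x)"
    and M: "\<And>x. x \<in> X \<Longrightarrow> b x \<in> M' \<longleftrightarrow> x \<in> M"
    and lab: "\<And>x. x \<in> X \<Longrightarrow> x \<notin> M \<Longrightarrow> lab' (b x) = lab x"
    and vert: "\<And>x. x \<in> X \<Longrightarrow> vert' (b x) = vert x"
  shows "necklace_structure Q lab' vert' \<sigma>' M' (b ` X)"
    and "collection_of lab' vert' \<sigma>' M' (b ` X) = collection_of lab vert \<sigma> M X"
proof -
  have fin: "finite X" and bij: "bij_betw \<sigma> X X"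
    using S by (auto simp: necklace_structure_def)
  have \<sigma>X: "\<sigma> x \<in> X" if "x \<in> X" for x
    using bij that by (auto simp: bij_betw_def)
  have "\<sigma>' ` b ` X = b ` \<sigma> ` X"
    unfolding image_image by (rule image_cong) (simp_all add: \<sigma>)
  also have "\<dots> = b ` X"
    using bij by (simp add: bij_betw_def)
  finally have "\<sigma>' ` b ` X = b ` X" .
  then have "bij_betw \<sigma>' (b ` X) (b ` X)"
    using fin by (simp add: bij_betw_def eq_card_imp_inj_on)
  then show S': "necklace_structure Q lab' vert' \<sigma>' M' (b ` X)"
    using S by (auto simp: necklace_structure_def \<sigma> M lab vert \<sigma>X)
  have sub: "orbit \<sigma> x \<subseteq> X" if "x \<in> X" for x
    using S that by (rule orbit_subset_structure)
  have orb: "orbit \<sigma>' (b x) = b ` orbit \<sigma> x" if "x \<in> X" for x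
    using orbit_inverse[of x \<sigma> \<sigma>' b] self_in_orbit[OF S that] \<sigma> sub[OF that] by blast
  have pow: "(\<sigma>' ^^ n) (b x) = b ((\<sigma> ^^ n) x) \<and> (\<sigma> ^^ n) x \<in> X" if "x \<in> X" for n x
    by (induction n) (use that in \<open>auto simp: \<sigma> \<sigma>X\<close>)
  have trav: "traversal \<sigma>' (b x) = map b (traversal \<sigma> x)" if "x \<in> X" for x
    using inj_on_subset[OF inj sub[OF that]] that
    by (simp add: traversal_def orb card_image pow)
  have travX: "set (traversal \<sigma> x) \<subseteq> X" if "x \<in> X" for x
    using pow[OF that] by (auto simp: traversal_def)
  have "map lab' (filter (\<lambda>y. y \<notin> M') (map b xs)) = map lab (filter (\<lambda>y. y \<notin> M) xs)"
    if "set xs \<subseteq> X" for xs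
    using that by (induction xs) (auto simp: M lab)
  moreover have "b ` orbit \<sigma> x \<subseteq> M' \<longleftrightarrow> orbit \<sigma> x \<subseteq> M" if "x \<in> X" for x
    using sub[OF that] M by (auto simp: subset_iff)
  ultimately have neck: "necklace_at lab' vert' \<sigma>' M' (b x) = necklace_at lab vert \<sigma> M x"
    if "x \<in> X" for x
    using that travX[OF that] by (simp add: necklace_at_def orb trav vert)
  have "collection_of lab vert \<sigma> M X =
      image_mset (\<lambda>K. necklace_at lab' vert' \<sigma>' M' (SOME y. y \<in> K))
        (mset_set ((\<lambda>x. orbit \<sigma>' (b x)) ` X))"
  proof (rule collection_of_eq[OF S])
    fix x y
    assume "x \<in> X" "y \<in> X"
    then show "orbit \<sigma>' (b x) = orbit \<sigma>' (b y) \<longleftrightarrow> orbit \<sigma> x = orbit \<sigma> y"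
      using inj_on_image_eq_iff[OF inj sub sub] by (simp add: orb)
  next
    fix x
    assume "x \<in> X"
    then show "necklace_at lab' vert' \<sigma>' M' (SOME y. y \<in> orbit \<sigma>' (b x)) =
        necklace_at lab vert \<sigma> M x"
      by (simp add: necklace_at_some_orbit[OF S'] neck)
  qed
  then show "collection_of lab' vert' \<sigma>' M' (b ` X) = collection_of lab vert \<sigma> M X"
    by (simp add: collection_of_def image_image)
qed

lemma collection_of_cong:
  assumes "necklace_structure Q lab vert \<sigma> M X"
    and "\<And>x. x \<in> X \<Longrightarrow> \<sigma>' x = \<sigma> x" "\<And>x. x \<in> X \<Longrightarrow> x \<in> M' \<longleftrightarrow> x \<in> M"
  shows "collection_of lab vert \<sigma>' M' X = collection_of lab vert \<sigma> M X"
  using necklace_structure_image(2)[OF assms(1), of id \<sigma>' M' lab vert] assms(2,3) by simp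

text \<open>A marked element does not change the vertex, so leaving it out of the word does not
  break the walk.\<close>

lemma awalk_along_structure:
  assumes Q: "wf_digraph Q" and S: "necklace_structure Q lab vert \<sigma> M X"
    and "set (x # xs) \<subseteq> X" "map \<sigma> (x # xs) = xs @ [z]"
  shows "pre_digraph.awalk (double_quiver Q) (vert x)
    (map lab (filter (\<lambda>y. y \<notin> M) (x # xs))) (vert z)"
proof -
  interpret wf_digraph "double_quiver Q"
    using Q by (auto simp: wf_digraph_def double_quiver_def)
  have verts: "verts (double_quiver Q) = verts Q"
    by (simp add: double_quiver_def)
  have step: "awalk (vert x) (if x \<in> M then p else lab x # p) v"
    if "x \<in> X" "awalk (vert (\<sigma> x)) p v" for x p v
    using S that by (auto simp: necklace_structure_def awalk_Cons_iff)
  show ?thesis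
    using assms(3,4)
  proof (induction xs arbitrary: x)
    case Nil
    have "z \<in> X"
      using Nil S by (auto simp: necklace_structure_def bij_betw_def)
    then have "awalk (vert (\<sigma> x)) [] (vert z)"
      using Nil S by (auto simp: awalk_Nil_iff verts necklace_structure_def)
    from step[OF _ this, of] show ?case
      using Nil by (simp split: if_splits)
  next
    case (Cons y ys)
    then have "awalk (vert (\<sigma> x)) (map lab (filter (\<lambda>y. y \<notin> M) (y # ys))) (vert z)"
      by simp
    from step[OF _ this] show ?case
      using Cons.prems by (simp split: if_splits)
  qed
qed

lemma collection_of_in_collections:
  assumes Q: "wf_digraph Q" and S: "necklace_structure Q lab vert \<sigma> M X"
  shows "collection_of lab vert \<sigma> M X \<in> collections Q"
proof -
  have "necklace_at lab vert \<sigma> M x \<in> necklaces Q" if x: "x \<in> X" for x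
  proof (cases "orbit \<sigma> x \<subseteq> M")
    case True
    then show ?thesis
      using S x by (auto simp: necklace_at_def necklaces_def necklace_structure_def)
  next
    case False
    have fin: "finite X" "bij_betw \<sigma> X X"
      using S by (auto simp: necklace_structure_def)
    note trav = cycle_list_traversal[OF fin x]
    obtain xs where xs: "traversal \<sigma> x = x # xs"
      using trav by (metis cycle_list_def list.collapse)
    define w where "w = map lab (filter (\<lambda>y. y \<notin> M) (x # xs))"
    have "pre_digraph.awalk (double_quiver Q) (vert x) w (vert x)"
      unfolding w_def
    proof (rule awalk_along_structure[OF Q S])
      show "set (x # xs) \<subseteq> X"
        using trav(2) orbit_subset_structure[OF S x] xs by simp
      \<comment> \<open>The traversal is a cycle that begins at \<open>x\<close>, so the walk ends
        where it starts.\<close>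
      show "map \<sigma> (x # xs) = xs @ [x]"
        using trav(1) xs by (simp add: cycle_list_def)
    qed
    moreover have "w \<noteq> []"
      using False trav(2) xs by (auto simp: w_def filter_empty_conv)
    ultimately have "cyclic_path Q w"
      by (auto simp: cyclic_path_def)
    then show ?thesis
      using False by (auto simp: necklace_at_def necklaces_def w_def xs)
  qed
  then show ?thesis
    using S by (auto simp: collections_def collection_of_def necklace_structure_def
        necklace_at_some_orbit[OF S])
qed

section \<open>Removing one marked element from its cycle\<close>

definition bypass :: "('x \<Rightarrow> 'x) \<Rightarrow> 'x \<Rightarrow> 'x \<Rightarrow> 'x" where
  "bypass \<sigma> x y = (if \<sigma> y = x then \<sigma> x else \<sigma> y)"

text \<open>With \<open>x\<close> written first, removing it is taking the tail: only the last
  element pointed to \<open>x\<close>, and it now points to the head of the tail.\<close>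

lemma bypass_cycle_list:
  assumes "cycle_list \<sigma> (x # xs)" "xs \<noteq> []"
  shows "cycle_list (bypass \<sigma> x) xs" "hd xs = \<sigma> x"
proof -
  obtain y ys where ys: "xs = y # ys"
    using assms(2) by (cases xs) auto
  have map: "\<sigma> x = y" "map \<sigma> xs = ys @ [x]"
    using assms(1) ys by (auto simp: cycle_list_def)
  have "map (bypass \<sigma> x) xs = map (\<lambda>z. if z = x then y else z) (map \<sigma> xs)"
    by (simp add: bypass_def map(1))
  also have "\<dots> = ys @ [y]"
  proof -
    have "map (\<lambda>z. if z = x then y else z) ys = ys"
      using assms(1) by (intro map_idI) (auto simp: cycle_list_def ys)
    then show ?thesis
      by (simp add: map(2))
  qed
  finally show "cycle_list (bypass \<sigma> x) xs" "hd xs = \<sigma> x"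
    using assms(1) by (auto simp: cycle_list_def ys map(1))
qed

text \<open>A marked element adds no letter to its necklace, and
  \<open>\<sigma> x \<noteq> x\<close> ensures that its orbit survives the removal, a marked fixed
  point being a trivial path by itself. The case \<open>x \<notin> X\<close> is included because the
  lemma is applied to both halves of a splitting, of which only one contains
  \<open>x\<close>.\<close>

lemma necklace_structure_bypass:
  assumes S: "necklace_structure Q lab vert \<sigma> M X" and x: "x \<in> M" "\<sigma> x \<noteq> x"
  shows "collection_of lab vert (bypass \<sigma> x) M (X - {x}) = collection_of lab vert \<sigma> M X"
    and "necklace_structure Q lab vert (bypass \<sigma> x) M (X - {x})"
proof -
  have "collection_of lab vert (bypass \<sigma> x) M (X - {x}) = collection_of lab vert \<sigma> M X \<and>
    necklace_structure Q lab vert (bypass \<sigma> x) M (X - {x})"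
  proof (cases "x \<in> X")
    case False
    have fin: "finite X" and bij: "bij_betw \<sigma> X X"
      using S by (auto simp: necklace_structure_def)
    have "bypass \<sigma> x y = \<sigma> y" if "y \<in> X" for y
      using False bij that by (auto simp: bypass_def bij_betw_def)
    then show ?thesis
      using False collection_of_cong[OF S, of "bypass \<sigma> x" M]
        necklace_structure_image(1)[OF S, of id "bypass \<sigma> x" M lab vert] by simp
  next
    case True
    let ?\<tau> = "bypass \<sigma> x"
    have fin: "finite X" and bij: "bij_betw \<sigma> X X"
      using S by (auto simp: necklace_structure_def)
    then have inj: "inj_on \<sigma> X" and \<sigma>X: "\<And>y. y \<in> X \<Longrightarrow> \<sigma> y \<in> X"
      by (auto simp: bij_betw_def)
    have "?\<tau> ` (X - {x}) \<subseteq> X - {x}"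
      using True x \<sigma>X by (auto simp: bypass_def)
    moreover have "inj_on ?\<tau> (X - {x})"
      using inj True by (auto simp: bypass_def inj_on_def split: if_splits)
    ultimately have "bij_betw ?\<tau> (X - {x}) (X - {x})"
      using fin by (simp add: bij_betw_def endo_inj_surj)
    moreover have "vert (?\<tau> y) = vert (\<sigma> y)" if "y \<in> X" for y
      using S True x by (auto simp: bypass_def necklace_structure_def)
    ultimately have S': "necklace_structure Q lab vert ?\<tau> M (X - {x})"
      using S by (auto simp: necklace_structure_def)
    have orbit_neck: "orbit ?\<tau> y = orbit \<sigma> y - {x} \<and>
        necklace_at lab vert ?\<tau> M y = necklace_at lab vert \<sigma> M y" if y: "y \<in> X - {x}" for y
    proof -
      have yX: "y \<in> X"
        using y by simp
      \<comment> \<open>If \<open>x\<close> lies on the cycle of \<open>y\<close>, the cycle is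
        listed from \<open>x\<close>, in the form required by
        \<open>bypass_cycle_list\<close>.\<close>
      obtain xs where xs: "cycle_list \<sigma> xs" "set xs = orbit \<sigma> y" "x \<in> set xs \<Longrightarrow> hd xs = x"
        using cycle_list_traversal[OF fin bij yX] cycle_list_traversal[OF fin bij True]
          orbit_eq[OF S yX] by metis
      define ys where "ys = (if x \<in> set xs then tl xs else xs)"
      have y_xs: "y \<in> set xs"
        unfolding xs(2) by (rule self_in_orbit[OF S yX])
      have ys: "cycle_list ?\<tau> ys" "set ys = set xs - {x}" "y \<in> set ys"
        "set ys \<subseteq> M \<longleftrightarrow> set xs \<subseteq> M" "filter (\<lambda>z. z \<notin> M) ys = filter (\<lambda>z. z \<notin> M) xs"
        "set xs \<subseteq> M \<Longrightarrow> vert (hd ys) = vert (hd xs)"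
      proof -
        have "cycle_list ?\<tau> ys \<and> set ys = set xs - {x} \<and> y \<in> set ys \<and>
          (set ys \<subseteq> M \<longleftrightarrow> set xs \<subseteq> M) \<and> filter (\<lambda>z. z \<notin> M) ys = filter (\<lambda>z. z \<notin> M) xs \<and>
          vert (hd ys) = vert (hd xs)"
        proof (cases "x \<in> set xs")
          case True
          then obtain zs where zs: "xs = x # zs"
            using xs(3) by (cases xs) auto
          then have ne: "zs \<noteq> []"
            using y_xs y by auto
          \<comment> \<open>Dropping \<open>x\<close> moves the head of the list to
            \<open>\<sigma> x\<close>; as \<open>x\<close> is marked, a trivial path read there has
            the same vertex.\<close>
          have "vert (\<sigma> x) = vert x"
            using S \<open>x \<in> X\<close> x by (auto simp: necklace_structure_def)
          with bypass_cycle_list[of \<sigma> x zs] xs(1) ne y y_xs x zs show ?thesis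
            by (auto simp: ys_def cycle_list_def)
        next
          case False
          have "map ?\<tau> xs = map \<sigma> xs"
          proof (rule map_cong[OF refl])
            fix z
            assume "z \<in> set xs"
            then have "\<sigma> z \<in> set (map \<sigma> xs)"
              by simp
            then have "\<sigma> z \<in> set xs"
              using xs(1) by (metis cycle_list_def set_rotate1)
            then show "?\<tau> z = \<sigma> z"
              using False by (auto simp: bypass_def)
          qed
          then have "cycle_list ?\<tau> xs"
            using xs(1) by (simp add: cycle_list_def del: map_eq_conv)
          then show ?thesis
            using False y_xs by (auto simp: ys_def)
        qed
        then show "cycle_list ?\<tau> ys" "set ys = set xs - {x}" "y \<in> set ys"
          "set ys \<subseteq> M \<longleftrightarrow> set xs \<subseteq> M" "filter (\<lambda>z. z \<notin> M) ys = filter (\<lambda>z. z \<notin> M) xs"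
          "set xs \<subseteq> M \<Longrightarrow> vert (hd ys) = vert (hd xs)"
          by blast+
      qed
      have xsX: "set xs \<subseteq> X"
        using xs(2) orbit_subset_structure[OF S yX] by simp
      have "necklace_at lab vert \<sigma> M y = (if set xs \<subseteq> M then Trivial (vert (hd xs))
          else Cyclic (cyclic_word (map lab (filter (\<lambda>y. y \<notin> M) xs))))"
        using xs(1) y_xs by (rule necklace_at_cycle_list)
          (use S xsX in \<open>auto simp: necklace_structure_def\<close>)
      moreover have "necklace_at lab vert ?\<tau> M y = (if set ys \<subseteq> M then Trivial (vert (hd ys))
          else Cyclic (cyclic_word (map lab (filter (\<lambda>y. y \<notin> M) ys))))"
        using ys(1,3) by (rule necklace_at_cycle_list)
          (use S' xsX ys(2) in \<open>auto simp: necklace_structure_def\<close>)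
      ultimately show ?thesis
        using ys orbit_cycle_list[OF ys(1,3)] xs(2) by simp
    qed
    have "collection_of lab vert ?\<tau> M (X - {x}) =
        image_mset (\<lambda>K. necklace_at lab vert \<sigma> M (SOME x. x \<in> K)) (mset_set (orbit \<sigma> ` (X - {x})))"
    proof (rule collection_of_eq[OF S'])
      fix y z
      assume yz: "y \<in> X - {x}" "z \<in> X - {x}"
      show "orbit \<sigma> y = orbit \<sigma> z \<longleftrightarrow> orbit ?\<tau> y = orbit ?\<tau> z"
      proof
        assume "orbit ?\<tau> y = orbit ?\<tau> z"
        moreover have "y \<in> orbit ?\<tau> y"
          using S' yz(1) by (rule self_in_orbit)
        ultimately have "y \<in> orbit \<sigma> z"
          using orbit_neck yz by auto
        then show "orbit \<sigma> y = orbit \<sigma> z"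
          using orbit_eq[OF S] yz by auto
      qed (use orbit_neck yz in auto)
    next
      fix y
      assume "y \<in> X - {x}"
      then show "necklace_at lab vert \<sigma> M (SOME z. z \<in> orbit \<sigma> y) = necklace_at lab vert ?\<tau> M y"
        using orbit_neck necklace_at_some_orbit[OF S, of y] by auto
    qed
    \<comment> \<open>The orbit of \<open>x\<close> is still represented, by
      \<open>\<sigma> x\<close>, so no member is lost.\<close>
    moreover have "orbit \<sigma> ` (X - {x}) = orbit \<sigma> ` X"
    proof -
      have "orbit \<sigma> x = orbit \<sigma> (\<sigma> x)"
        using orbit_eq[OF S True orbit.base] by simp
      moreover have "\<sigma> x \<in> X - {x}"
        using \<sigma>X True x by simp
      ultimately show ?thesis
        by blast
    qed
    ultimately show ?thesis
      using S' by (simp add: collection_of_def)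
  qed
  then show "collection_of lab vert (bypass \<sigma> x) M (X - {x}) = collection_of lab vert \<sigma> M X"
    and "necklace_structure Q lab vert (bypass \<sigma> x) M (X - {x})"
    by blast+
qed

section \<open>The coproduct of a marked structure\<close>

text \<open>
  A pairing \<open>(J, \<phi>)\<close> is encoded by \<open>\<phi>\<close> alone, extended by the identity outside \<open>J\<close>: an edge and its
  reverse differ, so \<open>J\<close> is recovered as the set of points moved by \<open>\<phi>\<close>, and the successor map is
  \<open>\<sigma> \<circ> \<phi>\<close>. A colouring of the members is encoded by the set \<open>A\<close> of the elements of colour 1; only
  the colourings of nonzero sign are kept, those for which \<open>\<phi>\<close> exchanges the colours on \<open>J\<close>.
\<close>

definition edge_pairings ::
    "('x \<Rightarrow> 'e + 'e) \<Rightarrow> 'x set \<Rightarrow> 'x set \<Rightarrow> ('x \<Rightarrow> 'x) set" where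
  "edge_pairings lab M X =
     {\<phi>. (\<forall>x. \<phi> (\<phi> x) = x) \<and>
        (\<forall>x. \<phi> x \<noteq> x \<longrightarrow> x \<in> X \<and> x \<notin> M \<and> lab (\<phi> x) = edge_reversal (lab x))}"

abbreviation moved :: "('x \<Rightarrow> 'x) \<Rightarrow> 'x set" where
  "moved \<phi> \<equiv> {x. \<phi> x \<noteq> x}"

definition splittings ::
    "('x \<Rightarrow> 'e + 'e) \<Rightarrow> ('x \<Rightarrow> 'x) \<Rightarrow> 'x set \<Rightarrow> 'x set \<Rightarrow> (('x \<Rightarrow> 'x) \<times> 'x set) set" where
  "splittings lab \<sigma> M X =
     {(\<phi>, A). \<phi> \<in> edge_pairings lab M X \<and> A \<subseteq> X \<and> (\<sigma> \<circ> \<phi>) ` A \<subseteq> A \<and>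
        (\<forall>x. \<phi> x \<noteq> x \<longrightarrow> (\<phi> x \<in> A \<longleftrightarrow> x \<notin> A))}"

text \<open>Every pair has exactly one member \<open>x\<close> in the quiver itself, found by
  \<open>isl\<close>. Its factor is h/2 times the sign of the pair, which is positive when
  \<open>x\<close> has colour 1. Keeping one factor per pair lets weights multiply when disjoint
  pairings are combined.\<close>

definition pairing_weight ::
    "('x \<Rightarrow> 'e + 'e) \<Rightarrow> ('x \<Rightarrow> 'x) \<Rightarrow> 'x set \<Rightarrow> 'k::field_char_0 poly" where
  "pairing_weight lab \<phi> A =
     (\<Prod>x | \<phi> x \<noteq> x \<and> isl (lab x). monom (if x \<in> A then 1 / 2 else - 1 / 2) 1)"

definition split_coproduct ::
    "('x \<Rightarrow> 'e + 'e) \<Rightarrow> ('x \<Rightarrow> 'v) \<Rightarrow> ('x \<Rightarrow> 'x) \<Rightarrow> 'x set \<Rightarrow> 'x set \<Rightarrow>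
     (('v, 'e) collection \<times> ('v, 'e) collection \<Rightarrow>\<^sub>0 'k::field_char_0 poly)" where
  "split_coproduct lab vert \<sigma> M X =
     (\<Sum>(\<phi>, A)\<in>splittings lab \<sigma> M X.
        Poly_Mapping.single
          (collection_of lab vert (\<sigma> \<circ> \<phi>) (M \<union> moved \<phi>) A,
           collection_of lab vert (\<sigma> \<circ> \<phi>) (M \<union> moved \<phi>) (X - A))
          (pairing_weight lab \<phi> A))"

section \<open>Splittings and the marked structures they produce\<close>

lemma edge_pairings_permutes:
  assumes "\<phi> \<in> edge_pairings lab M X"
  shows "\<phi> permutes X"
  using assms unfolding edge_pairings_def permutes_def by auto metis

lemma finite_splittings:
  assumes "finite X"
  shows "finite (splittings lab \<sigma> M X)"
proof (rule finite_subset)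
  show "splittings lab \<sigma> M X \<subseteq> {\<phi>. \<phi> permutes X} \<times> Pow X"
    using edge_pairings_permutes by (auto simp: splittings_def)
  show "finite ({\<phi>. \<phi> permutes X} \<times> Pow X)"
    using assms by (simp add: finite_permutations)
qed

lemma finite_moved:
  assumes "finite X" "\<phi> \<in> edge_pairings lab M X"
  shows "finite (moved \<phi>)"
  by (rule finite_subset[OF _ assms(1)]) (use assms(2) in \<open>auto simp: edge_pairings_def\<close>)

text \<open>The new successor of a paired \<open>x\<close> starts where its partner ends. The
  partner is the reverse of \<open>x\<close>, so this is the vertex where \<open>x\<close> starts,
  as a marked element demands.\<close>

lemma necklace_structure_edge_pairing:
  assumes S: "necklace_structure Q lab vert \<sigma> M X" and \<phi>: "\<phi> \<in> edge_pairings lab M X"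
  shows "necklace_structure Q lab vert (\<sigma> \<circ> \<phi>) (M \<union> moved \<phi>) X"
proof -
  have fin: "finite X" and bij: "bij_betw \<sigma> X X"
    using S by (auto simp: necklace_structure_def)
  have "bij_betw (\<sigma> \<circ> \<phi>) X X"
    by (rule bij_betw_trans[OF permutes_imp_bij[OF edge_pairings_permutes[OF \<phi>]] bij])
  moreover
  have "vert (\<sigma> (\<phi> x)) = vert x" if "\<phi> x \<noteq> x" for x
  proof -
    have moved: "x \<in> X - M" "\<phi> x \<in> X - M" "lab (\<phi> x) = edge_reversal (lab x)"
      using \<phi> that by (auto simp: edge_pairings_def)
    have "head (double_quiver Q) (lab (\<phi> x)) = vert (\<sigma> (\<phi> x))"
      using S moved(2) by (simp add: necklace_structure_def)
    then have "vert (\<sigma> (\<phi> x)) = head (double_quiver Q) (edge_reversal (lab x))"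
      by (simp add: moved(3))
    also have "\<dots> = tail (double_quiver Q) (lab x)"
      by (auto simp: double_quiver_def edge_reversal_def split: sum.split)
    also have "\<dots> = vert x"
      using S moved by (auto simp: necklace_structure_def)
    finally show ?thesis .
  qed
  then have "vert (\<sigma> (\<phi> x)) = vert x" if "x \<in> X \<inter> (M \<union> moved \<phi>)" for x
    using that S by (cases "\<phi> x = x") (auto simp: necklace_structure_def)
  ultimately show ?thesis
    using S by (auto simp: necklace_structure_def)
qed

lemma necklace_structure_splitting:
  assumes S: "necklace_structure Q lab vert \<sigma> M X" and \<phi>: "(\<phi>, A) \<in> splittings lab \<sigma> M X"
  shows "necklace_structure Q lab vert (\<sigma> \<circ> \<phi>) (M \<union> moved \<phi>) A"
    "necklace_structure Q lab vert (\<sigma> \<circ> \<phi>) (M \<union> moved \<phi>) (X - A)"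
  using necklace_structure_closed_subset[OF necklace_structure_edge_pairing[OF S, of \<phi>], of A] \<phi>
  by (auto simp: splittings_def)

text \<open>The complement of a union of cycles is again closed, which gives the converse of
  closure.\<close>

lemma closed_iff_splitting:
  assumes S: "necklace_structure Q lab vert \<sigma> M X" and \<phi>: "(\<phi>, A) \<in> splittings lab \<sigma> M X"
    and "x \<in> X"
  shows "\<sigma> (\<phi> x) \<in> A \<longleftrightarrow> x \<in> A"
  using necklace_structure_splitting[OF assms(1,2)] assms(3)
  by (force simp: necklace_structure_def bij_betw_def)

lemma sum_reindex_pairs:
  assumes "\<And>a b. (a, b) \<in> S \<Longrightarrow> (p a b, q a b) \<in> T"
    and "\<And>a b. (a, b) \<in> S \<Longrightarrow> p' (p a b) (q a b) = a"
    and "\<And>a b. (a, b) \<in> S \<Longrightarrow> q' (p a b) (q a b) = b"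
    and "\<And>c d. (c, d) \<in> T \<Longrightarrow> (p' c d, q' c d) \<in> S"
    and "\<And>c d. (c, d) \<in> T \<Longrightarrow> p (p' c d) (q' c d) = c"
    and "\<And>c d. (c, d) \<in> T \<Longrightarrow> q (p' c d) (q' c d) = d"
    and "\<And>a b. (a, b) \<in> S \<Longrightarrow> h (p a b) (q a b) = g a b"
  shows "(\<Sum>(a, b)\<in>S. g a b) = (\<Sum>(c, d)\<in>T. h c d)"
  by (rule sum.reindex_bij_witness[where i = "\<lambda>(c, d). (p' c d, q' c d)"
        and j = "\<lambda>(a, b). (p a b, q a b)"]) (auto simp: assms)

text \<open>A marked \<open>x\<close> is fixed by every pairing, so
  \<open>bypass \<sigma> x \<circ> \<phi>\<close> equals
  \<open>bypass (\<sigma> \<circ> \<phi>) x\<close>. The colour of \<open>x\<close> is not free,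
  since it agrees with that of \<open>\<sigma> x\<close>; hence colour sets with and without
  \<open>x\<close> correspond.\<close>

lemma split_coproduct_bypass:
  assumes S: "necklace_structure Q lab vert \<sigma> M X" and x: "x \<in> X" "x \<in> M" "\<sigma> x \<noteq> x"
  shows "split_coproduct lab vert (bypass \<sigma> x) M (X - {x}) =
    (split_coproduct lab vert \<sigma> M X :: _ \<Rightarrow>\<^sub>0 'k::field_char_0 poly)"
proof -
  have fix_x: "\<phi> x = x" "bypass \<sigma> x \<circ> \<phi> = bypass (\<sigma> \<circ> \<phi>) x" if "\<phi> \<in> edge_pairings lab M X" for \<phi>
  proof -
    show "\<phi> x = x"
      using that x by (auto simp: edge_pairings_def)
    then show "bypass \<sigma> x \<circ> \<phi> = bypass (\<sigma> \<circ> \<phi>) x"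
      by (simp add: bypass_def fun_eq_iff)
  qed
  have pairings_eq: "edge_pairings lab M (X - {x}) = edge_pairings lab M X"
    using x by (auto simp: edge_pairings_def)
  have \<sigma>x: "\<sigma> x \<in> X"
    using S x by (auto simp: necklace_structure_def bij_betw_def)
  show ?thesis
    unfolding split_coproduct_def
  proof (rule sum_reindex_pairs[where p = "\<lambda>\<phi> B. \<phi>" and p' = "\<lambda>\<phi> A. \<phi>"
        and q = "\<lambda>\<phi> B. if \<sigma> x \<in> B then insert x B else B" and q' = "\<lambda>\<phi> A. A - {x}"])
    fix \<phi> B
    assume "(\<phi>, B) \<in> splittings lab (bypass \<sigma> x) M (X - {x})"
    then have \<phi>: "\<phi> \<in> edge_pairings lab M X" and B: "B \<subseteq> X - {x}"
      and closed: "\<And>y. y \<in> B \<Longrightarrow> bypass (\<sigma> \<circ> \<phi>) x y \<in> B"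
      and swap: "\<And>y. \<phi> y \<noteq> y \<Longrightarrow> \<phi> y \<in> B \<longleftrightarrow> y \<notin> B"
      by (auto simp: splittings_def pairings_eq fix_x(2)[symmetric])
    have inv: "\<phi> (\<phi> y) = y" for y
      using \<phi> by (simp add: edge_pairings_def)
    let ?A = "if \<sigma> x \<in> B then insert x B else B"
    show "\<phi> = \<phi>" "?A - {x} = B"
      using B by auto
    have closed': "(\<sigma> \<circ> \<phi>) ` ?A \<subseteq> ?A"
    proof (rule image_subsetI)
      fix y
      assume "y \<in> ?A"
      then show "(\<sigma> \<circ> \<phi>) y \<in> ?A"
        using closed[of y] fix_x(1)[OF \<phi>] by (auto simp: bypass_def split: if_splits)
    qed
    have sub: "?A \<subseteq> X"
      using B x by auto
    have swap': "\<phi> y \<in> ?A \<longleftrightarrow> y \<notin> ?A" if "\<phi> y \<noteq> y" for y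
      using swap[OF that] that inv[of y] fix_x(1)[OF \<phi>] by auto
    show A: "(\<phi>, ?A) \<in> splittings lab \<sigma> M X"
      unfolding splittings_def mem_Collect_eq prod.case
      by (intro conjI allI impI \<phi> sub closed', rule swap', assumption)
    have bypass: "collection_of lab vert (bypass \<sigma> x \<circ> \<phi>) (M \<union> moved \<phi>) (C - {x}) =
        collection_of lab vert (\<sigma> \<circ> \<phi>) (M \<union> moved \<phi>) C"
      if "necklace_structure Q lab vert (\<sigma> \<circ> \<phi>) (M \<union> moved \<phi>) C" for C
      unfolding fix_x(2)[OF \<phi>]
      by (rule necklace_structure_bypass(1)[OF that]) (use x fix_x(1)[OF \<phi>] in auto)
    have "B = ?A - {x}" "X - {x} - B = (X - ?A) - {x}"
      using B by auto
    moreover have "pairing_weight lab \<phi> ?A = (pairing_weight lab \<phi> B :: 'k poly)"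
      unfolding pairing_weight_def by (rule prod.cong) (use fix_x(1)[OF \<phi>] in auto)
    ultimately show "Poly_Mapping.single
          (collection_of lab vert (\<sigma> \<circ> \<phi>) (M \<union> moved \<phi>) ?A,
           collection_of lab vert (\<sigma> \<circ> \<phi>) (M \<union> moved \<phi>) (X - ?A))
          (pairing_weight lab \<phi> ?A :: 'k poly) =
        Poly_Mapping.single
          (collection_of lab vert (bypass \<sigma> x \<circ> \<phi>) (M \<union> moved \<phi>) B,
           collection_of lab vert (bypass \<sigma> x \<circ> \<phi>) (M \<union> moved \<phi>) (X - {x} - B))
          (pairing_weight lab \<phi> B)"
      using bypass[OF necklace_structure_splitting(1)[OF S A]]
        bypass[OF necklace_structure_splitting(2)[OF S A]] by (simp only:)
  next
    fix \<phi> A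
    assume \<phi>A: "(\<phi>, A) \<in> splittings lab \<sigma> M X"
    then have \<phi>: "\<phi> \<in> edge_pairings lab M X" and A: "A \<subseteq> X"
      and swap: "\<And>y. \<phi> y \<noteq> y \<Longrightarrow> \<phi> y \<in> A \<longleftrightarrow> y \<notin> A"
      by (auto simp: splittings_def)
    note closed = closed_iff_splitting[OF S \<phi>A]
    have inv: "\<phi> (\<phi> y) = y" for y
      using \<phi> by (simp add: edge_pairings_def)
    have x_iff: "\<sigma> x \<in> A \<longleftrightarrow> x \<in> A"
      using closed[OF x(1)] fix_x(1)[OF \<phi>] by simp
    then show "\<phi> = \<phi>" "(if \<sigma> x \<in> A - {x} then insert x (A - {x}) else A - {x}) = A"
      using x by auto
    have "(bypass \<sigma> x \<circ> \<phi>) y \<in> A - {x}" if "y \<in> A - {x}" for y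
    proof -
      have "\<sigma> (\<phi> y) \<in> A"
        using closed[of y] that A by auto
      then show ?thesis
        using x_iff x by (auto simp: bypass_def)
    qed
    moreover have "\<phi> y \<in> A - {x} \<longleftrightarrow> y \<notin> A - {x}" if "\<phi> y \<noteq> y" for y
      using swap[OF that] that inv[of y] fix_x(1)[OF \<phi>] by auto
    ultimately show "(\<phi>, A - {x}) \<in> splittings lab (bypass \<sigma> x) M (X - {x})"
      using \<phi> A by (auto simp: splittings_def pairings_eq)
  qed
qed

section \<open>Reduction to fixed marks, and transport along isomorphisms\<close>

lemma reduce_necklace_structure:
  assumes "necklace_structure Q lab vert \<sigma> M X"
  obtains \<sigma>' X' where "necklace_structure Q lab vert \<sigma>' M X'" "\<And>x. x \<in> X' \<inter> M \<Longrightarrow> \<sigma>' x = x"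
    "collection_of lab vert \<sigma>' M X' = collection_of lab vert \<sigma> M X"
    "split_coproduct lab vert \<sigma>' M X' =
      (split_coproduct lab vert \<sigma> M X :: _ \<Rightarrow>\<^sub>0 'k::field_char_0 poly)"
proof -
  have "\<exists>\<sigma>' X'. necklace_structure Q lab vert \<sigma>' M X' \<and> (\<forall>x\<in>X' \<inter> M. \<sigma>' x = x) \<and>
    collection_of lab vert \<sigma>' M X' = collection_of lab vert \<sigma> M X \<and>
    split_coproduct lab vert \<sigma>' M X' =
      (split_coproduct lab vert \<sigma> M X :: _ \<Rightarrow>\<^sub>0 'k::field_char_0 poly)"
    using assms
  proof (induction "card X" arbitrary: \<sigma> X rule: less_induct)
    case less
    show ?case
    proof (cases "\<forall>x\<in>X \<inter> M. \<sigma> x = x")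
      case False
      then obtain x where x: "x \<in> X" "x \<in> M" "\<sigma> x \<noteq> x"
        by blast
      have "card (X - {x}) < card X"
        using less.prems x(1) by (intro card_Diff1_less) (auto simp: necklace_structure_def)
      from less.hyps[OF this necklace_structure_bypass(2)[OF less.prems x(2,3)]] show ?thesis
        unfolding necklace_structure_bypass(1)[OF less.prems x(2,3)]
          split_coproduct_bypass[OF less.prems x] .
    qed (use less.prems in blast)
  qed
  with that show ?thesis
    by blast
qed

text \<open>Pairings are conjugated by \<open>b\<close>; \<open>transport\<close> is the identity
  off the image because members of \<open>edge_pairings\<close> move only points of their carrier.
  The inverse \<open>c\<close> is a parameter so that the lemma can also be used with
  \<open>b\<close> and \<open>c\<close> exchanged.\<close>

lemma splitting_image:
  fixes b :: "'x \<Rightarrow> 'y" and c :: "'y \<Rightarrow> 'x"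
  defines "transport \<equiv> \<lambda>X \<phi> y. if y \<in> b ` X then b (\<phi> (c y)) else y"
  assumes S: "necklace_structure Q lab vert \<sigma> M X" and c: "\<And>x. x \<in> X \<Longrightarrow> c (b x) = x"
    and \<sigma>: "\<And>x. x \<in> X \<Longrightarrow> \<sigma>' (b x) = b (\<sigma> x)"
    and M: "\<And>x. x \<in> X \<Longrightarrow> b x \<in> M' \<longleftrightarrow> x \<in> M"
    and lab: "\<And>x. x \<in> X \<Longrightarrow> x \<notin> M \<Longrightarrow> lab' (b x) = lab x"
    and vert: "\<And>x. x \<in> X \<Longrightarrow> vert' (b x) = vert x"
    and \<phi>A: "(\<phi>, A) \<in> splittings lab \<sigma> M X"
  defines "\<phi>' \<equiv> transport X \<phi>"
  shows "(\<phi>', b ` A) \<in> splittings lab' \<sigma>' M' (b ` X)"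
    and "pairing_weight lab' \<phi>' (b ` A) = (pairing_weight lab \<phi> A :: 'k::field_char_0 poly)"
    and "collection_of lab' vert' (\<sigma>' \<circ> \<phi>') (M' \<union> moved \<phi>') (b ` A) =
      collection_of lab vert (\<sigma> \<circ> \<phi>) (M \<union> moved \<phi>) A"
    and "collection_of lab' vert' (\<sigma>' \<circ> \<phi>') (M' \<union> moved \<phi>') (b ` X - b ` A) =
      collection_of lab vert (\<sigma> \<circ> \<phi>) (M \<union> moved \<phi>) (X - A)"
proof -
  have inj: "inj_on b X"
    by (rule inj_on_inverseI[of _ c]) (rule c)
  have \<phi>: "\<phi> \<in> edge_pairings lab M X" and A: "A \<subseteq> X"
    and closed: "\<And>x. x \<in> A \<Longrightarrow> \<sigma> (\<phi> x) \<in> A"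
    and swap: "\<And>x. \<phi> x \<noteq> x \<Longrightarrow> \<phi> x \<in> A \<longleftrightarrow> x \<notin> A"
    using \<phi>A by (auto simp: splittings_def)
  have inv: "\<phi> (\<phi> x) = x" for x
    using \<phi> by (simp add: edge_pairings_def)
  have \<phi>X: "\<phi> x \<in> X" if "x \<in> X" for x
    using permutes_in_image[OF edge_pairings_permutes[OF \<phi>]] that by blast
  have \<phi>'b: "\<phi>' (b x) = b (\<phi> x)" if "x \<in> X" for x
    using that by (simp add: \<phi>'_def transport_def c)
  have \<phi>'_out: "\<phi>' y = y" if "y \<notin> b ` X" for y
    using that by (simp add: \<phi>'_def transport_def)
  have b_eq: "b x = b y \<longleftrightarrow> x = y" if "x \<in> X" "y \<in> X" for x y
    using that inj by (auto simp: inj_on_def)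
  have b_in: "b x \<in> b ` B \<longleftrightarrow> x \<in> B" if "x \<in> X" "B \<subseteq> X" for x B
    using inj_on_image_mem_iff[OF inj] that by blast
  have "\<phi>' (\<phi>' y) = y" for y
    by (cases "y \<in> b ` X") (auto simp: \<phi>'b \<phi>'_out \<phi>X inv)
  moreover have "y \<in> b ` X \<and> y \<notin> M' \<and> lab' (\<phi>' y) = edge_reversal (lab' y) \<and>
      (\<phi>' y \<in> b ` A \<longleftrightarrow> y \<notin> b ` A)"
    if "\<phi>' y \<noteq> y" for y
  proof -
    from that \<phi>'_out obtain x where x: "x \<in> X" "y = b x"
      by blast
    then have "\<phi> x \<noteq> x"
      using that \<phi>'b by auto
    then have "x \<notin> M" "\<phi> x \<notin> M" "lab (\<phi> x) = edge_reversal (lab x)" "\<phi> x \<in> A \<longleftrightarrow> x \<notin> A"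
      using \<phi> swap inv by (auto simp: edge_pairings_def)
    with x show ?thesis
      using A by (simp add: \<phi>'b M lab \<phi>X b_in)
  qed
  moreover have "\<sigma>' (\<phi>' y) \<in> b ` A" if "y \<in> b ` A" for y
    using that A closed by (auto simp: \<phi>'b \<sigma> \<phi>X subset_iff)
  ultimately show "(\<phi>', b ` A) \<in> splittings lab' \<sigma>' M' (b ` X)"
    using A by (auto simp: splittings_def edge_pairings_def)
  have moved_iff: "\<phi>' (b x) \<noteq> b x \<longleftrightarrow> \<phi> x \<noteq> x" if "x \<in> X" for x
    using that by (simp add: \<phi>'b b_eq \<phi>X)
  have moved_X: "x \<in> X \<and> x \<notin> M" if "\<phi> x \<noteq> x" for x
    using that \<phi> by (auto simp: edge_pairings_def)
  have "{y. \<phi>' y \<noteq> y \<and> isl (lab' y)} = b ` {x. \<phi> x \<noteq> x \<and> isl (lab x)}"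
  proof (intro set_eqI iffI)
    fix y
    assume y: "y \<in> {y. \<phi>' y \<noteq> y \<and> isl (lab' y)}"
    then obtain x where "x \<in> X" "y = b x"
      using \<phi>'_out by blast
    with y show "y \<in> b ` {x. \<phi> x \<noteq> x \<and> isl (lab x)}"
      using moved_X[of x] by (auto simp: moved_iff lab)
  next
    fix y
    assume "y \<in> b ` {x. \<phi> x \<noteq> x \<and> isl (lab x)}"
    then obtain x where "\<phi> x \<noteq> x" "isl (lab x)" "y = b x"
      by blast
    with moved_X[of x] show "y \<in> {y. \<phi>' y \<noteq> y \<and> isl (lab' y)}"
      by (simp add: moved_iff lab)
  qed
  moreover have "inj_on b {x. \<phi> x \<noteq> x \<and> isl (lab x)}"
    by (rule inj_on_subset[OF inj]) (use moved_X in auto)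
  ultimately show "pairing_weight lab' \<phi>' (b ` A) = (pairing_weight lab \<phi> A :: 'k poly)"
    unfolding pairing_weight_def using moved_X A
    by (auto simp: prod.reindex b_in intro!: prod.cong)
  note image = necklace_structure_image(2)[where lab' = lab' and vert' = vert' and \<sigma>' = "\<sigma>' \<circ> \<phi>'"
      and M' = "M' \<union> moved \<phi>'" and b = b]
  show "collection_of lab' vert' (\<sigma>' \<circ> \<phi>') (M' \<union> moved \<phi>') (b ` A) =
      collection_of lab vert (\<sigma> \<circ> \<phi>) (M \<union> moved \<phi>) A"
    by (rule image[OF necklace_structure_splitting(1)[OF S \<phi>A]])
      (use A inj_on_subset[OF inj A] in
        \<open>auto simp: \<phi>'b \<phi>X \<sigma> M lab vert moved_iff b_eq subset_iff\<close>)
  have "b ` X - b ` A = b ` (X - A)"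
    using A inj by (simp add: inj_on_image_set_diff)
  then show "collection_of lab' vert' (\<sigma>' \<circ> \<phi>') (M' \<union> moved \<phi>') (b ` X - b ` A) =
      collection_of lab vert (\<sigma> \<circ> \<phi>) (M \<union> moved \<phi>) (X - A)"
    by (simp only:) (rule image[OF necklace_structure_splitting(2)[OF S \<phi>A]],
      use inj_on_subset[OF inj, of "X - A"] in
        \<open>auto simp: \<phi>'b \<phi>X \<sigma> M lab vert moved_iff b_eq\<close>)
qed

lemma split_coproduct_image:
  assumes S: "necklace_structure Q lab vert \<sigma> M X" and inj: "inj_on b X"
    and \<sigma>: "\<And>x. x \<in> X \<Longrightarrow> \<sigma>' (b x) = b (\<sigma> x)"
    and M: "\<And>x. x \<in> X \<Longrightarrow> b x \<in> M' \<longleftrightarrow> x \<in> M"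
    and lab: "\<And>x. x \<in> X \<Longrightarrow> x \<notin> M \<Longrightarrow> lab' (b x) = lab x"
    and vert: "\<And>x. x \<in> X \<Longrightarrow> vert' (b x) = vert x"
  shows "split_coproduct lab' vert' \<sigma>' M' (b ` X) =
    (split_coproduct lab vert \<sigma> M X :: _ \<Rightarrow>\<^sub>0 'k::field_char_0 poly)"
proof -
  define c where "c = inv_into X b"
  have c: "c (b x) = x" if "x \<in> X" for x
    unfolding c_def using inj that by (rule inv_into_f_f)
  have S': "necklace_structure Q lab' vert' \<sigma>' M' (b ` X)"
    using assms by (rule necklace_structure_image(1))
  have cb: "c ` b ` X = X"
    by (force simp: image_image c)
  have \<sigma>X: "\<sigma> x \<in> X" if "x \<in> X" for x
    using S that by (auto simp: necklace_structure_def bij_betw_def)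
  define push where "push \<phi> y = (if y \<in> b ` X then b (\<phi> (c y)) else y)" for \<phi> y
  define pull where "pull \<phi>' x = (if x \<in> X then c (\<phi>' (b x)) else x)" for \<phi>' x
  note forward = splitting_image[where b = b and c = c and lab' = lab' and \<sigma>' = \<sigma>' and M' = M'
      and vert' = vert', OF S c \<sigma> M lab vert]
  have "b (c y) = y" "\<sigma> (c y) = c (\<sigma>' y)" "c y \<in> M \<longleftrightarrow> y \<in> M'" "y \<notin> M' \<Longrightarrow> lab (c y) = lab' y"
    "vert (c y) = vert' y" if "y \<in> b ` X" for y
    using that by (auto simp: c \<sigma> \<sigma>X M lab vert)
  \<comment> \<open>The isomorphism read in reverse: it shows that \<open>pull\<close> lands in the
    splittings of \<open>X\<close>.\<close>
  note backward = splitting_image(1)[where b = c and c = b and lab' = lab and \<sigma>' = \<sigma> and M' = M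
      and vert' = vert, OF S' this, unfolded cb]
  show ?thesis
    unfolding split_coproduct_def
  proof (rule sum_reindex_pairs[where p' = "\<lambda>\<phi> A. push \<phi>" and q' = "\<lambda>\<phi> A. b ` A"
        and p = "\<lambda>\<phi>' A'. pull \<phi>'" and q = "\<lambda>\<phi>' A'. c ` A'"])
    fix \<phi> A
    assume \<phi>A: "(\<phi>, A) \<in> splittings lab \<sigma> M X"
    show "(push \<phi>, b ` A) \<in> splittings lab' \<sigma>' M' (b ` X)"
      unfolding push_def[abs_def] by (rule forward(1)) (simp_all add: \<phi>A)
    have \<phi>: "\<phi> permutes X" and A: "A \<subseteq> X"
      using \<phi>A edge_pairings_permutes by (auto simp: splittings_def)
    show "pull (push \<phi>) = \<phi>"
      using \<phi> by (auto simp: fun_eq_iff pull_def push_def c permutes_in_image permutes_not_in)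
    show "c ` b ` A = A"
      using A by (force simp: image_image c subset_iff)
  next
    fix \<phi>' A'
    assume \<phi>A': "(\<phi>', A') \<in> splittings lab' \<sigma>' M' (b ` X)"
    show \<phi>A: "(pull \<phi>', c ` A') \<in> splittings lab \<sigma> M X"
      unfolding pull_def[abs_def] by (rule backward) (simp_all add: \<phi>A')
    have \<phi>': "\<phi>' permutes b ` X" and A': "A' \<subseteq> b ` X"
      using \<phi>A' edge_pairings_permutes by (auto simp: splittings_def)
    have bc: "b (c y) = y" if "y \<in> b ` X" for y
      using that c by auto
    have "c y \<in> X" if "y \<in> b ` X" for y
      using that c by auto
    then show 1: "push (pull \<phi>') = \<phi>'"
      using \<phi>' by (auto simp: fun_eq_iff pull_def push_def bc permutes_in_image permutes_not_in)
    have 3: "(if y \<in> b ` X then b (pull \<phi>' (c y)) else y) = \<phi>' y" for y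
      using 1 by (simp flip: push_def)
    show 2: "b ` c ` A' = A'"
      using A' bc by (force simp: image_image subset_iff)
    have "pairing_weight lab' (\<lambda>y. if y \<in> b ` X then b (pull \<phi>' (c y)) else y) (b ` c ` A') =
        (pairing_weight lab (pull \<phi>') (c ` A') :: 'k poly)"
      by (rule forward(2)) (simp_all add: \<phi>A)
    then show "Poly_Mapping.single
          (collection_of lab vert (\<sigma> \<circ> pull \<phi>') (M \<union> moved (pull \<phi>')) (c ` A'),
           collection_of lab vert (\<sigma> \<circ> pull \<phi>') (M \<union> moved (pull \<phi>')) (X - c ` A'))
          (pairing_weight lab (pull \<phi>') (c ` A') :: 'k poly) =
        Poly_Mapping.single
          (collection_of lab' vert' (\<sigma>' \<circ> \<phi>') (M' \<union> moved \<phi>') A',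
           collection_of lab' vert' (\<sigma>' \<circ> \<phi>') (M' \<union> moved \<phi>') (b ` X - A'))
          (pairing_weight lab' \<phi>' A')"
      using forward(3,4)[OF _ _ _ _ _ _ \<phi>A] by (simp add: 2 3)
  qed
qed

section \<open>Iterated coproducts\<close>

text \<open>Testing both \<open>x\<close> and \<open>\<theta> x\<close> makes the condition
  symmetric within a pair, so this part of an involution and the complementary
  \<open>avoiding\<close> are again involutions. In use, \<open>C\<close> is the colour class that
  is split off first.\<close>

definition meeting :: "('x \<Rightarrow> 'x) \<Rightarrow> 'x set \<Rightarrow> 'x \<Rightarrow> 'x" where
  "meeting \<theta> C x = (if x \<in> C \<or> \<theta> x \<in> C then \<theta> x else x)"

definition avoiding :: "('x \<Rightarrow> 'x) \<Rightarrow> 'x set \<Rightarrow> 'x \<Rightarrow> 'x" where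
  "avoiding \<theta> C x = (if x \<in> C \<or> \<theta> x \<in> C then x else \<theta> x)"

text \<open>
  \<open>A\<close> and \<open>B\<close> are the sets of elements of colours 1 and 2; the other elements of \<open>X\<close> have colour 3.
\<close>

definition triple_splittings ::
    "('x \<Rightarrow> 'e + 'e) \<Rightarrow> ('x \<Rightarrow> 'x) \<Rightarrow> 'x set \<Rightarrow> 'x set \<Rightarrow>
     (('x \<Rightarrow> 'x) \<times> 'x set \<times> 'x set) set" where
  "triple_splittings lab \<sigma> M X =
     {(\<theta>, A, B). \<theta> \<in> edge_pairings lab M X \<and> A \<subseteq> X \<and> B \<subseteq> X \<and> A \<inter> B = {} \<and>
        (\<sigma> \<circ> \<theta>) ` A \<subseteq> A \<and> (\<sigma> \<circ> \<theta>) ` B \<subseteq> B \<and>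
        (\<forall>x. \<theta> x \<noteq> x \<longrightarrow>
           \<not> (x \<in> A \<and> \<theta> x \<in> A) \<and> \<not> (x \<in> B \<and> \<theta> x \<in> B) \<and> (x \<in> A \<union> B \<or> \<theta> x \<in> A \<union> B))}"

text \<open>The factor of a pair is positive exactly when its member in the quiver itself has the
  smaller colour: colour 1, or colour 2 with a partner of colour 3.\<close>

definition triple_coproduct ::
    "('x \<Rightarrow> 'e + 'e) \<Rightarrow> ('x \<Rightarrow> 'v) \<Rightarrow> ('x \<Rightarrow> 'x) \<Rightarrow> 'x set \<Rightarrow> 'x set \<Rightarrow>
     (('v, 'e) collection \<times> ('v, 'e) collection \<times> ('v, 'e) collection \<Rightarrow>\<^sub>0
       'k::field_char_0 poly)" where
  "triple_coproduct lab vert \<sigma> M X =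
     (\<Sum>(\<theta>, A, B)\<in>triple_splittings lab \<sigma> M X.
        Poly_Mapping.single
          (collection_of lab vert (\<sigma> \<circ> \<theta>) (M \<union> moved \<theta>) A,
           collection_of lab vert (\<sigma> \<circ> \<theta>) (M \<union> moved \<theta>) B,
           collection_of lab vert (\<sigma> \<circ> \<theta>) (M \<union> moved \<theta>) (X - A - B))
          (\<Prod>x | \<theta> x \<noteq> x \<and> isl (lab x).
             monom (if x \<in> A \<or> x \<in> B \<and> \<theta> x \<notin> A then 1 / 2 else - 1 / 2) 1))"

text \<open>Points moved by \<open>\<phi>\<close> are marked when \<open>\<psi>\<close> is chosen,
  so the supports are disjoint and the composite is just the union of the two sets of pairs.\<close>

lemma edge_pairings_comp:
  assumes \<phi>: "\<phi> \<in> edge_pairings lab M X" and \<psi>: "\<psi> \<in> edge_pairings lab (M \<union> moved \<phi>) Y"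
    and "Y \<subseteq> X"
  shows "(\<phi> \<circ> \<psi>) x = (if \<phi> x \<noteq> x then \<phi> x else \<psi> x)"
    and "\<phi> \<circ> \<psi> \<in> edge_pairings lab M X"
    and "moved (\<phi> \<circ> \<psi>) = moved \<phi> \<union> moved \<psi>"
    and "moved \<phi> \<inter> moved \<psi> = {}"
proof -
  have \<phi>_inv: "\<phi> (\<phi> x) = x" for x
    using \<phi> by (simp add: edge_pairings_def)
  have \<psi>_inv: "\<psi> (\<psi> x) = x" for x
    using \<psi> by (simp add: edge_pairings_def)
  have disj: "\<phi> x = x" if "\<psi> x \<noteq> x" for x
    using that \<psi> by (auto simp: edge_pairings_def)
  have comp: "(\<phi> \<circ> \<psi>) x = (if \<phi> x \<noteq> x then \<phi> x else \<psi> x)" for x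
    using disj[of x] disj[of "\<psi> x"] \<psi>_inv[of x] by (cases "\<psi> x = x") auto
  then show "(\<phi> \<circ> \<psi>) x = (if \<phi> x \<noteq> x then \<phi> x else \<psi> x)" .
  show mv: "moved (\<phi> \<circ> \<psi>) = moved \<phi> \<union> moved \<psi>"
    unfolding comp by auto
  show "moved \<phi> \<inter> moved \<psi> = {}"
    using disj by auto
  have "(\<phi> \<circ> \<psi>) ((\<phi> \<circ> \<psi>) x) = x" for x
  proof (cases "\<phi> x = x")
    case True
    show ?thesis
    proof (cases "\<psi> x = x")
      case False
      then have "\<phi> (\<psi> x) = \<psi> x"
        using disj[of "\<psi> x"] \<psi>_inv[of x] by auto
      with True \<psi>_inv show ?thesis
        by simp
    qed (use True in simp)
  next
    case False
    then have "\<psi> x = x" "\<psi> (\<phi> x) = \<phi> x"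
      using disj[of x] disj[of "\<phi> x"] \<phi>_inv[of x] by auto
    with \<phi>_inv show ?thesis
      by simp
  qed
  moreover have "x \<in> X \<and> x \<notin> M \<and> lab ((\<phi> \<circ> \<psi>) x) = edge_reversal (lab x)"
    if "(\<phi> \<circ> \<psi>) x \<noteq> x" for x
    using that \<phi> \<psi> assms(3) unfolding comp by (auto simp: edge_pairings_def split: if_splits)
  ultimately show "\<phi> \<circ> \<psi> \<in> edge_pairings lab M X"
    by (simp add: edge_pairings_def)
qed

text \<open>Inverse to composing: once the pairs that meet \<open>C\<close> are marked, the
  remaining ones lie off the marks and off \<open>C\<close>, as a second step inside
  \<open>X - C\<close> demands.\<close>

lemma meeting_avoiding:
  assumes \<theta>: "\<theta> \<in> edge_pairings lab M X"
  shows "meeting \<theta> C \<in> edge_pairings lab M X"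
    and "avoiding \<theta> C \<in> edge_pairings lab (M \<union> moved (meeting \<theta> C)) (X - C)"
    and "meeting \<theta> C \<circ> avoiding \<theta> C = \<theta>"
proof -
  have inv: "\<theta> (\<theta> x) = x" for x
    using \<theta> by (simp add: edge_pairings_def)
  show "meeting \<theta> C \<in> edge_pairings lab M X"
    "avoiding \<theta> C \<in> edge_pairings lab (M \<union> moved (meeting \<theta> C)) (X - C)"
    using \<theta> by (auto simp: edge_pairings_def meeting_def avoiding_def inv)
  show "meeting \<theta> C \<circ> avoiding \<theta> C = \<theta>"
    by (auto simp: fun_eq_iff meeting_def avoiding_def inv)
qed

lemma prod_pairing_comp:
  assumes X: "finite X" and \<phi>: "\<phi> \<in> edge_pairings lab M X"
    and \<psi>: "\<psi> \<in> edge_pairings lab (M \<union> moved \<phi>) Y" and Y: "Y \<subseteq> X"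
  shows "(\<Prod>x | \<phi> x \<noteq> x \<and> isl (lab x). g x) * (\<Prod>x | \<psi> x \<noteq> x \<and> isl (lab x). g x) =
    (\<Prod>x | (\<phi> \<circ> \<psi>) x \<noteq> x \<and> isl (lab x). g x)"
proof -
  note comp = edge_pairings_comp[OF \<phi> \<psi> Y]
  have "{x. (\<phi> \<circ> \<psi>) x \<noteq> x \<and> isl (lab x)} =
      {x. \<phi> x \<noteq> x \<and> isl (lab x)} \<union> {x. \<psi> x \<noteq> x \<and> isl (lab x)}"
    using comp(3) by blast
  moreover have "finite {x. \<phi> x \<noteq> x \<and> isl (lab x)}" "finite {x. \<psi> x \<noteq> x \<and> isl (lab x)}"
    using finite_moved[OF X \<phi>] finite_moved[OF finite_subset[OF Y X] \<psi>] by auto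
  ultimately show ?thesis
    using comp(4) by (subst prod.union_disjoint[symmetric]) auto
qed

text \<open>Colour 1 is separated from colours 2 and 3 first. Pairs of \<open>\<phi>\<close> have
  one member in \<open>A\<close> and pairs of \<open>\<psi>\<close> have none, so
  \<open>\<phi>\<close> and \<open>\<psi>\<close> are recovered from the composite and
  \<open>A\<close>.\<close>

lemma iterated_split_coproduct_right:
  fixes \<sigma> :: "'x \<Rightarrow> 'x"
  assumes S: "necklace_structure Q lab vert \<sigma> M X"
  shows "(\<Sum>(\<phi>, A)\<in>splittings lab \<sigma> M X.
      \<Sum>(\<psi>, B)\<in>splittings lab (\<sigma> \<circ> \<phi>) (M \<union> moved \<phi>) (X - A).
        Poly_Mapping.single
          (collection_of lab vert (\<sigma> \<circ> \<phi>) (M \<union> moved \<phi>) A,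
           collection_of lab vert (\<sigma> \<circ> \<phi> \<circ> \<psi>) (M \<union> moved \<phi> \<union> moved \<psi>) B,
           collection_of lab vert (\<sigma> \<circ> \<phi> \<circ> \<psi>) (M \<union> moved \<phi> \<union> moved \<psi>) (X - A - B))
          (pairing_weight lab \<phi> A * pairing_weight lab \<psi> B :: 'k::field_char_0 poly)) =
    triple_coproduct lab vert \<sigma> M X"
    (is "(\<Sum>(\<phi>, A)\<in>?S. \<Sum>(\<psi>, B)\<in>?T \<phi> A. ?t \<phi> A \<psi> B) = _")
proof -
  have fin: "finite X"
    using S by (simp add: necklace_structure_def)
  have "(\<Sum>(\<phi>, A)\<in>?S. \<Sum>(\<psi>, B)\<in>?T \<phi> A. ?t \<phi> A \<psi> B) =
      (\<Sum>a\<in>?S. \<Sum>b\<in>(case a of (\<phi>, A) \<Rightarrow> ?T \<phi> A).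
        ?t (fst a) (snd a) (fst b) (snd b))"
    by (simp add: case_prod_beta)
  also have "\<dots> = (\<Sum>(a, b)\<in>Sigma ?S (\<lambda>(\<phi>, A). ?T \<phi> A). ?t (fst a) (snd a) (fst b) (snd b))"
    by (rule sum.Sigma) (use fin in \<open>auto intro!: finite_splittings\<close>)
  also have "\<dots> = triple_coproduct lab vert \<sigma> M X"
    unfolding triple_coproduct_def
  proof (rule sum_reindex_pairs[where p = "\<lambda>a b. fst a \<circ> fst b" and q = "\<lambda>a b. (snd a, snd b)"
        and p' = "\<lambda>\<theta> c. (meeting \<theta> (fst c), fst c)" and q' = "\<lambda>\<theta> c. (avoiding \<theta> (fst c), snd c)"])
    fix a :: "('x \<Rightarrow> 'x) \<times> 'x set" and b :: "('x \<Rightarrow> 'x) \<times> 'x set"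
    assume ab: "(a, b) \<in> Sigma ?S (\<lambda>(\<phi>, A). ?T \<phi> A)"
    obtain \<phi> A \<psi> B where eq: "a = (\<phi>, A)" "b = (\<psi>, B)"
      by (cases a, cases b)
    define \<theta> where "\<theta> = \<phi> \<circ> \<psi>"
    have \<phi>A: "(\<phi>, A) \<in> ?S" and \<psi>B: "(\<psi>, B) \<in> ?T \<phi> A"
      using ab by (auto simp: eq)
    then have \<phi>: "\<phi> \<in> edge_pairings lab M X" and A: "A \<subseteq> X"
      and A_closed: "\<And>x. x \<in> A \<Longrightarrow> \<sigma> (\<phi> x) \<in> A"
      and \<phi>_swap: "\<And>x. \<phi> x \<noteq> x \<Longrightarrow> \<phi> x \<in> A \<longleftrightarrow> x \<notin> A"
      and \<psi>: "\<psi> \<in> edge_pairings lab (M \<union> moved \<phi>) (X - A)" and B: "B \<subseteq> X - A"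
      and B_closed: "\<And>x. x \<in> B \<Longrightarrow> \<sigma> (\<theta> x) \<in> B"
      and \<psi>_swap: "\<And>x. \<psi> x \<noteq> x \<Longrightarrow> \<psi> x \<in> B \<longleftrightarrow> x \<notin> B"
      by (auto simp: splittings_def \<theta>_def)
    note comp = edge_pairings_comp[OF \<phi> \<psi> Diff_subset, folded \<theta>_def]
    have \<psi>A: "x \<notin> A" "\<psi> x \<notin> A" "\<phi> x = x" if "\<psi> x \<noteq> x" for x
    proof -
      have "\<psi> (\<psi> x) \<noteq> \<psi> x"
        using that \<psi> by (simp add: edge_pairings_def)
      with that \<psi> show "x \<notin> A" "\<psi> x \<notin> A" "\<phi> x = x"
        by (auto simp: edge_pairings_def)
    qed
    have "\<sigma> (\<theta> x) \<in> A" if "x \<in> A" for x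
      using A_closed[OF that] \<psi>A(1)[of x] that
      by (cases "\<psi> x = x") (auto simp: comp(1))
    moreover have "\<not> (x \<in> A \<and> \<theta> x \<in> A) \<and> \<not> (x \<in> B \<and> \<theta> x \<in> B) \<and> (x \<in> A \<union> B \<or> \<theta> x \<in> A \<union> B)"
      if "\<theta> x \<noteq> x" for x
      using that \<phi>_swap[of x] \<psi>_swap[of x] \<psi>A[of x] B unfolding comp(1)
      by (auto split: if_splits)
    ultimately have "(\<theta>, A, B) \<in> triple_splittings lab \<sigma> M X"
      using A B B_closed comp(2) by (auto simp: triple_splittings_def)
    then show "(fst a \<circ> fst b, snd a, snd b) \<in> triple_splittings lab \<sigma> M X"
      by (simp add: eq \<theta>_def)
    have "meeting \<theta> A x = \<phi> x" "avoiding \<theta> A x = \<psi> x" for x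
      using \<phi>_swap[of x] \<psi>A[of x]
      by (cases "\<psi> x = x"; auto simp: meeting_def avoiding_def comp(1))+
    then show "(meeting (fst a \<circ> fst b) (fst (snd a, snd b)), fst (snd a, snd b)) = a"
      "(avoiding (fst a \<circ> fst b) (fst (snd a, snd b)), snd (snd a, snd b)) = b"
      by (simp_all add: eq fun_eq_iff flip: \<theta>_def)
    \<comment> \<open>The second step leaves \<open>A\<close> untouched, so the necklaces of colour
      1 are final after the first.\<close>
    have "collection_of lab vert (\<sigma> \<circ> \<theta>) (M \<union> moved \<theta>) A =
        collection_of lab vert (\<sigma> \<circ> \<phi>) (M \<union> moved \<phi>) A"
    proof (rule collection_of_cong[OF necklace_structure_splitting(1)[OF S \<phi>A]])
      fix x
      assume "x \<in> A"
      then have "\<psi> x = x"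
        using \<psi>A(1) by blast
      then show "(\<sigma> \<circ> \<theta>) x = (\<sigma> \<circ> \<phi>) x" "x \<in> M \<union> moved \<theta> \<longleftrightarrow> x \<in> M \<union> moved \<phi>"
        by (auto simp: comp(1))
    qed
    moreover have "M \<union> moved \<theta> = M \<union> moved \<phi> \<union> moved \<psi>" "\<sigma> \<circ> \<theta> = \<sigma> \<circ> \<phi> \<circ> \<psi>"
      by (simp_all only: comp(3) Un_assoc) (simp add: \<theta>_def comp_assoc)
    \<comment> \<open>A pair of \<open>\<phi>\<close> has exactly one member in \<open>A\<close>, so
      membership in \<open>A\<close> decides the order of its colours; a pair of
      \<open>\<psi>\<close> avoids \<open>A\<close>, and membership in \<open>B\<close>
      decides.\<close>
    moreover have "pairing_weight lab \<phi> A * pairing_weight lab \<psi> B =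
        ((\<Prod>x | \<theta> x \<noteq> x \<and> isl (lab x).
          monom (if x \<in> A \<or> x \<in> B \<and> \<theta> x \<notin> A then 1 / 2 else - 1 / 2) 1) :: 'k poly)"
      unfolding \<theta>_def prod_pairing_comp[OF fin \<phi> \<psi> Diff_subset, symmetric] pairing_weight_def
      unfolding \<theta>_def[symmetric] comp(1) using \<phi>_swap \<psi>A
      by (intro arg_cong2[where f = "(*)"] prod.cong) auto
    ultimately show "(case (snd a, snd b) of (A, B) \<Rightarrow> Poly_Mapping.single
          (collection_of lab vert (\<sigma> \<circ> (fst a \<circ> fst b)) (M \<union> moved (fst a \<circ> fst b)) A,
           collection_of lab vert (\<sigma> \<circ> (fst a \<circ> fst b)) (M \<union> moved (fst a \<circ> fst b)) B,
           collection_of lab vert (\<sigma> \<circ> (fst a \<circ> fst b)) (M \<union> moved (fst a \<circ> fst b)) (X - A - B))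
          ((\<Prod>x | (fst a \<circ> fst b) x \<noteq> x \<and> isl (lab x).
             monom (if x \<in> A \<or> x \<in> B \<and> (fst a \<circ> fst b) x \<notin> A then 1 / 2 else - 1 / 2) 1) ::
             'k poly)) = ?t (fst a) (snd a) (fst b) (snd b)"
      by (simp add: eq flip: \<theta>_def)
  next
    fix \<theta> :: "'x \<Rightarrow> 'x" and c :: "'x set \<times> 'x set"
    assume c: "(\<theta>, c) \<in> triple_splittings lab \<sigma> M X"
    obtain A B where eq: "c = (A, B)"
      by (cases c)
    from c have \<theta>: "\<theta> \<in> edge_pairings lab M X" and AB: "A \<subseteq> X" "B \<subseteq> X - A"
      and closed: "\<And>x. x \<in> A \<Longrightarrow> \<sigma> (\<theta> x) \<in> A" "\<And>x. x \<in> B \<Longrightarrow> \<sigma> (\<theta> x) \<in> B"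
      and swap: "\<And>x. \<theta> x \<noteq> x \<Longrightarrow>
        \<not> (x \<in> A \<and> \<theta> x \<in> A) \<and> \<not> (x \<in> B \<and> \<theta> x \<in> B) \<and> (x \<in> A \<union> B \<or> \<theta> x \<in> A \<union> B)"
      by (auto simp: triple_splittings_def eq)
    note parts = meeting_avoiding[OF \<theta>, of A]
    have "(meeting \<theta> A, A) \<in> ?S"
      using parts(1) AB closed(1) swap by (auto simp: splittings_def meeting_def)
    moreover have "(avoiding \<theta> A, B) \<in> ?T (meeting \<theta> A) A"
    proof -
      have "\<sigma> \<circ> meeting \<theta> A \<circ> avoiding \<theta> A = \<sigma> \<circ> \<theta>"
        by (simp only: comp_assoc parts(3))
      moreover have "avoiding \<theta> A x \<in> B \<longleftrightarrow> x \<notin> B" if "avoiding \<theta> A x \<noteq> x" for x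
        using that swap[of x] by (auto simp: avoiding_def split: if_splits)
      ultimately show ?thesis
        using parts(2) AB closed(2) by (auto simp: splittings_def simp del: comp_apply; simp)
    qed
    ultimately show "((meeting \<theta> (fst c), fst c), avoiding \<theta> (fst c), snd c)
        \<in> Sigma ?S (\<lambda>(\<phi>, A). ?T \<phi> A)"
      by (simp add: eq)
    show "fst (meeting \<theta> (fst c), fst c) \<circ> fst (avoiding \<theta> (fst c), snd c) = \<theta>"
      using parts(3) by (simp add: eq)
    show "(snd (meeting \<theta> (fst c), fst c), snd (avoiding \<theta> (fst c), snd c)) = c"
      by simp
  qed
  finally show ?thesis .
qed

text \<open>Colour 3 is separated first, while colours 1 and 2 share \<open>A'\<close>. Between the
  two steps elements of colours 1 and 2 may still lie on common cycles, so in the first step only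
  \<open>A'\<close> as a whole is closed.\<close>

lemma iterated_split_coproduct_left:
  fixes \<sigma> :: "'x \<Rightarrow> 'x"
  assumes S: "necklace_structure Q lab vert \<sigma> M X"
  shows "(\<Sum>(\<phi>, A')\<in>splittings lab \<sigma> M X.
      \<Sum>(\<psi>, A)\<in>splittings lab (\<sigma> \<circ> \<phi>) (M \<union> moved \<phi>) A'.
        Poly_Mapping.single
          (collection_of lab vert (\<sigma> \<circ> \<phi> \<circ> \<psi>) (M \<union> moved \<phi> \<union> moved \<psi>) A,
           collection_of lab vert (\<sigma> \<circ> \<phi> \<circ> \<psi>) (M \<union> moved \<phi> \<union> moved \<psi>) (A' - A),
           collection_of lab vert (\<sigma> \<circ> \<phi>) (M \<union> moved \<phi>) (X - A'))
          (pairing_weight lab \<phi> A' * pairing_weight lab \<psi> A :: 'k::field_char_0 poly)) =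
    triple_coproduct lab vert \<sigma> M X"
    (is "(\<Sum>(\<phi>, A')\<in>?S. \<Sum>(\<psi>, A)\<in>?T \<phi> A'. ?t \<phi> A' \<psi> A) = _")
proof -
  have fin: "finite X"
    using S by (simp add: necklace_structure_def)
  have "(\<Sum>(\<phi>, A')\<in>?S. \<Sum>(\<psi>, A)\<in>?T \<phi> A'. ?t \<phi> A' \<psi> A) =
      (\<Sum>a\<in>?S. \<Sum>b\<in>(case a of (\<phi>, A') \<Rightarrow> ?T \<phi> A').
        ?t (fst a) (snd a) (fst b) (snd b))"
    by (simp add: case_prod_beta)
  also have "\<dots> = (\<Sum>(a, b)\<in>Sigma ?S (\<lambda>(\<phi>, A'). ?T \<phi> A'). ?t (fst a) (snd a) (fst b) (snd b))"
  proof (rule sum.Sigma)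
    have "finite A'" if "(\<phi>, A') \<in> ?S" for \<phi> A'
      using that fin by (auto simp: splittings_def intro: finite_subset)
    then show "\<forall>a\<in>?S. finite (case a of (\<phi>, A') \<Rightarrow> ?T \<phi> A')"
      by (auto intro!: finite_splittings)
  qed (rule finite_splittings[OF fin])
  also have "\<dots> = triple_coproduct lab vert \<sigma> M X"
    unfolding triple_coproduct_def
  proof (rule sum_reindex_pairs[where p = "\<lambda>a b. fst a \<circ> fst b"
        and q = "\<lambda>a b. (snd b, snd a - snd b)"
        and p' = "\<lambda>\<theta> c. (meeting \<theta> (X - fst c - snd c), fst c \<union> snd c)"
        and q' = "\<lambda>\<theta> c. (avoiding \<theta> (X - fst c - snd c), fst c)"])
    fix a :: "('x \<Rightarrow> 'x) \<times> 'x set" and b :: "('x \<Rightarrow> 'x) \<times> 'x set"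
    assume ab: "(a, b) \<in> Sigma ?S (\<lambda>(\<phi>, A'). ?T \<phi> A')"
    obtain \<phi> A' \<psi> A where eq: "a = (\<phi>, A')" "b = (\<psi>, A)"
      by (cases a, cases b)
    define \<theta> where "\<theta> = \<phi> \<circ> \<psi>"
    have \<phi>A': "(\<phi>, A') \<in> ?S" and \<psi>A: "(\<psi>, A) \<in> ?T \<phi> A'"
      using ab by (auto simp: eq)
    then have \<phi>: "\<phi> \<in> edge_pairings lab M X" and A': "A' \<subseteq> X"
      and A'_closed: "\<And>x. x \<in> A' \<Longrightarrow> \<sigma> (\<phi> x) \<in> A'"
      and \<phi>_swap: "\<And>x. \<phi> x \<noteq> x \<Longrightarrow> \<phi> x \<in> A' \<longleftrightarrow> x \<notin> A'"
      and \<psi>: "\<psi> \<in> edge_pairings lab (M \<union> moved \<phi>) A'" and A: "A \<subseteq> A'"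
      and \<psi>_swap: "\<And>x. \<psi> x \<noteq> x \<Longrightarrow> \<psi> x \<in> A \<longleftrightarrow> x \<notin> A"
      by (auto simp: splittings_def)
    note comp = edge_pairings_comp[OF \<phi> \<psi> A', folded \<theta>_def]
    have \<psi>_moved: "x \<in> A'" "\<psi> x \<in> A'" "\<phi> x = x" if "\<psi> x \<noteq> x" for x
    proof -
      have "\<psi> (\<psi> x) \<noteq> \<psi> x"
        using that \<psi> by (simp add: edge_pairings_def)
      with that \<psi> show "x \<in> A'" "\<psi> x \<in> A'" "\<phi> x = x"
        by (auto simp: edge_pairings_def)
    qed
    \<comment> \<open>An equivalence, because it also makes the rest \<open>A' - A\<close>, the
      elements of colour 2, closed.\<close>
    have A_iff: "\<sigma> (\<theta> x) \<in> A \<longleftrightarrow> x \<in> A" if "x \<in> A'" for x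
      using closed_iff_splitting[OF necklace_structure_splitting(1)[OF S \<phi>A'] \<psi>A that]
      by (simp add: \<theta>_def)
    have "\<sigma> (\<theta> x) \<in> A'" if "x \<in> A'" for x
      using that A'_closed \<psi>_moved[of x] by (cases "\<psi> x = x") (auto simp: \<theta>_def)
    moreover have "\<not> (x \<in> A \<and> \<theta> x \<in> A) \<and> \<not> (x \<in> A' - A \<and> \<theta> x \<in> A' - A) \<and>
        (x \<in> A \<union> (A' - A) \<or> \<theta> x \<in> A \<union> (A' - A))"
      if "\<theta> x \<noteq> x" for x
      using that \<phi>_swap[of x] \<psi>_swap[of x] \<psi>_moved[of x] A unfolding comp(1)
      by (auto split: if_splits)
    ultimately have "(\<theta>, A, A' - A) \<in> triple_splittings lab \<sigma> M X"
      using A A' A_iff comp(2) by (auto simp: triple_splittings_def)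
    then show "(fst a \<circ> fst b, snd b, snd a - snd b) \<in> triple_splittings lab \<sigma> M X"
      by (simp add: eq \<theta>_def)
    have C: "X - A - (A' - A) = X - A'" "A \<union> (A' - A) = A'"
      using A by auto
    have "\<phi> x \<in> X \<longleftrightarrow> x \<in> X" for x
      by (rule permutes_in_image[OF edge_pairings_permutes[OF \<phi>]])
    moreover have "x \<in> X" if "\<phi> x \<noteq> x" for x
      using that \<phi> by (simp add: edge_pairings_def)
    ultimately have "meeting \<theta> (X - A') x = \<phi> x" "avoiding \<theta> (X - A') x = \<psi> x" for x
      using \<phi>_swap[of x] \<psi>_moved[of x] A'
      by (cases "\<psi> x = x"; auto simp: meeting_def avoiding_def comp(1))+
    then show "(meeting (fst a \<circ> fst b) (X - fst (snd b, snd a - snd b) - snd (snd b, snd a - snd b)),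
          fst (snd b, snd a - snd b) \<union> snd (snd b, snd a - snd b)) = a"
      "(avoiding (fst a \<circ> fst b) (X - fst (snd b, snd a - snd b) - snd (snd b, snd a - snd b)),
          fst (snd b, snd a - snd b)) = b"
      by (simp_all add: eq C fun_eq_iff del: Un_Diff_cancel flip: \<theta>_def)
    have "collection_of lab vert (\<sigma> \<circ> \<theta>) (M \<union> moved \<theta>) (X - A') =
        collection_of lab vert (\<sigma> \<circ> \<phi>) (M \<union> moved \<phi>) (X - A')"
    proof (rule collection_of_cong[OF necklace_structure_splitting(2)[OF S \<phi>A']])
      fix x
      assume "x \<in> X - A'"
      then have "\<psi> x = x"
        using \<psi>_moved(1) by blast
      then show "(\<sigma> \<circ> \<theta>) x = (\<sigma> \<circ> \<phi>) x" "x \<in> M \<union> moved \<theta> \<longleftrightarrow> x \<in> M \<union> moved \<phi>"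
        by (auto simp: comp(1))
    qed
    moreover have "M \<union> moved \<theta> = M \<union> moved \<phi> \<union> moved \<psi>" "\<sigma> \<circ> \<theta> = \<sigma> \<circ> \<phi> \<circ> \<psi>"
      by (simp_all only: comp(3) Un_assoc) (simp add: \<theta>_def comp_assoc)
    \<comment> \<open>In a pair of \<open>\<phi>\<close> the member in \<open>A'\<close> has the
      smaller colour, be it 1 or 2. In a pair of \<open>\<psi>\<close> both members lie in
      \<open>A'\<close>, and membership in \<open>A\<close> decides.\<close>
    moreover have "pairing_weight lab \<phi> A' * pairing_weight lab \<psi> A =
        ((\<Prod>x | \<theta> x \<noteq> x \<and> isl (lab x).
          monom (if x \<in> A \<or> x \<in> A' - A \<and> \<theta> x \<notin> A then 1 / 2 else - 1 / 2) 1) :: 'k poly)"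
      unfolding \<theta>_def prod_pairing_comp[OF fin \<phi> \<psi> A', symmetric] pairing_weight_def
      unfolding \<theta>_def[symmetric] comp(1) using \<phi>_swap \<psi>_swap \<psi>_moved A
      by (intro arg_cong2[where f = "(*)"] prod.cong) auto
    ultimately show "(case (snd b, snd a - snd b) of (A, B) \<Rightarrow> Poly_Mapping.single
          (collection_of lab vert (\<sigma> \<circ> (fst a \<circ> fst b)) (M \<union> moved (fst a \<circ> fst b)) A,
           collection_of lab vert (\<sigma> \<circ> (fst a \<circ> fst b)) (M \<union> moved (fst a \<circ> fst b)) B,
           collection_of lab vert (\<sigma> \<circ> (fst a \<circ> fst b)) (M \<union> moved (fst a \<circ> fst b)) (X - A - B))
          ((\<Prod>x | (fst a \<circ> fst b) x \<noteq> x \<and> isl (lab x).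
             monom (if x \<in> A \<or> x \<in> B \<and> (fst a \<circ> fst b) x \<notin> A then 1 / 2 else - 1 / 2) 1) ::
             'k poly)) = ?t (fst a) (snd a) (fst b) (snd b)"
      by (simp add: eq C(1) flip: \<theta>_def)
  next
    fix \<theta> :: "'x \<Rightarrow> 'x" and c :: "'x set \<times> 'x set"
    assume c: "(\<theta>, c) \<in> triple_splittings lab \<sigma> M X"
    obtain A B where eq: "c = (A, B)"
      by (cases c)
    from c have \<theta>: "\<theta> \<in> edge_pairings lab M X" and AB: "A \<subseteq> X" "B \<subseteq> X" "A \<inter> B = {}"
      and closed: "\<And>x. x \<in> A \<Longrightarrow> \<sigma> (\<theta> x) \<in> A" "\<And>x. x \<in> B \<Longrightarrow> \<sigma> (\<theta> x) \<in> B"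
      and swap: "\<And>x. \<theta> x \<noteq> x \<Longrightarrow>
        \<not> (x \<in> A \<and> \<theta> x \<in> A) \<and> \<not> (x \<in> B \<and> \<theta> x \<in> B) \<and> (x \<in> A \<union> B \<or> \<theta> x \<in> A \<union> B)"
      by (auto simp: triple_splittings_def eq)
    define C where "C = X - A - B"
    note parts = meeting_avoiding[OF \<theta>, of C]
    have XC: "X - C = A \<union> B"
      using AB by (auto simp: C_def)
    have \<theta>X: "x \<in> X" "\<theta> x \<in> X" if "\<theta> x \<noteq> x" for x
      using that \<theta> permutes_in_image[OF edge_pairings_permutes[OF \<theta>]]
      by (auto simp: edge_pairings_def)
    have "(meeting \<theta> C, A \<union> B) \<in> ?S"
    proof -
      have "\<sigma> (meeting \<theta> C x) \<in> A \<union> B" if "x \<in> A \<union> B" for x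
      proof (cases "\<theta> x \<in> C")
        case True
        then have "\<theta> x \<notin> A \<union> B"
          by (simp add: C_def)
        have "meeting \<theta> C x = \<theta> x"
          using True by (simp add: meeting_def)
        then show ?thesis
          using that closed by auto
      next
        case False
        then have "meeting \<theta> C x = x"
          using that by (auto simp: meeting_def C_def)
        \<comment> \<open>The pair of \<open>x\<close>, if any, is left to the second step, so the
          first step sends \<open>x\<close> to \<open>\<sigma> x\<close>. This is
          \<open>\<sigma> (\<theta> (\<theta> x))\<close>, which has the colour of
          \<open>\<theta> x\<close> and so possibly not that of \<open>x\<close>.\<close>
        moreover have "\<theta> (\<theta> x) = x"
          using \<theta> by (simp add: edge_pairings_def)
        moreover have "\<theta> x \<in> A \<union> B"
          using False that \<theta>X[of x] by (cases "\<theta> x = x") (auto simp: C_def)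
        ultimately show ?thesis
          using closed(1)[of "\<theta> x"] closed(2)[of "\<theta> x"] by auto
      qed
      moreover have "meeting \<theta> C x \<in> A \<union> B \<longleftrightarrow> x \<notin> A \<union> B" if "meeting \<theta> C x \<noteq> x" for x
        using that swap[of x] \<theta>X[of x] by (auto simp: meeting_def C_def split: if_splits)
      ultimately show ?thesis
        using parts(1) AB by (auto simp: splittings_def)
    qed
    moreover have "(avoiding \<theta> C, A) \<in> ?T (meeting \<theta> C) (A \<union> B)"
    proof -
      have "\<sigma> \<circ> meeting \<theta> C \<circ> avoiding \<theta> C = \<sigma> \<circ> \<theta>"
        by (simp only: comp_assoc parts(3))
      moreover have "avoiding \<theta> C x \<in> A \<longleftrightarrow> x \<notin> A" if "avoiding \<theta> C x \<noteq> x" for x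
        using that swap[of x] \<theta>X[of x] by (auto simp: avoiding_def C_def split: if_splits)
      ultimately show ?thesis
        using parts(2) AB closed(1) unfolding XC by (auto simp: splittings_def simp del: comp_apply; simp)
    qed
    ultimately show "((meeting \<theta> (X - fst c - snd c), fst c \<union> snd c),
        avoiding \<theta> (X - fst c - snd c), fst c) \<in> Sigma ?S (\<lambda>(\<phi>, A). ?T \<phi> A)"
      by (simp add: eq C_def)
    show "fst (meeting \<theta> (X - fst c - snd c), fst c \<union> snd c) \<circ>
        fst (avoiding \<theta> (X - fst c - snd c), fst c) = \<theta>"
      using parts(3) by (simp add: eq C_def)
    show "(snd (avoiding \<theta> (X - fst c - snd c), fst c),
        snd (meeting \<theta> (X - fst c - snd c), fst c \<union> snd c) -
        snd (avoiding \<theta> (X - fst c - snd c), fst c)) = c"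
      using AB by (auto simp: eq)
  qed
  finally show ?thesis .
qed

section \<open>Marked structures from presentations\<close>

text \<open>
  A trivial path in a presentation is treated as a further word with one letter, whose only abstract
  edge is marked from the start, so that the letter is never read.
\<close>

definition padded_words :: "'a list list \<Rightarrow> 'v list \<Rightarrow> 'a list list" where
  "padded_words ws vs = ws @ replicate (length vs) [undefined]"

definition padding :: "'a list list \<Rightarrow> (nat \<times> nat) set" where
  "padding ws = {x. length ws \<le> fst x}"

definition start_vertex ::
    "('v, 'e) pre_digraph \<Rightarrow> ('e + 'e) list list \<Rightarrow> 'v list \<Rightarrow> nat \<times> nat \<Rightarrow> 'v" where
  "start_vertex Q ws vs x =
     (if x \<in> padding ws then vs ! (fst x - length ws)
      else tail (double_quiver Q) (edge_of ws x))"

abbreviation presented_structure ::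
    "('v, 'e) pre_digraph \<Rightarrow> ('e + 'e) list list \<Rightarrow> 'v list \<Rightarrow> bool" where
  "presented_structure Q ws vs \<equiv>
     necklace_structure Q (edge_of (padded_words ws vs)) (start_vertex Q ws vs)
       (next_edge (padded_words ws vs)) (padding ws) (abstract_edges (padded_words ws vs))"

lemma finite_abstract_edges: "finite (abstract_edges ws)"
  by (simp add: abstract_edges_def)

lemma next_edge_image: "next_edge ws ` abstract_edges ws = abstract_edges ws"
proof -
  have row: "next_edge ws ` ({i} \<times> {..<length (ws ! i)}) = {i} \<times> {..<length (ws ! i)}" for i
  proof (cases "ws ! i = []")
    case False
    define xs where "xs = map (Pair i) [0..<length (ws ! i)]"
    have "map (next_edge ws) xs = rotate1 xs"
      using False by (intro nth_equalityI) (auto simp: xs_def next_edge_def nth_rotate1)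
    moreover have "set xs = {i} \<times> {..<length (ws ! i)}"
      by (auto simp: xs_def)
    ultimately show ?thesis
      by (metis list.set_map set_rotate1)
  qed simp
  have "abstract_edges ws = (\<Union>i<length ws. {i} \<times> {..<length (ws ! i)})"
    by (auto simp: abstract_edges_def)
  then show ?thesis
    by (simp add: image_UN row)
qed

lemma abstract_edges_padded_iff:
  "(i, j) \<in> abstract_edges (padded_words ws vs) \<longleftrightarrow>
     (if i < length ws then j < length (ws ! i) else i < length ws + length vs \<and> j = 0)"
  by (auto simp: abstract_edges_def padded_words_def nth_append)

lemma abstract_edges_unpadded:
  "abstract_edges ws = abstract_edges (padded_words ws vs) - padding ws"
  by (auto simp: abstract_edges_padded_iff padding_def) (auto simp: abstract_edges_def)

lemma padded_words_agree:
  assumes "x \<notin> padding ws"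
  shows "edge_of (padded_words ws vs) x = edge_of ws x"
    and "next_edge (padded_words ws vs) x = next_edge ws x"
  using assms
  by (auto simp: padding_def edge_of_def next_edge_def padded_words_def nth_append split: prod.splits)

lemma awalk_heads_tails:
  assumes "wf_digraph Q" "pre_digraph.awalk (double_quiver Q) u w v" "w \<noteq> []"
  shows "set w \<subseteq> arcs (double_quiver Q)"
    and "map (head (double_quiver Q)) w = tl (map (tail (double_quiver Q)) w) @ [v]"
    and "tail (double_quiver Q) (hd w) = u"
proof -
  interpret wf_digraph "double_quiver Q"
    using assms(1) by (auto simp: wf_digraph_def double_quiver_def)
  have "set w \<subseteq> arcs (double_quiver Q) \<and>
    map (head (double_quiver Q)) w = tl (map (tail (double_quiver Q)) w) @ [v] \<and>
    tail (double_quiver Q) (hd w) = u"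
    using assms(2,3)
  proof (induction w arbitrary: u)
    case (Cons e w)
    then show ?case
      by (cases w) (auto simp: awalk_Cons_iff awalk_Nil_iff)
  qed simp
  then show "set w \<subseteq> arcs (double_quiver Q)"
    "map (head (double_quiver Q)) w = tl (map (tail (double_quiver Q)) w) @ [v]"
    "tail (double_quiver Q) (hd w) = u"
    by blast+
qed

text \<open>Stated as an equality up to \<open>rotate1\<close>, the incidence condition is preserved
  by every rotation; so it passes from the representative known to be a closed walk to the given
  word.\<close>

lemma Cyclic_in_necklacesD:
  assumes Q: "wf_digraph Q" and "Cyclic (cyclic_word w) \<in> necklaces Q"
  shows "set w \<subseteq> arcs (double_quiver Q)"
    and "map (head (double_quiver Q)) w = rotate1 (map (tail (double_quiver Q)) w)"
proof -
  obtain w' where w': "cyclic_path Q w'" "cyclic_word w' = cyclic_word w"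
    using assms(2) by (auto simp: necklaces_def)
  then obtain n u where w: "w = rotate n w'" and "w' \<noteq> []"
    and u: "pre_digraph.awalk (double_quiver Q) u w' u"
    by (auto simp: cyclic_word_eq_iff cyclic_path_def)
  note walk = awalk_heads_tails[OF Q u \<open>w' \<noteq> []\<close>]
  have "map (head (double_quiver Q)) w' = rotate1 (map (tail (double_quiver Q)) w')"
    using walk(2,3) \<open>w' \<noteq> []\<close> by (cases w') auto
  then show "map (head (double_quiver Q)) w = rotate1 (map (tail (double_quiver Q)) w)"
    unfolding w rotate_map[symmetric] by (simp add: rotate1_rotate_swap)
  show "set w \<subseteq> arcs (double_quiver Q)"
    using walk(1) by (simp add: w)
qed

lemma presented_structure:
  assumes Q: "wf_digraph Q" and P: "P \<in> collections Q" and pres: "presents ws vs P"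
  shows "presented_structure Q ws vs"
proof -
  let ?W = "padded_words ws vs" and ?D = "double_quiver Q"
  have D: "wf_digraph ?D"
    using Q by (auto simp: wf_digraph_def double_quiver_def)
  have words: "Cyclic (cyclic_word w) \<in> necklaces Q" if "w \<in> set ws" for w
    using that P pres by (auto simp: collections_def presents_def)
  have vs: "v \<in> verts Q" if "v \<in> set vs" for v
    using that P pres by (auto simp: collections_def presents_def necklaces_def)
  have "bij_betw (next_edge ?W) (abstract_edges ?W) (abstract_edges ?W)"
    by (simp add: bij_betw_def eq_card_imp_inj_on finite_abstract_edges next_edge_image)
  moreover have "start_vertex Q ws vs x \<in> verts Q" if "x \<in> abstract_edges ?W" for x
  proof (cases x)
    case (Pair i j)
    show ?thesis
    proof (cases "i < length ws")
      case True
      then have "ws ! i ! j \<in> arcs ?D"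
        using that words Cyclic_in_necklacesD(1)[OF Q words[of "ws ! i"]]
        by (auto simp: Pair abstract_edges_padded_iff subset_iff)
      then have "tail ?D (ws ! i ! j) \<in> verts ?D"
        by (rule wf_digraph.tail_in_verts[OF D])
      then show ?thesis
        using True by (simp add: Pair start_vertex_def padding_def edge_of_def double_quiver_def)
    next
      case False
      then show ?thesis
        using that vs
        by (auto simp: Pair abstract_edges_padded_iff start_vertex_def padding_def)
    qed
  qed
  moreover have "start_vertex Q ws vs (next_edge ?W x) = start_vertex Q ws vs x"
    if "x \<in> padding ws" for x
    using that by (auto simp: start_vertex_def next_edge_def padding_def split: prod.split)
  moreover have "edge_of ?W x \<in> arcs ?D \<and> tail ?D (edge_of ?W x) = start_vertex Q ws vs x \<and>
      head ?D (edge_of ?W x) = start_vertex Q ws vs (next_edge ?W x)"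
    if "x \<in> abstract_edges ?W - padding ws" for x
  proof (cases x)
    case (Pair i j)
    have i: "i < length ws" "j < length (ws ! i)"
      using that by (auto simp: Pair padding_def abstract_edges_padded_iff)
    note w = Cyclic_in_necklacesD[OF Q words[OF nth_mem[OF i(1)]]]
    have "map (head ?D) (ws ! i) ! j = rotate1 (map (tail ?D) (ws ! i)) ! j"
      using w(2) by simp
    then have "head ?D (ws ! i ! j) = tail ?D (ws ! i ! (Suc j mod length (ws ! i)))"
      using i(2) mod_less_divisor[of "length (ws ! i)" "Suc j", OF le_less_trans[OF le0 i(2)]]
      by (simp add: nth_rotate1)
    then show ?thesis
      using i w(1) by (auto simp: Pair padding_def start_vertex_def edge_of_def next_edge_def
          padded_words_def nth_append subset_iff)
  qed
  ultimately show ?thesis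
    by (auto simp: necklace_structure_def finite_abstract_edges)
qed

text \<open>Guarantees that the choice made in \<open>moyal_coproduct_collection\<close> is a
  genuine presentation.\<close>

lemma presents_exists:
  assumes "P \<in> collections Q"
  shows "\<exists>ws vs. presents ws vs P"
  using assms
proof (induction P)
  case empty
  have "presents [] [] {#}"
    by (simp add: presents_def)
  then show ?case
    by blast
next
  case (add N P)
  then obtain ws vs where pres: "presents ws vs P"
    by (auto simp: collections_def)
  have "N \<in> necklaces Q"
    using add.prems by (simp add: collections_def)
  then consider v where "N = Trivial v" | w where "N = Cyclic (cyclic_word w)" "w \<noteq> []"
    by (auto simp: necklaces_def cyclic_path_def)
  then show ?case
  proof cases
    case 1
    then have "presents ws (v # vs) (add_mset N P)"
      using pres by (simp add: presents_def)
    then show ?thesis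
      by blast
  next
    case 2
    then have "presents (w # ws) vs (add_mset N P)"
      using pres by (simp add: presents_def)
    then show ?thesis
      by blast
  qed
qed

text \<open>Equal multisets give a bijection between the members of the presentation and the orbits.
  Each traversal is rotated until its labels spell the chosen word itself, and the resulting
  enumerations fit together to an isomorphism \<open>b\<close> onto \<open>X\<close>. As marks are
  fixed, a trivial path is a one-point orbit, of the same size as its padding word.\<close>

lemma split_coproduct_eq_presented:
  assumes S: "necklace_structure Q lab vert \<sigma> M X"
    and fixed: "\<And>x. x \<in> X \<inter> M \<Longrightarrow> \<sigma> x = x"
    and pres: "presents ws vs (collection_of lab vert \<sigma> M X)"
    and S': "presented_structure Q ws vs"
  shows "split_coproduct lab vert \<sigma> M X =
    (split_coproduct (edge_of (padded_words ws vs)) (start_vertex Q ws vs)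
      (next_edge (padded_words ws vs)) (padding ws) (abstract_edges (padded_words ws vs)) ::
      _ \<Rightarrow>\<^sub>0 'k::field_char_0 poly)"
proof -
  let ?W = "padded_words ws vs" and ?n = "length ws + length vs"
  have fin: "finite X" and bij: "bij_betw \<sigma> X X"
    using S by (auto simp: necklace_structure_def)
  define nk where "nk K = necklace_at lab vert \<sigma> M (SOME x. x \<in> K)" for K
  define L where "L = map (\<lambda>w. Cyclic (cyclic_word w)) ws @ map Trivial vs"
  obtain Ks where Ks: "set Ks = orbit \<sigma> ` X" "distinct Ks"
    using finite_distinct_list[of "orbit \<sigma> ` X"] fin by auto
  have "mset L = mset (map nk Ks)"
    using pres Ks mset_set_set[OF Ks(2)]
    by (simp add: presents_def L_def collection_of_def nk_def[abs_def])
  \<comment> \<open>Repeated necklaces make \<open>f\<close> non-unique; any choice will do.\<close>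
  then obtain f where f: "bij_betw f {..<length L} {..<length (map nk Ks)}"
    and f_eq: "\<And>i. i < length L \<Longrightarrow> L ! i = map nk Ks ! f i"
    using permutation_Ex_bij by blast
  have lenL: "length L = ?n"
    by (simp add: L_def)
  have f_lt: "f i < length Ks" if "i < ?n" for i
    using f that by (auto simp: bij_betw_def lenL)
  define K where "K i = Ks ! f i" for i
  have K_inj: "i = i'" if "i < ?n" "i' < ?n" "K i = K i'" for i i'
  proof -
    have "f i = f i'"
      using that f_lt Ks(2) by (simp add: K_def nth_eq_iff_index_eq)
    then show ?thesis
      using f that by (auto simp: bij_betw_def lenL inj_on_def)
  qed
  have K_range: "K ` {..<?n} = orbit \<sigma> ` X"
  proof -
    have "K ` {..<?n} = (!) Ks ` f ` {..<?n}"
      by (auto simp: K_def)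
    also have "f ` {..<?n} = {..<length Ks}"
      using f by (simp add: bij_betw_def lenL)
    also have "(!) Ks ` {..<length Ks} = set Ks"
      by (auto simp: set_conv_nth)
    finally show ?thesis
      using Ks(1) by simp
  qed
  have K_orbit: "\<exists>x\<in>X. K i = orbit \<sigma> x" if "i < ?n" for i
  proof -
    have "K i \<in> K ` {..<?n}"
      using that by simp
    then show ?thesis
      unfolding K_range by blast
  qed
  have orbit_K: "\<exists>i<?n. K i = orbit \<sigma> x" if "x \<in> X" for x
  proof -
    have "orbit \<sigma> x \<in> K ` {..<?n}"
      unfolding K_range using that by simp
    then show ?thesis
      by auto
  qed
  \<comment> \<open>\<open>map lab ys = ws ! i\<close> is an equality of lists and not only of
    cyclic words: the base point in the orbit is chosen to suit the word.\<close>
  define good where "good i ys \<longleftrightarrow>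
    cycle_list \<sigma> ys \<and> set ys = K i \<and> length ys = length (?W ! i) \<and>
      (i < length ws \<longrightarrow> set ys \<inter> M = {} \<and> map lab ys = ws ! i) \<and>
      (\<not> i < length ws \<longrightarrow> set ys \<subseteq> M \<and> vert (hd ys) = vs ! (i - length ws))" for i ys
  have good_ex: "\<exists>ys. good i ys" if i: "i < ?n" for i
  proof -
    obtain x where x: "x \<in> X" "K i = orbit \<sigma> x"
      using K_orbit[OF i] by blast
    note trav = cycle_list_traversal[OF fin bij x(1)]
    have neck: "necklace_at lab vert \<sigma> M x = L ! i"
      using f_eq[of i] i f_lt[OF i] necklace_at_some_orbit[OF S x(1)] x(2)
      by (simp add: lenL K_def nk_def)
    show ?thesis
    proof (cases "i < length ws")
      case True
      then have neck': "necklace_at lab vert \<sigma> M x = Cyclic (cyclic_word (ws ! i))"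
        by (simp add: neck L_def nth_append)
      then have "\<not> orbit \<sigma> x \<subseteq> M"
        by (auto simp: necklace_at_def)
      \<comment> \<open>A marked point is fixed, hence an orbit of its own, and cannot lie on a
        cycle that has letters.\<close>
      have no_marks: "orbit \<sigma> x \<inter> M = {}"
      proof (rule ccontr)
        assume "orbit \<sigma> x \<inter> M \<noteq> {}"
        then obtain z where z: "z \<in> orbit \<sigma> x" "z \<in> M"
          by blast
        then have "z \<in> X"
          using orbit_subset_structure[OF S x(1)] by blast
        then have "orbit \<sigma> z = {z}"
          using fixed z(2) by (simp add: orbit_eq_singleton_iff)
        then show False
          using orbit_eq[OF S x(1) z(1)] z(2) \<open>\<not> orbit \<sigma> x \<subseteq> M\<close> by auto
      qed
      have "filter (\<lambda>y. y \<notin> M) (traversal \<sigma> x) = traversal \<sigma> x"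
        using no_marks trav(2) by (auto simp: filter_id_conv)
      then have "cyclic_word (map lab (traversal \<sigma> x)) = cyclic_word (ws ! i)"
        using neck' \<open>\<not> orbit \<sigma> x \<subseteq> M\<close> by (simp add: necklace_at_def)
      then obtain m where m: "ws ! i = map lab (rotate m (traversal \<sigma> x))"
        by (auto simp: cyclic_word_eq_iff rotate_map)
      have "length (?W ! i) = length (ws ! i)"
        using True by (simp add: padded_words_def nth_append)
      then show ?thesis
        using True m no_marks trav x(2)
        by (intro exI[of _ "rotate m (traversal \<sigma> x)"]) (simp add: good_def cycle_list_rotate)
    next
      case False
      then have neck': "necklace_at lab vert \<sigma> M x = Trivial (vs ! (i - length ws))"
        using i by (simp add: neck L_def nth_append)
      then have sub: "orbit \<sigma> x \<subseteq> M" and "vert x = vs ! (i - length ws)"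
        by (auto simp: necklace_at_def split: if_splits)
      moreover have "\<sigma> x = x"
        using sub self_in_orbit[OF S x(1)] x(1) fixed by blast
      moreover from this have "orbit \<sigma> x = {x}"
        by (simp add: orbit_eq_singleton_iff)
      moreover have "length (?W ! i) = 1"
        using False i by (simp add: padded_words_def nth_append)
      ultimately show ?thesis
        using False x(2) by (intro exI[of _ "[x]"]) (simp add: good_def cycle_list_def)
    qed
  qed
  define Y where "Y i = (SOME ys. good i ys)" for i
  have good: "good i (Y i)" if "i < ?n" for i
    unfolding Y_def by (rule someI_ex) (rule good_ex[OF that])
  note Y = good[unfolded good_def, THEN conjunct1]
    good[unfolded good_def, THEN conjunct2, THEN conjunct1]
    good[unfolded good_def, THEN conjunct2, THEN conjunct2, THEN conjunct1]
    good[unfolded good_def, THEN conjunct2, THEN conjunct2, THEN conjunct2, THEN conjunct1, rule_format]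
    good[unfolded good_def, THEN conjunct2, THEN conjunct2, THEN conjunct2, THEN conjunct2, rule_format]
  define b where "b = (\<lambda>(i, j). Y i ! j)"
  have edges: "i < ?n \<and> j < length (Y i)" if "(i, j) \<in> abstract_edges ?W" for i j
    using that Y(3)[of i] by (auto simp: abstract_edges_def padded_words_def)
  have KX: "K i \<subseteq> X" if "i < ?n" for i
    using K_orbit[OF that] orbit_subset_structure[OF S] by auto
  have image: "b ` abstract_edges ?W = X"
  proof (intro set_eqI iffI)
    fix x
    assume "x \<in> b ` abstract_edges ?W"
    then obtain i j where "x = Y i ! j" "(i, j) \<in> abstract_edges ?W"
      by (auto simp: b_def)
    then show "x \<in> X"
      using edges[of i j] Y(2)[of i] KX[of i] nth_mem[of j "Y i"] by auto
  next
    fix x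
    assume x: "x \<in> X"
    then obtain i where i: "i < ?n" "K i = orbit \<sigma> x"
      using orbit_K[OF x] by blast
    then have "x \<in> set (Y i)"
      using self_in_orbit[OF S x] Y(2) by simp
    then obtain j where "j < length (Y i)" "x = Y i ! j"
      by (auto simp: in_set_conv_nth)
    moreover from this have "(i, j) \<in> abstract_edges ?W"
      using i Y(3) by (auto simp: abstract_edges_def padded_words_def)
    ultimately show "x \<in> b ` abstract_edges ?W"
      by (force simp: b_def)
  qed
  have inj: "inj_on b (abstract_edges ?W)"
  proof (rule inj_onI, clarify)
    fix i j i' j'
    assume ij: "(i, j) \<in> abstract_edges ?W" "(i', j') \<in> abstract_edges ?W" "b (i, j) = b (i', j')"
    have lt: "i < ?n" "j < length (Y i)" "i' < ?n" "j' < length (Y i')"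
      using edges ij by blast+
    have mem: "Y i ! j \<in> K i" "Y i ! j \<in> K i'"
      using ij(3) Y(2)[OF lt(1)] Y(2)[OF lt(3)] nth_mem[OF lt(2)] nth_mem[OF lt(4)]
      by (simp_all add: b_def)
    obtain x x' where "x \<in> X" "K i = orbit \<sigma> x" "x' \<in> X" "K i' = orbit \<sigma> x'"
      using K_orbit[OF lt(1)] K_orbit[OF lt(3)] by blast
    then have "K i = K i'"
      using mem orbit_eq[OF S] by metis
    then have "i = i'"
      using K_inj lt by blast
    moreover have "distinct (Y i)"
      using Y(1) lt by (simp add: cycle_list_def)
    ultimately show "i = i' \<and> j = j'"
      using ij(3) lt by (simp add: b_def nth_eq_iff_index_eq)
  qed
  have step: "\<sigma> (b x) = b (next_edge ?W x)" if "x \<in> abstract_edges ?W" for x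
  proof (cases x)
    case (Pair i j)
    have lt: "i < ?n" "j < length (Y i)"
      using edges that by (auto simp: Pair)
    have "map \<sigma> (Y i) ! j = rotate1 (Y i) ! j"
      using Y(1)[OF lt(1)] by (simp add: cycle_list_def)
    then show ?thesis
      using lt Y(3)[OF lt(1)] by (simp add: Pair b_def next_edge_def nth_rotate1)
  qed
  have marks: "b x \<in> M \<longleftrightarrow> x \<in> padding ws"
    and labels: "x \<notin> padding ws \<Longrightarrow> lab (b x) = edge_of ?W x"
    and verts: "vert (b x) = start_vertex Q ws vs x" if x: "x \<in> abstract_edges ?W" for x
  proof -
    obtain i j where ij: "x = (i, j)"
      by (cases x)
    have lt: "i < ?n" "j < length (Y i)"
      using edges x by (auto simp: ij)
    then have mem: "b x \<in> set (Y i)"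
      by (simp add: ij b_def)
    show mark: "b x \<in> M \<longleftrightarrow> x \<in> padding ws"
      using mem Y(4,5)[OF lt(1)] by (cases "i < length ws") (auto simp: ij padding_def)
    show label: "lab (b x) = edge_of ?W x" if "x \<notin> padding ws"
    proof -
      have "i < length ws"
        using that by (simp add: ij padding_def)
      then have "map lab (Y i) ! j = ws ! i ! j"
        using Y(4)[OF lt(1)] by simp
      then show ?thesis
        using lt \<open>i < length ws\<close> by (simp add: ij b_def edge_of_def padded_words_def nth_append)
    qed
    show "vert (b x) = start_vertex Q ws vs x"
    proof (cases "x \<in> padding ws")
      case True
      then have i: "\<not> i < length ws"
        by (simp add: ij padding_def)
      then have "j = 0"
        using x by (simp add: ij abstract_edges_padded_iff)
      moreover have "Y i \<noteq> []"
        using lt by auto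
      ultimately have "b x = hd (Y i)"
        by (simp add: ij b_def hd_conv_nth)
      then show ?thesis
        using Y(5)[OF lt(1) i] True by (simp add: ij start_vertex_def)
    next
      case False
      have "b x \<in> X"
        using image x by blast
      then have "vert (b x) = tail (double_quiver Q) (lab (b x))"
        using S False mark by (auto simp: necklace_structure_def)
      then show ?thesis
        using False by (simp add: label start_vertex_def padded_words_agree)
    qed
  qed
  have "split_coproduct lab vert \<sigma> M (b ` abstract_edges ?W) =
    (split_coproduct (edge_of ?W) (start_vertex Q ws vs) (next_edge ?W) (padding ws)
      (abstract_edges ?W) :: _ \<Rightarrow>\<^sub>0 'k poly)"
    by (rule split_coproduct_image[OF S' inj]) (simp_all add: step marks labels verts)
  then show ?thesis
    by (simp add: image)
qed

section \<open>The sum over pairings and colourings rewritten over splittings\<close>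

lemma coloured_eq:
  fixes R :: "('v, 'e) necklace"
  shows "(coloured R i :: _ \<Rightarrow>\<^sub>0 'k::field_char_0 poly) = Poly_Mapping.single (if i = 1 then ({#R#}, {#}) else ({#}, {#R#})) 1"
proof -
  have one: "(1 :: ('v, 'e) collection \<Rightarrow>\<^sub>0 'k poly) = Poly_Mapping.single {#} 1"
    by (simp flip: single_one)
  show ?thesis
    unfolding coloured_def one tensor_single_single by simp
qed

lemma prod_coloured:
  assumes "finite I"
  shows "(\<Prod>r\<in>I. coloured (m r) (c r)) =
    Poly_Mapping.single (image_mset m (mset_set {r \<in> I. c r = 1}),
      image_mset m (mset_set {r \<in> I. c r \<noteq> 1})) 1"
  using assms
proof induction
  case empty
  show ?case
    by (simp flip: single_one add: zero_prod_def)
next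
  case (insert x I)
  show ?case
  proof (cases "c x = 1")
    case True
    then have "{r \<in> insert x I. c r = 1} = insert x {r \<in> I. c r = 1}"
      "{r \<in> insert x I. c r \<noteq> 1} = {r \<in> I. c r \<noteq> 1}"
      by auto
    with True insert show ?thesis
      by (simp add: coloured_eq mult_single)
  next
    case False
    then have "{r \<in> insert x I. c r = 1} = {r \<in> I. c r = 1}"
      "{r \<in> insert x I. c r \<noteq> 1} = insert x {r \<in> I. c r \<noteq> 1}"
      by auto
    with False insert show ?thesis
      by (simp add: coloured_eq mult_single)
  qed
qed

text \<open>Distributes the power of h/2 over the pairs, each with its own sign, as in
  \<open>pairing_weight\<close>.\<close>

lemma monom_times_sign:
  assumes "finite B"
  shows "monom (1 / 2 ^ card B) (card B) * of_int (\<Prod>x\<in>B. if p x then 1 else - 1) =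
    (\<Prod>x\<in>B. monom (if p x then 1 / 2 else - 1 / 2) 1 :: 'k::field_char_0 poly)"
  using assms
proof induction
  case (insert x B)
  have "monom (1 / 2 ^ card (insert x B)) (card (insert x B)) =
      monom (1 / 2) 1 * (monom (1 / 2 ^ card B) (card B) :: 'k poly)"
    using insert.hyps by (simp add: mult_monom)
  moreover have "monom (if p x then 1 / 2 else - 1 / 2) 1 =
      monom (1 / 2) 1 * (of_int (if p x then 1 else - 1) :: 'k poly)"
    by (simp flip: minus_monom)
  ultimately show ?case
    using insert by (simp add: algebra_simps del: One_nat_def flip: insert.IH)
qed (simp add: one_pCons monom_0)

text \<open>Hence no edge is paired with itself, and each pair has exactly one member in the quiver
  itself.\<close>

lemma edge_reversal_isl [simp]: "isl (edge_reversal e) \<longleftrightarrow> \<not> isl e"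
  by (cases e) (auto simp: edge_reversal_def)

text \<open>For a fixed pairing, a colouring of nonzero sign is determined by the set of elements
  whose member has colour 1. The sets that arise are the unions of orbits containing exactly one
  element of each pair, together with any padding elements of colour 1.\<close>

lemma pairing_term_eq:
  fixes Q :: "('v, 'e) pre_digraph" and ws :: "('e + 'e) list list" and vs :: "'v list"
    and \<phi> :: "nat \<times> nat \<Rightarrow> nat \<times> nat"
  assumes S: "presented_structure Q ws vs" and J\<phi>: "(J, \<phi>) \<in> pairings ws"
  defines "W \<equiv> padded_words ws vs"
  defines "\<phi>' \<equiv> \<lambda>x. if x \<in> J then \<phi> x else x"
  shows "\<phi>' \<in> edge_pairings (edge_of W) (padding ws) (abstract_edges W)"
    and "scale (monom (1 / 2 ^ (card J div 2)) (card J div 2)) (pairing_term Q ws vs J \<phi>) =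
      (\<Sum>A | (\<phi>', A) \<in> splittings (edge_of W) (next_edge W) (padding ws) (abstract_edges W).
        Poly_Mapping.single
          (collection_of (edge_of W) (start_vertex Q ws vs) (next_edge W \<circ> \<phi>')
             (padding ws \<union> moved \<phi>') A,
           collection_of (edge_of W) (start_vertex Q ws vs) (next_edge W \<circ> \<phi>')
             (padding ws \<union> moved \<phi>') (abstract_edges W - A))
          (pairing_weight (edge_of W) \<phi>' A :: 'k::field_char_0 poly))"
proof -
  define X where "X = abstract_edges W"
  define M where "M = padding ws"
  define lab where "lab = edge_of W"
  define vert where "vert = start_vertex Q ws vs"
  define f where "f = next_edge W \<circ> \<phi>'"
  have S: "necklace_structure Q lab vert (next_edge W) M X"
    using S by (simp add: lab_def vert_def M_def X_def W_def)
  have J: "J \<subseteq> abstract_edges ws" and \<phi>_inv: "\<And>x. x \<in> J \<Longrightarrow> \<phi> (\<phi> x) = x"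
    and \<phi>J: "\<And>x. x \<in> J \<Longrightarrow> \<phi> x \<in> J"
    and \<phi>_lab: "\<And>x. x \<in> J \<Longrightarrow> edge_of ws (\<phi> x) = edge_reversal (edge_of ws x)"
    using J\<phi> by (auto simp: pairings_def PiE_def Pi_def)
  have unpadded: "abstract_edges ws = X - M"
    by (simp add: X_def M_def W_def abstract_edges_unpadded[of ws vs])
  have JX: "x \<in> X" "x \<notin> M" if "x \<in> J" for x
    using that J unpadded by auto
  have lab: "lab x = edge_of ws x" "next_edge W x = next_edge ws x" if "x \<notin> M" for x
    using that padded_words_agree[of x ws vs] by (simp_all add: lab_def M_def W_def)
  have \<phi>_lab': "lab (\<phi> x) = edge_reversal (lab x)" if "x \<in> J" for x
    using that \<phi>_lab[OF that] JX[OF that] JX[OF \<phi>J[OF that]] by (simp add: lab)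
  have moved_J: "\<phi> x \<noteq> x" if "x \<in> J" for x
    using \<phi>_lab'[OF that] edge_reversal_isl[of "lab x"] by metis
  have moved: "moved \<phi>' = J"
    using moved_J by (auto simp: \<phi>'_def)
  show pairing: "\<phi>' \<in> edge_pairings (edge_of W) (padding ws) (abstract_edges W)"
    unfolding X_def[symmetric] M_def[symmetric] lab_def[symmetric]
    using JX \<phi>_lab' \<phi>_inv \<phi>J by (auto simp: edge_pairings_def \<phi>'_def)
  have Sf: "necklace_structure Q lab vert f (M \<union> J) X"
    using necklace_structure_edge_pairing[OF S, of \<phi>'] pairing
    by (simp add: moved f_def X_def M_def lab_def)

  define m where "m = member Q ws vs J \<phi>"
  \<comment> \<open>\<open>h\<close> names the member to which an element contributes:
    \<open>Inr s\<close> for the padding element of the trivial path at position \<open>s\<close>,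
    and the orbit for any other element.\<close>
  define h where "h x = (if x \<in> M then Inr (fst x - length ws) else
      member_of_edge ws J \<phi> x)" for x
  define I where "I = member_indices ws vs J \<phi>"
  have f_succ: "f x = successor ws J \<phi> x" if "x \<notin> M" for x
    using that \<phi>J JX by (auto simp: f_def \<phi>'_def successor_def lab(2))
  have f_pad: "f x = x" if "x \<in> X" "x \<in> M" for x
  proof (cases x)
    case (Pair i j)
    have "\<phi>' x = x"
      using that JX(2)[of x] by (auto simp: \<phi>'_def)
    moreover have "\<not> i < length ws" "i < length ws + length vs" "j = 0"
      using that by (auto simp: Pair X_def M_def W_def abstract_edges_padded_iff padding_def)
    ultimately show ?thesis
      by (simp add: f_def Pair W_def next_edge_def padded_words_def nth_append)
  qed
  have f_unpadded: "f x \<in> X - M" if "x \<in> X - M" for x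
  proof -
    have "\<phi>' x \<in> abstract_edges ws"
      using that \<phi>J JX by (auto simp: unpadded \<phi>'_def)
    then have "next_edge ws (\<phi>' x) \<in> abstract_edges ws"
      using next_edge_image[of ws] by blast
    moreover have "\<phi>' x \<notin> M"
      using that \<phi>J JX by (auto simp: \<phi>'_def)
    ultimately show ?thesis
      using lab(2)[of "\<phi>' x"] by (simp add: unpadded f_def)
  qed
  have orbit_succ: "orbit f x = orbit (successor ws J \<phi>) x" if "x \<in> X - M" for x
    using that f_unpadded f_succ by (intro orbit_cong0[of x "X - M"]) auto
  have orbit_unpadded: "orbit f x \<subseteq> X - M" if "x \<in> X - M" for x
    using f_unpadded by (intro orbit_subset_closed[OF _ that]) auto
  have orbit_pad: "orbit f x = {x}" if "x \<in> X" "x \<in> M" for x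
    using f_pad[OF that] by (simp add: orbit_eq_singleton_iff)
  have h_iff: "h x = h y \<longleftrightarrow> orbit f x = orbit f y" if xy: "x \<in> X" "y \<in> X" for x y
  proof -
    have self: "z \<in> orbit f z" if "z \<in> X" for z
      using Sf that by (rule self_in_orbit)
    consider "x \<in> M" "y \<in> M" | "x \<notin> M" "y \<notin> M" | "x \<in> M \<longleftrightarrow> y \<notin> M"
      by blast
    then show ?thesis
    proof cases
      case 1
      then show ?thesis
        using xy by (cases x, cases y) (auto simp: h_def orbit_pad X_def W_def M_def padding_def
            abstract_edges_padded_iff)
    next
      case 2
      then show ?thesis
        using xy by (simp add: h_def member_of_edge_def orbit_succ)
    next
      case 3
      then have "orbit f x \<noteq> orbit f y"
        using xy self[of x] self[of y] orbit_unpadded[of x] orbit_unpadded[of y] by auto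
      then show ?thesis
        using 3 by (auto simp: h_def member_of_edge_def)
    qed
  qed
  have hX: "h ` X = I"
  proof -
    have "h ` (X - M) = Inl ` orbit (successor ws J \<phi>) ` abstract_edges ws"
      by (auto simp: unpadded h_def member_of_edge_def image_image intro!: image_cong)
    moreover have "h ` (X \<inter> M) = Inr ` {..<length vs}"
    proof -
      have "X \<inter> M = (\<lambda>s. (length ws + s, 0)) ` {..<length vs}"
      proof (intro set_eqI iffI)
        fix x
        assume x: "x \<in> X \<inter> M"
        obtain i j where ij: "x = (i, j)"
          by (cases x)
        have "x = (length ws + (i - length ws), 0)" "i - length ws < length vs"
          using x by (auto simp: ij X_def M_def W_def padding_def abstract_edges_padded_iff)
        then show "x \<in> (\<lambda>s. (length ws + s, 0)) ` {..<length vs}"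
          by blast
      qed (auto simp: X_def M_def W_def padding_def abstract_edges_padded_iff)
      moreover have "h (length ws + s, 0) = Inr s" for s
        by (simp add: h_def M_def padding_def)
      ultimately show ?thesis
        by (simp add: image_image)
    qed
    moreover have "h ` X = h ` (X - M) \<union> h ` (X \<inter> M)"
      by blast
    ultimately show ?thesis
      by (simp add: I_def member_indices_def Plus_def)
  qed
  have hI: "h x \<in> I" if "x \<in> X" for x
    using that by (simp flip: hX)
  have m_h: "m (h x) = necklace_at lab vert f (M \<union> J) x" if x: "x \<in> X" for x
  proof (cases "x \<in> M")
    case True
    then show ?thesis
      using x by (simp add: m_def h_def member_def necklace_at_def orbit_pad vert_def start_vertex_def
          M_def[symmetric])
  next
    case False
    \<comment> \<open>\<open>member\<close> reads an orbit from a chosen point, so the comparison is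
      made there and carried back to \<open>x\<close> by independence of the base point.\<close>
    define y where "y = (SOME y. y \<in> orbit f x)"
    have "y \<in> orbit f x"
      unfolding y_def using orbit_nonempty[of f x] by (simp add: some_in_eq)
    then have y: "y \<in> X - M"
      using orbit_unpadded[of x] x False by blast
    have trav: "(\<lambda>n. (successor ws J \<phi> ^^ n) y) = (\<lambda>n. (f ^^ n) y)"
    proof
      fix n
      have "(successor ws J \<phi> ^^ n) y = (f ^^ n) y \<and> (f ^^ n) y \<in> X - M"
        using y f_unpadded f_succ by (induction n) auto
      then show "(successor ws J \<phi> ^^ n) y = (f ^^ n) y"
        by blast
    qed
    have sub: "set (traversal f y) \<subseteq> X - M"
      using Sf y orbit_unpadded[OF y] cycle_list_traversal(2)[of X f y]
      by (auto simp: necklace_structure_def)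
    have "orbit_necklace Q ws J \<phi> y = necklace_at lab vert f (M \<union> J) y"
    proof -
      have "orbit f y \<subseteq> J \<longleftrightarrow> orbit f y \<subseteq> M \<union> J"
        using orbit_unpadded[OF y] by auto
      moreover have "map (edge_of ws) (filter (\<lambda>z. z \<notin> J) (traversal f y)) =
          map lab (filter (\<lambda>z. z \<notin> M \<union> J) (traversal f y))"
        using sub by (induction "traversal f y") (auto simp: lab subset_iff
            intro!: map_cong filter_cong)
      ultimately show ?thesis
        using y by (simp add: orbit_necklace_def necklace_at_def Let_def trav traversal_def
            orbit_succ[symmetric] vert_def start_vertex_def M_def[symmetric])
    qed
    also have "\<dots> = necklace_at lab vert f (M \<union> J) x"
      unfolding y_def by (rule necklace_at_some_orbit[OF Sf x])
    finally show ?thesis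
      using False x by (simp add: m_def h_def member_def member_of_edge_def y_def orbit_succ)
  qed
  have finX: "finite X"
    using S by (simp add: necklace_structure_def)
  have finI: "finite I"
    unfolding hX[symmetric] using finX by simp
  have finJ: "finite J"
    by (rule finite_subset[OF J finite_abstract_edges])
  have h_f: "h (f x) = h x" if "x \<in> X" for x
  proof -
    have "f x \<in> X"
      using Sf that by (auto simp: necklace_structure_def bij_betw_def)
    then show ?thesis
      using h_iff[of "f x" x] that orbit_eq[OF Sf that orbit.base] by simp
  qed

  define B where "B = {x \<in> J. isl (lab x)}"
  \<comment> \<open>\<open>\<phi>\<close> exchanges the unreversed edges in \<open>J\<close> with
    the reversed ones, so the exponent of h/2 is the size of \<open>B\<close>.\<close>
  have J_card: "card J div 2 = card B"
  proof -
    have "J = B \<union> \<phi> ` B"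
    proof (intro set_eqI iffI)
      fix x
      assume x: "x \<in> J"
      show "x \<in> B \<union> \<phi> ` B"
      proof (cases "isl (lab x)")
        case False
        then have "\<phi> x \<in> B" "x = \<phi> (\<phi> x)"
          using x by (simp_all add: B_def \<phi>J \<phi>_lab' \<phi>_inv)
        then show ?thesis
          by blast
      qed (use x in \<open>simp add: B_def\<close>)
    qed (auto simp: B_def \<phi>J)
    moreover have "B \<inter> \<phi> ` B = {}"
      by (auto simp: B_def \<phi>_lab')
    moreover have "inj_on \<phi> B"
      by (rule inj_on_inverseI[of _ \<phi>]) (simp add: B_def \<phi>_inv)
    moreover have "finite B"
      using finJ by (simp add: B_def)
    ultimately have "card J = card B + card B"
      by (metis card_Un_disjoint card_image finite_imageI)
    then show ?thesis
      by simp
  qed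
  have weight: "pairing_weight lab \<phi>' A =
      (monom (1 / 2 ^ card B) (card B) * of_int (\<Prod>x\<in>B. if x \<in> A then 1 else - 1) :: 'k poly)" for A
  proof -
    have "{x. \<phi>' x \<noteq> x \<and> isl (lab x)} = B"
      using moved by (auto simp: B_def)
    moreover have "finite B"
      using finJ by (simp add: B_def)
    ultimately show ?thesis
      by (simp only: pairing_weight_def monom_times_sign)
  qed
  define colour_pair where "colour_pair c x =
    (if c (h x) < (c (h (\<phi> x)) :: nat) then 1 else if c (h x) = c (h (\<phi> x)) then 0 else - 1 :: int)"
    for c x
  have sign: "pairing_sign ws J \<phi> c = (\<Prod>x\<in>B. colour_pair c x)" for c
  proof -
    have "{x \<in> J. isl (edge_of ws x)} = B"
      using JX by (auto simp: B_def lab)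
    \<comment> \<open>The definition of the sign looks at \<open>x\<close> and the edge after
      \<open>x\<close>. The successor map sends the partner \<open>\<phi> x\<close> to that edge, so
      it lies in the orbit of the partner, and the sign compares the two partners.\<close>
    moreover have "member_of_edge ws J \<phi> x = h x" "member_of_edge ws J \<phi> (next_edge ws x) = h (\<phi> x)"
      if x: "x \<in> B" for x
    proof -
      have xJ: "x \<in> J"
        using x by (simp add: B_def)
      then have "h (\<phi> x) = h (f (\<phi> x))"
        using JX \<phi>J by (simp add: h_f)
      also have "f (\<phi> x) = next_edge ws x"
        using xJ \<phi>J JX by (simp add: f_def \<phi>'_def \<phi>_inv lab)
      also have "h (next_edge ws x) = member_of_edge ws J \<phi> (next_edge ws x)"
        using xJ J next_edge_image[of ws] unpadded by (auto simp: h_def)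
      finally show "member_of_edge ws J \<phi> (next_edge ws x) = h (\<phi> x)" ..
      show "member_of_edge ws J \<phi> x = h x"
        using xJ JX by (simp add: h_def)
    qed
    ultimately show ?thesis
      unfolding pairing_sign_def by (intro prod.cong) (simp_all add: Let_def colour_pair_def)
  qed
  define C where "C = {c \<in> I \<rightarrow>\<^sub>E {1, 2}. pairing_sign ws J \<phi> c \<noteq> 0}"
  have split_iff: "(\<phi>', A) \<in> splittings lab (next_edge W) M X \<longleftrightarrow>
      A \<subseteq> X \<and> f ` A \<subseteq> A \<and> (\<forall>x\<in>J. \<phi> x \<in> A \<longleftrightarrow> x \<notin> A)" for A
  proof -
    have "(\<forall>x. \<phi>' x \<noteq> x \<longrightarrow> (\<phi>' x \<in> A \<longleftrightarrow> x \<notin> A)) \<longleftrightarrow> (\<forall>x\<in>J. \<phi> x \<in> A \<longleftrightarrow> x \<notin> A)"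
      by (auto simp: \<phi>'_def moved_J)
    then show ?thesis
      using pairing by (simp add: splittings_def f_def X_def M_def lab_def)
  qed
  \<comment> \<open>The sign is a product over \<open>B\<close> only; the involution carries the
    inequality of colours to the other members of the pairs.\<close>
  have C_swap: "(c (h (\<phi> x)) = 1) \<longleftrightarrow> c (h x) \<noteq> 1" if c: "c \<in> C" and x: "x \<in> J" for c x
  proof -
    have val: "c (h z) = 1 \<or> c (h z) = 2" if "z \<in> X" for z
    proof -
      have "h z \<in> I"
        using that hX by blast
      then show ?thesis
        using c by (auto simp: C_def PiE_def Pi_def)
    qed
    have ne: "c (h z) \<noteq> c (h (\<phi> z))" if "z \<in> B" for z
    proof -
      have "finite B" "(\<Prod>x\<in>B. colour_pair c x) \<noteq> 0"
        using c finJ by (simp_all add: C_def sign B_def)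
      then have "colour_pair c z \<noteq> 0"
        using that by (metis prod_zero)
      then show ?thesis
        by (auto simp: colour_pair_def)
    qed
    have "c (h x) \<noteq> c (h (\<phi> x))"
    proof (cases "isl (lab x)")
      case False
      then have "\<phi> x \<in> B"
        using x by (simp add: B_def \<phi>J \<phi>_lab')
      then show ?thesis
        using ne[of "\<phi> x"] x by (simp add: \<phi>_inv)
    qed (use ne x in \<open>simp add: B_def\<close>)
    then show ?thesis
      using val[of x] val[of "\<phi> x"] JX x \<phi>J by fastforce
  qed
  let ?t = "\<lambda>A. Poly_Mapping.single (collection_of lab vert f (M \<union> moved \<phi>') A,
      collection_of lab vert f (M \<union> moved \<phi>') (X - A)) (pairing_weight lab \<phi>' A :: 'k poly)"
  have "scale (monom (1 / 2 ^ (card J div 2)) (card J div 2)) (pairing_term Q ws vs J \<phi>) =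
      (\<Sum>c\<in>I \<rightarrow>\<^sub>E {1, 2}. Poly_Mapping.single
        (image_mset m (mset_set {r \<in> I. c r = 1}), image_mset m (mset_set {r \<in> I. c r \<noteq> 1}))
        (monom (1 / 2 ^ card B) (card B) * of_int (pairing_sign ws J \<phi> c) :: 'k poly))"
    unfolding pairing_term_def I_def[symmetric] m_def[symmetric] J_card scale_sum
    by (simp add: prod_coloured[OF finI] mult_single flip: single_of_int)
  also have "\<dots> = (\<Sum>c\<in>C. Poly_Mapping.single
        (image_mset m (mset_set {r \<in> I. c r = 1}), image_mset m (mset_set {r \<in> I. c r \<noteq> 1}))
        (monom (1 / 2 ^ card B) (card B) * of_int (pairing_sign ws J \<phi> c)))"
    using finI by (intro sum.mono_neutral_right) (auto simp: C_def intro!: finite_PiE)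
  also have "\<dots> = (\<Sum>A | (\<phi>', A) \<in> splittings lab (next_edge W) M X. ?t A)"
  proof (rule sum.reindex_bij_witness[where i = "\<lambda>A. restrict (\<lambda>r. if r \<in> h ` A then 1 else 2) I"
        and j = "\<lambda>c. {x \<in> X. c (h x) = 1}"])
    fix c
    assume c: "c \<in> C"
    define A where "A = {x \<in> X. c (h x) = 1}"
    have c_val: "c r = 1 \<or> c r = 2" if "r \<in> I" for r
      using c that by (auto simp: C_def PiE_def Pi_def)
    have hA: "r \<in> h ` A \<longleftrightarrow> c r = 1" if "r \<in> I" for r
      using that hX by (auto simp: A_def)
    show "restrict (\<lambda>r. if r \<in> h ` {x \<in> X. c (h x) = 1} then 1 else 2) I = c"
      unfolding A_def[symmetric]
    proof
      fix r
      show "restrict (\<lambda>r. if r \<in> h ` A then 1 else 2) I r = c r"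
      proof (cases "r \<in> I")
        case True
        then show ?thesis
          using c_val[OF True] hA[OF True] by auto
      next
        case False
        then show ?thesis
          using c by (auto simp: C_def PiE_def extensional_def)
      qed
    qed
    have "f x \<in> A" if "x \<in> A" for x
      using that h_f[of x] Sf by (auto simp: A_def necklace_structure_def bij_betw_def)
    moreover have swap: "\<phi> x \<in> A \<longleftrightarrow> x \<notin> A" if "x \<in> J" for x
      using C_swap[OF c that] JX[OF that] JX[OF \<phi>J[OF that]] by (simp add: A_def)
    ultimately have split: "(\<phi>', A) \<in> splittings lab (next_edge W) M X"
      by (auto simp: split_iff A_def)
    then show "{x \<in> X. c (h x) = 1} \<in> {A. (\<phi>', A) \<in> splittings lab (next_edge W) M X}"
      by (simp add: A_def)
    have "colour_pair c x = (if x \<in> A then 1 else - 1)" if "x \<in> B" for x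
    proof -
      have xJ: "x \<in> J"
        using that by (simp add: B_def)
      have "c (h x) = 1 \<or> c (h x) = 2" "c (h (\<phi> x)) = 1 \<or> c (h (\<phi> x)) = 2"
        using c_val[OF hI[OF JX(1)[OF xJ]]] c_val[OF hI[OF JX(1)[OF \<phi>J[OF xJ]]]] by blast+
      then consider "c (h x) = 1" "c (h (\<phi> x)) = 2" | "c (h x) = 2" "c (h (\<phi> x)) = 1"
        using C_swap[OF c xJ] by force
      moreover have "x \<in> A \<longleftrightarrow> c (h x) = 1"
        using JX[OF xJ] by (simp add: A_def)
      ultimately show ?thesis
        by cases (simp_all add: colour_pair_def)
    qed
    then have "pairing_sign ws J \<phi> c = (\<Prod>x\<in>B. if x \<in> A then 1 else - 1)"
      unfolding sign by (intro prod.cong) simp_all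
    then have weight_A: "pairing_weight lab \<phi>' A =
        monom (1 / 2 ^ card B) (card B) * (of_int (pairing_sign ws J \<phi> c) :: 'k poly)"
      by (simp only: weight)
    have AX: "A \<subseteq> X"
      by (auto simp: A_def)
    note structures = necklace_structure_splitting[OF S split, folded f_def, unfolded moved]
    have coll: "collection_of lab vert f (M \<union> J) D = image_mset m (mset_set (h ` D))"
      if "necklace_structure Q lab vert f (M \<union> J) D" "D \<subseteq> X" for D
      using that(2) by (intro collection_of_eq[OF that(1)] h_iff m_h) auto
    have "collection_of lab vert f (M \<union> J) A = image_mset m (mset_set (h ` A))"
      by (rule coll[OF structures(1) AX])
    moreover have "collection_of lab vert f (M \<union> J) (X - A) = image_mset m (mset_set (h ` (X - A)))"
      by (rule coll[OF structures(2) Diff_subset])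
    moreover have "h ` A = {r \<in> I. c r = 1}"
      using hX by (auto simp: A_def)
    moreover have "h ` (X - A) = {r \<in> I. c r \<noteq> 1}"
      using hX by (auto simp: A_def)
    ultimately show "?t {x \<in> X. c (h x) = 1} = Poly_Mapping.single
        (image_mset m (mset_set {r \<in> I. c r = 1}), image_mset m (mset_set {r \<in> I. c r \<noteq> 1}))
        (monom (1 / 2 ^ card B) (card B) * of_int (pairing_sign ws J \<phi> c))"
      unfolding A_def[symmetric] by (simp add: weight_A moved)
  next
    fix A
    assume "A \<in> {A. (\<phi>', A) \<in> splittings lab (next_edge W) M X}"
    then have split: "(\<phi>', A) \<in> splittings lab (next_edge W) M X"
      by simp
    then have A: "A \<subseteq> X" "f ` A \<subseteq> A" and swap: "\<And>x. x \<in> J \<Longrightarrow> \<phi> x \<in> A \<longleftrightarrow> x \<notin> A"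
      by (auto simp: split_iff)
    define c where "c = restrict (\<lambda>r. if r \<in> h ` A then 1 else 2 :: nat) I"
    \<comment> \<open>\<open>A\<close> is a union of orbits, so it can be recovered from the indices
      of its members.\<close>
    have mem: "h x \<in> h ` A \<longleftrightarrow> x \<in> A" if x: "x \<in> X" for x
    proof
      assume "h x \<in> h ` A"
      then obtain y where y: "y \<in> A" "h x = h y"
        by blast
      then have "y \<in> X"
        using A(1) by blast
      then have "orbit f x = orbit f y"
        using h_iff[of x y] x y(2) by simp
      then have "x \<in> orbit f y"
        using self_in_orbit[OF Sf x] by simp
      then show "x \<in> A"
        using orbit_subset_closed[OF A(2) y(1)] by blast
    qed simp
    have c_h: "c (h x) = (if x \<in> A then 1 else 2)" if "x \<in> X" for x
      using hI[OF that] mem[OF that] by (simp add: c_def)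
    have "{x \<in> X. c (h x) = 1} = A"
      using A(1) c_h by (auto split: if_splits)
    then show "{x \<in> X. restrict (\<lambda>r. if r \<in> h ` A then 1 else 2 :: nat) I (h x) = 1} = A"
      unfolding c_def .
    have "colour_pair c x \<noteq> 0" if "x \<in> B" for x
    proof -
      have xJ: "x \<in> J"
        using that by (simp add: B_def)
      show ?thesis
        unfolding colour_pair_def c_h[OF JX(1)[OF xJ]] c_h[OF JX(1)[OF \<phi>J[OF xJ]]]
        using swap[OF xJ] by simp
    qed
    then have "pairing_sign ws J \<phi> c \<noteq> 0"
      using finJ by (simp add: sign B_def)
    moreover have "c \<in> I \<rightarrow>\<^sub>E {1, 2}"
      by (auto simp: c_def)
    ultimately show "restrict (\<lambda>r. if r \<in> h ` A then 1 else 2) I \<in> C"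
      unfolding C_def c_def by blast
  qed
  finally show "scale (monom (1 / 2 ^ (card J div 2)) (card J div 2)) (pairing_term Q ws vs J \<phi>) =
      (\<Sum>A | (\<phi>', A) \<in> splittings (edge_of W) (next_edge W) (padding ws) (abstract_edges W).
        Poly_Mapping.single
          (collection_of (edge_of W) (start_vertex Q ws vs) (next_edge W \<circ> \<phi>')
             (padding ws \<union> moved \<phi>') A,
           collection_of (edge_of W) (start_vertex Q ws vs) (next_edge W \<circ> \<phi>')
             (padding ws \<union> moved \<phi>') (abstract_edges W - A))
          (pairing_weight (edge_of W) \<phi>' A :: 'k poly))"
    by (simp only: lab_def vert_def f_def M_def X_def)
qed

section \<open>Coassociativity\<close>

lemma moyal_coproduct_presented_eq:
  assumes "presented_structure Q ws vs"
  shows "moyal_coproduct_presented Q ws vs =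
    (split_coproduct (edge_of (padded_words ws vs)) (start_vertex Q ws vs)
      (next_edge (padded_words ws vs)) (padding ws) (abstract_edges (padded_words ws vs)) ::
      _ \<Rightarrow>\<^sub>0 'k::field_char_0 poly)"
proof -
  let ?W = "padded_words ws vs"
  let ?X = "abstract_edges ?W"
  let ?E = "edge_pairings (edge_of ?W) (padding ws) ?X"
  let ?A = "\<lambda>\<phi>. {A. (\<phi>, A) \<in> splittings (edge_of ?W) (next_edge ?W) (padding ws) ?X}"
  let ?t = "\<lambda>\<phi> A. Poly_Mapping.single
    (collection_of (edge_of ?W) (start_vertex Q ws vs) (next_edge ?W \<circ> \<phi>)
       (padding ws \<union> moved \<phi>) A,
     collection_of (edge_of ?W) (start_vertex Q ws vs) (next_edge ?W \<circ> \<phi>)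
       (padding ws \<union> moved \<phi>) (?X - A))
    (pairing_weight (edge_of ?W) \<phi> A :: 'k poly)"
  have "moyal_coproduct_presented Q ws vs = (\<Sum>\<phi>\<in>?E. \<Sum>A\<in>?A \<phi>. ?t \<phi> A)"
    unfolding moyal_coproduct_presented_def
  proof (rule sum.reindex_bij_witness[where
        i = "\<lambda>\<phi>. (moved \<phi>, restrict \<phi> (moved \<phi>))" and
        j = "\<lambda>(J, \<phi>) x. if x \<in> J then \<phi> x else x"])
    fix p
    assume p: "p \<in> pairings ws"
    obtain J \<phi> where p_eq: "p = (J, \<phi>)"
      by (cases p)
    define \<phi>' where "\<phi>' = (\<lambda>x. if x \<in> J then \<phi> x else x)"
    note eq = pairing_term_eq(1)[OF assms p[unfolded p_eq], folded \<phi>'_def]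
      pairing_term_eq(2)[OF assms p[unfolded p_eq], where ?'k = 'k]
    have ne: "\<phi> x \<noteq> x" if "x \<in> J" for x
    proof
      assume "\<phi> x = x"
      moreover have "edge_of ws (\<phi> x) = edge_reversal (edge_of ws x)"
        using p that by (simp add: p_eq pairings_def)
      ultimately show False
        using edge_reversal_isl[of "edge_of ws x"] by metis
    qed
    then have moved: "moved \<phi>' = J"
      by (auto simp: \<phi>'_def)
    have "\<phi> \<in> extensional J"
      using p by (auto simp: p_eq pairings_def PiE_def)
    then have "restrict \<phi>' J = \<phi>"
      by (auto simp: \<phi>'_def extensional_def)
    then show "(moved ((\<lambda>(J, \<phi>) x. if x \<in> J then \<phi> x else x) p),
        restrict ((\<lambda>(J, \<phi>) x. if x \<in> J then \<phi> x else x) p)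
          (moved ((\<lambda>(J, \<phi>) x. if x \<in> J then \<phi> x else x) p))) = p"
      using moved by (simp add: p_eq flip: \<phi>'_def)
    show "(\<lambda>(J, \<phi>) x. if x \<in> J then \<phi> x else x) p \<in> ?E"
      using eq(1) by (simp add: p_eq flip: \<phi>'_def)
    show "(\<Sum>A\<in>?A ((\<lambda>(J, \<phi>) x. if x \<in> J then \<phi> x else x) p).
          ?t ((\<lambda>(J, \<phi>) x. if x \<in> J then \<phi> x else x) p) A) =
        (case p of (J, \<phi>) \<Rightarrow> scale (monom (1 / 2 ^ (card J div 2)) (card J div 2))
          (pairing_term Q ws vs J \<phi>))"
      by (simp only: p_eq prod.case eq(2))
  next
    fix \<phi>
    assume \<phi>: "\<phi> \<in> ?E"
    have inv: "\<phi> (\<phi> x) = x" for x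
      using \<phi> unfolding edge_pairings_def by blast
    have unpadded: "x \<in> abstract_edges ws \<and> x \<notin> padding ws" if "\<phi> x \<noteq> x" for x
      using that \<phi> unfolding edge_pairings_def abstract_edges_unpadded[of ws vs] by blast
    show "(\<lambda>(J, \<phi>) x. if x \<in> J then \<phi> x else x) (moved \<phi>, restrict \<phi> (moved \<phi>)) = \<phi>"
      by auto
    have "edge_of ws (\<phi> x) = edge_reversal (edge_of ws x)" if "\<phi> x \<noteq> x" for x
    proof -
      have "\<phi> (\<phi> x) \<noteq> \<phi> x"
        using that inv by simp
      then have "x \<notin> padding ws" "\<phi> x \<notin> padding ws"
        using unpadded that by blast+
      moreover have "edge_of ?W (\<phi> x) = edge_reversal (edge_of ?W x)"
        using that \<phi> unfolding edge_pairings_def by blast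
      ultimately show ?thesis
        by (simp add: padded_words_agree)
    qed
    moreover have "moved \<phi> \<subseteq> abstract_edges ws"
      using unpadded by auto
    ultimately show "(moved \<phi>, restrict \<phi> (moved \<phi>)) \<in> pairings ws"
      by (auto simp: pairings_def inv)
  qed
  also have "\<dots> = (\<Sum>(\<phi>, A)\<in>Sigma ?E ?A. ?t \<phi> A)"
  proof (rule sum.Sigma)
    have "?E \<subseteq> {\<phi>. \<phi> permutes ?X}"
      using edge_pairings_permutes by blast
    then show "finite ?E"
      by (rule finite_subset) (simp add: finite_permutations finite_abstract_edges)
    have "?A \<phi> \<subseteq> Pow ?X" for \<phi>
      by (auto simp: splittings_def)
    then show "\<forall>\<phi>\<in>?E. finite (?A \<phi>)"
      using finite_abstract_edges by (metis finite_Pow_iff finite_subset)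
  qed
  also have "Sigma ?E ?A = splittings (edge_of ?W) (next_edge ?W) (padding ws) ?X"
    by (auto simp: splittings_def)
  finally show ?thesis
    by (simp only: split_coproduct_def)
qed

lemma moyal_coproduct_collection_presented:
  assumes "wf_digraph Q" "P \<in> collections Q"
  obtains ws vs where "presents ws vs P" "presented_structure Q ws vs"
    "moyal_coproduct_collection Q P =
      (split_coproduct (edge_of (padded_words ws vs)) (start_vertex Q ws vs)
        (next_edge (padded_words ws vs)) (padding ws) (abstract_edges (padded_words ws vs)) ::
        _ \<Rightarrow>\<^sub>0 'k::field_char_0 poly)"
proof -
  obtain ws vs where wv: "(ws, vs) = (SOME (ws, vs). presents ws vs P)"
    by (metis surj_pair)
  have "\<exists>p. case p of (ws, vs) \<Rightarrow> presents ws vs P"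
    using presents_exists[OF assms(2)] by auto
  from someI_ex[OF this] have pres: "presents ws vs P"
    by (simp flip: wv)
  note S = presented_structure[OF assms pres]
  have "moyal_coproduct_collection Q P = (moyal_coproduct_presented Q ws vs :: _ \<Rightarrow>\<^sub>0 'k poly)"
    by (simp add: moyal_coproduct_collection_def flip: wv)
  then show ?thesis
    using that[OF pres S] moyal_coproduct_presented_eq[OF S] by simp
qed

text \<open>Here the choice of words disappears: the reduced structure and the chosen presentation
  have the same collection, hence the same split coproduct. A second coproduct can therefore be
  computed on the set used for the first.\<close>

lemma moyal_coproduct_collection_of:
  assumes Q: "wf_digraph Q" and S: "necklace_structure Q lab vert \<sigma> M X"
  shows "moyal_coproduct_collection Q (collection_of lab vert \<sigma> M X) =
    (split_coproduct lab vert \<sigma> M X :: _ \<Rightarrow>\<^sub>0 'k::field_char_0 poly)"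
proof -
  obtain \<sigma>' X' where S': "necklace_structure Q lab vert \<sigma>' M X'"
    and fixed: "\<And>x. x \<in> X' \<inter> M \<Longrightarrow> \<sigma>' x = x"
    and coll: "collection_of lab vert \<sigma>' M X' = collection_of lab vert \<sigma> M X"
    and split: "split_coproduct lab vert \<sigma>' M X' =
      (split_coproduct lab vert \<sigma> M X :: _ \<Rightarrow>\<^sub>0 'k poly)"
    using reduce_necklace_structure[OF S, where ?'k = 'k] by metis
  obtain ws vs where pres: "presents ws vs (collection_of lab vert \<sigma> M X)"
    and P: "presented_structure Q ws vs"
    and eq: "moyal_coproduct_collection Q (collection_of lab vert \<sigma> M X) =
      (split_coproduct (edge_of (padded_words ws vs)) (start_vertex Q ws vs)
        (next_edge (padded_words ws vs)) (padding ws) (abstract_edges (padded_words ws vs)) ::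
        _ \<Rightarrow>\<^sub>0 'k poly)"
    using moyal_coproduct_collection_presented[OF Q collection_of_in_collections[OF Q S],
        where ?'k = 'k] by metis
  have "split_coproduct lab vert \<sigma>' M X' =
    (split_coproduct (edge_of (padded_words ws vs)) (start_vertex Q ws vs)
      (next_edge (padded_words ws vs)) (padding ws) (abstract_edges (padded_words ws vs)) ::
      _ \<Rightarrow>\<^sub>0 'k poly)"
    by (rule split_coproduct_eq_presented[OF S' fixed _ P]) (simp_all add: coll pres)
  with eq split show ?thesis
    by simp
qed

lemma scale_one [simp]: "scale 1 F = F"
  by (rule poly_mapping_eqI) simp

lemma moyal_coproduct_single_collection_of:
  assumes "wf_digraph Q" "necklace_structure Q lab vert \<sigma> M X"
  shows "moyal_coproduct Q (Poly_Mapping.single (collection_of lab vert \<sigma> M X) 1) =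
    (split_coproduct lab vert \<sigma> M X :: _ \<Rightarrow>\<^sub>0 'k::field_char_0 poly)"
  by (simp add: moyal_coproduct_def moyal_coproduct_collection_of[OF assms])

text \<open>The first step leaves marked structures on \<open>A\<close> and on \<open>X - A\<close>,
  so the second coproduct is once more a \<open>split_coproduct\<close>, and the iterates become the
  double sums of \<open>iterated_split_coproduct_right\<close> and
  \<open>iterated_split_coproduct_left\<close>.\<close>

lemma split_coproduct_coassociative:
  assumes Q: "wf_digraph Q" and S: "necklace_structure Q lab vert \<sigma> M X"
  shows "tensor_map id (moyal_coproduct Q) (split_coproduct lab vert \<sigma> M X) =
      (triple_coproduct lab vert \<sigma> M X :: _ \<Rightarrow>\<^sub>0 'k::field_char_0 poly)"
    and "tensor_assoc (tensor_map (moyal_coproduct Q) id (split_coproduct lab vert \<sigma> M X)) =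
      (triple_coproduct lab vert \<sigma> M X :: _ \<Rightarrow>\<^sub>0 'k poly)"
proof -
  note structures = necklace_structure_splitting[OF S]
  let ?S = "splittings lab \<sigma> M X"
  let ?c = "\<lambda>\<phi>. collection_of lab vert (\<sigma> \<circ> \<phi>) (M \<union> moved \<phi>)"
  have right: "tensor (Poly_Mapping.single (?c \<phi> A) 1)
        (moyal_coproduct Q (Poly_Mapping.single (?c \<phi> (X - A)) 1)) =
      (\<Sum>(\<psi>, B)\<in>splittings lab (\<sigma> \<circ> \<phi>) (M \<union> moved \<phi>) (X - A). Poly_Mapping.single
        (?c \<phi> A,
         collection_of lab vert (\<sigma> \<circ> \<phi> \<circ> \<psi>) (M \<union> moved \<phi> \<union> moved \<psi>) B,
         collection_of lab vert (\<sigma> \<circ> \<phi> \<circ> \<psi>) (M \<union> moved \<phi> \<union> moved \<psi>) (X - A - B))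
        (pairing_weight lab \<psi> B :: 'k poly))" if "(\<phi>, A) \<in> ?S" for \<phi> A
    unfolding moyal_coproduct_single_collection_of[OF Q structures(2)[OF that]]
      split_coproduct_def case_prod_unfold tensor_single_left ..
  have left: "tensor (moyal_coproduct Q (Poly_Mapping.single (?c \<phi> A') 1))
        (Poly_Mapping.single (?c \<phi> (X - A')) 1) =
      (\<Sum>(\<psi>, A)\<in>splittings lab (\<sigma> \<circ> \<phi>) (M \<union> moved \<phi>) A'. Poly_Mapping.single
        ((collection_of lab vert (\<sigma> \<circ> \<phi> \<circ> \<psi>) (M \<union> moved \<phi> \<union> moved \<psi>) A,
          collection_of lab vert (\<sigma> \<circ> \<phi> \<circ> \<psi>) (M \<union> moved \<phi> \<union> moved \<psi>) (A' - A)),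
         ?c \<phi> (X - A'))
        (pairing_weight lab \<psi> A :: 'k poly))" if "(\<phi>, A') \<in> ?S" for \<phi> A'
    unfolding moyal_coproduct_single_collection_of[OF Q structures(1)[OF that]]
      split_coproduct_def case_prod_unfold tensor_single_right ..
  have "tensor_map id (moyal_coproduct Q) (split_coproduct lab vert \<sigma> M X) =
      (\<Sum>(\<phi>, A)\<in>?S. scale (pairing_weight lab \<phi> A)
        (tensor (Poly_Mapping.single (?c \<phi> A) 1)
          (moyal_coproduct Q (Poly_Mapping.single (?c \<phi> (X - A)) (1 :: 'k poly)))))"
    by (simp add: tensor_map_def split_coproduct_def linear_extension_sum case_prod_unfold)
  also have "\<dots> = (\<Sum>(\<phi>, A)\<in>?S. \<Sum>(\<psi>, B)\<in>splittings lab (\<sigma> \<circ> \<phi>) (M \<union> moved \<phi>) (X - A).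
      Poly_Mapping.single
        (?c \<phi> A,
         collection_of lab vert (\<sigma> \<circ> \<phi> \<circ> \<psi>) (M \<union> moved \<phi> \<union> moved \<psi>) B,
         collection_of lab vert (\<sigma> \<circ> \<phi> \<circ> \<psi>) (M \<union> moved \<phi> \<union> moved \<psi>) (X - A - B))
        (pairing_weight lab \<phi> A * pairing_weight lab \<psi> B))"
  proof (rule sum.cong[OF refl], clarify)
    fix \<phi> A
    assume "(\<phi>, A) \<in> ?S"
    from right[OF this] show "scale (pairing_weight lab \<phi> A)
        (tensor (Poly_Mapping.single (?c \<phi> A) 1)
          (moyal_coproduct Q (Poly_Mapping.single (?c \<phi> (X - A)) (1 :: 'k poly)))) =
      (\<Sum>(\<psi>, B)\<in>splittings lab (\<sigma> \<circ> \<phi>) (M \<union> moved \<phi>) (X - A). Poly_Mapping.single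
        (?c \<phi> A,
         collection_of lab vert (\<sigma> \<circ> \<phi> \<circ> \<psi>) (M \<union> moved \<phi> \<union> moved \<psi>) B,
         collection_of lab vert (\<sigma> \<circ> \<phi> \<circ> \<psi>) (M \<union> moved \<phi> \<union> moved \<psi>) (X - A - B))
        (pairing_weight lab \<phi> A * pairing_weight lab \<psi> B))"
      by (simp only: scale_sum case_prod_unfold scale_single)
  qed
  also have "\<dots> = triple_coproduct lab vert \<sigma> M X"
    by (rule iterated_split_coproduct_right[OF S])
  finally show "tensor_map id (moyal_coproduct Q) (split_coproduct lab vert \<sigma> M X) =
      (triple_coproduct lab vert \<sigma> M X :: _ \<Rightarrow>\<^sub>0 'k poly)" .
  have "tensor_map (moyal_coproduct Q) id (split_coproduct lab vert \<sigma> M X) =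
      (\<Sum>(\<phi>, A')\<in>?S. scale (pairing_weight lab \<phi> A')
        (tensor (moyal_coproduct Q (Poly_Mapping.single (?c \<phi> A') 1))
          (Poly_Mapping.single (?c \<phi> (X - A')) (1 :: 'k poly))))"
    by (simp add: tensor_map_def split_coproduct_def linear_extension_sum case_prod_unfold)
  then have "tensor_assoc (tensor_map (moyal_coproduct Q) id (split_coproduct lab vert \<sigma> M X)) =
      (\<Sum>(\<phi>, A')\<in>?S. tensor_assoc (scale (pairing_weight lab \<phi> A')
        (tensor (moyal_coproduct Q (Poly_Mapping.single (?c \<phi> A') 1))
          (Poly_Mapping.single (?c \<phi> (X - A')) (1 :: 'k poly)))))"
    by (simp only: tensor_assoc_def linear_extension_sum case_prod_unfold)
  also have "\<dots> = (\<Sum>(\<phi>, A')\<in>?S. \<Sum>(\<psi>, A)\<in>splittings lab (\<sigma> \<circ> \<phi>) (M \<union> moved \<phi>) A'.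
      Poly_Mapping.single
        (collection_of lab vert (\<sigma> \<circ> \<phi> \<circ> \<psi>) (M \<union> moved \<phi> \<union> moved \<psi>) A,
         collection_of lab vert (\<sigma> \<circ> \<phi> \<circ> \<psi>) (M \<union> moved \<phi> \<union> moved \<psi>) (A' - A),
         ?c \<phi> (X - A'))
        (pairing_weight lab \<phi> A' * pairing_weight lab \<psi> A))"
  proof (rule sum.cong[OF refl], clarify)
    fix \<phi> A'
    assume "(\<phi>, A') \<in> ?S"
    from left[OF this] show "tensor_assoc (scale (pairing_weight lab \<phi> A')
        (tensor (moyal_coproduct Q (Poly_Mapping.single (?c \<phi> A') 1))
          (Poly_Mapping.single (?c \<phi> (X - A')) (1 :: 'k poly)))) =
      (\<Sum>(\<psi>, A)\<in>splittings lab (\<sigma> \<circ> \<phi>) (M \<union> moved \<phi>) A'. Poly_Mapping.single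
        (collection_of lab vert (\<sigma> \<circ> \<phi> \<circ> \<psi>) (M \<union> moved \<phi> \<union> moved \<psi>) A,
         collection_of lab vert (\<sigma> \<circ> \<phi> \<circ> \<psi>) (M \<union> moved \<phi> \<union> moved \<psi>) (A' - A),
         ?c \<phi> (X - A'))
        (pairing_weight lab \<phi> A' * pairing_weight lab \<psi> A))"
      by (simp only: scale_sum case_prod_unfold scale_single tensor_assoc_def linear_extension_sum
          linear_extension_single fst_conv snd_conv mult_1_right)
  qed
  also have "\<dots> = triple_coproduct lab vert \<sigma> M X"
    by (rule iterated_split_coproduct_left[OF S])
  finally show "tensor_assoc (tensor_map (moyal_coproduct Q) id (split_coproduct lab vert \<sigma> M X)) =
      (triple_coproduct lab vert \<sigma> M X :: _ \<Rightarrow>\<^sub>0 'k poly)" .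
qed

text \<open>Terms of different splittings may share a key and cancel; a key with nonzero coefficient
  still comes from some splitting, whose two halves are marked structures.\<close>

lemma keys_split_coproduct:
  assumes Q: "wf_digraph Q" and S: "necklace_structure Q lab vert \<sigma> M X"
  shows "Poly_Mapping.keys (split_coproduct lab vert \<sigma> M X :: _ \<Rightarrow>\<^sub>0 'k::field_char_0 poly) \<subseteq>
    collections Q \<times> collections Q"
proof
  fix k
  assume "k \<in> Poly_Mapping.keys (split_coproduct lab vert \<sigma> M X :: _ \<Rightarrow>\<^sub>0 'k poly)"
  then have "(\<Sum>(\<phi>, A)\<in>splittings lab \<sigma> M X. Poly_Mapping.lookup (Poly_Mapping.single
      (collection_of lab vert (\<sigma> \<circ> \<phi>) (M \<union> moved \<phi>) A,
       collection_of lab vert (\<sigma> \<circ> \<phi>) (M \<union> moved \<phi>) (X - A))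
      (pairing_weight lab \<phi> A :: 'k poly)) k) \<noteq> 0"
    by (simp add: in_keys_iff split_coproduct_def lookup_sum case_prod_unfold)
  then obtain \<phi> A where split: "(\<phi>, A) \<in> splittings lab \<sigma> M X"
    and "Poly_Mapping.lookup (Poly_Mapping.single
      (collection_of lab vert (\<sigma> \<circ> \<phi>) (M \<union> moved \<phi>) A,
       collection_of lab vert (\<sigma> \<circ> \<phi>) (M \<union> moved \<phi>) (X - A))
      (pairing_weight lab \<phi> A :: 'k poly)) k \<noteq> 0"
    by (auto elim: sum.not_neutral_contains_not_neutral)
  then have "k = (collection_of lab vert (\<sigma> \<circ> \<phi>) (M \<union> moved \<phi>) A,
      collection_of lab vert (\<sigma> \<circ> \<phi>) (M \<union> moved \<phi>) (X - A))"
    by (auto simp: lookup_single when_def split: if_splits)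
  then show "k \<in> collections Q \<times> collections Q"
    using collection_of_in_collections[OF Q necklace_structure_splitting(1)[OF S split]]
      collection_of_in_collections[OF Q necklace_structure_splitting(2)[OF S split]] by simp
qed

theorem mainTheorem6:
  fixes Q :: "('v, 'e) pre_digraph"
    and P :: "('v, 'e) collection \<Rightarrow>\<^sub>0 'k::field_char_0 poly"
  assumes "wf_digraph Q"
    and "P \<in> Sym_L Q"
  shows "moyal_coproduct Q P \<in> Sym_L_tensor_Sym_L Q \<and>
    tensor_map id (moyal_coproduct Q) (moyal_coproduct Q P) =
    tensor_assoc (tensor_map (moyal_coproduct Q) id (moyal_coproduct Q P))"
proof
  let ?D = "\<lambda>a. moyal_coproduct_collection Q a :: _ \<Rightarrow>\<^sub>0 'k poly"
  have keys: "a \<in> collections Q" if "a \<in> Poly_Mapping.keys P" for a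
    using that assms(2) by (auto simp: Sym_L_def free_module_def)
  have P: "moyal_coproduct Q P =
      (\<Sum>a\<in>Poly_Mapping.keys P. scale (Poly_Mapping.lookup P a) (?D a))"
    by (simp add: moyal_coproduct_def linear_extension_def)
  \<comment> \<open>By linearity it suffices to treat a single collection, whose coproduct is that
    of the marked structure of its chosen presentation.\<close>
  have D: "Poly_Mapping.keys (?D a) \<subseteq> collections Q \<times> collections Q"
    "tensor_map id (moyal_coproduct Q) (?D a) =
      tensor_assoc (tensor_map (moyal_coproduct Q) id (?D a))"
    if a_coll: "a \<in> collections Q" for a
  proof -
    obtain ws vs where S: "presented_structure Q ws vs"
      and a: "?D a = split_coproduct (edge_of (padded_words ws vs)) (start_vertex Q ws vs)
        (next_edge (padded_words ws vs)) (padding ws) (abstract_edges (padded_words ws vs))"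
      using moyal_coproduct_collection_presented[OF assms(1) a_coll, where ?'k = 'k] by metis
    show "Poly_Mapping.keys (?D a) \<subseteq> collections Q \<times> collections Q"
      unfolding a by (rule keys_split_coproduct[OF assms(1) S])
    show "tensor_map id (moyal_coproduct Q) (?D a) =
        tensor_assoc (tensor_map (moyal_coproduct Q) id (?D a))"
      unfolding a split_coproduct_coassociative[OF assms(1) S] ..
  qed
  have "k \<in> collections Q \<times> collections Q"
    if "k \<in> Poly_Mapping.keys (moyal_coproduct Q P)" for k
  proof -
    have "(\<Sum>a\<in>Poly_Mapping.keys P. Poly_Mapping.lookup P a * Poly_Mapping.lookup (?D a) k) \<noteq> 0"
      using that by (simp add: in_keys_iff P lookup_sum)
    then obtain a where "a \<in> Poly_Mapping.keys P" "Poly_Mapping.lookup (?D a) k \<noteq> 0"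
      by (metis (no_types, lifting) mult_zero_right sum.neutral)
    then show ?thesis
      using D(1)[OF keys, of a] by (meson in_keys_iff subsetD)
  qed
  then show "moyal_coproduct Q P \<in> Sym_L_tensor_Sym_L Q"
    by (auto simp: Sym_L_tensor_Sym_L_def free_module_def)
  show "tensor_map id (moyal_coproduct Q) (moyal_coproduct Q P) =
      tensor_assoc (tensor_map (moyal_coproduct Q) id (moyal_coproduct Q P))"
    using D(2)[OF keys]
    by (simp add: P tensor_map_def tensor_assoc_def linear_extension_sum linear_extension_scale)
qed

end
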